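(* Let $R$ be a noetherian ring with identity such that finitely generated left $R$-modules have unique minimal resolutions up to isomorphism (for example, a noetherian local ring), and let $M$ be a finitely generated left $R$-module. If $\mathfrak{G}$ is a minimal basis of $M$ and $\mathfrak{R}$ is a relationship set, with relationship matrix $A_{\mathfrak{G},\mathfrak{R}}$, then $$\mathrm{dn}(M)=\max_{A\sim A_{\mathfrak{G},\mathfrak{R}}}\{\mathrm{bn}(A)\}.$$
   Context: A minimal basis of a module is a minimal generating set. Relationship sets. Let $\mathfrak{G}=\{g_i\}$ be a set of nonzero generators of $M$, and let $F=\sum Re_i$ be the associated free module with free basis $\{e_i\}$. The relationship submodule of $F$ is $\{\sum r_ie_i\mid \sum r_ig_i=0\}$, and a relationship set $\mathfrak{R}$ is a set of generators of the relationship submodule. When $\mathfrak{G}$ has $v$ elements and $\mathfrak{R}$ has $u$ elements, the relationship matrix $A_{\mathfrak{G},\mathfrak{R}}=(a_{ij})_{u\times v}$ is the matrix whose rows $(a_{i1},\dots,a_{iv})$ correspond to the elements $\sum_j a_{ij}e_j$ of $\mathfrak{R}$. Decomposition number. Each relationship set $\mathfrak{R}$ defines an equivalence relation on $\{e_i\}$: the one generated by $e_i\sim e_j$ whenever some element $\sum_k r_ke_k\in\mathfrak{R}$ has $r_i\neq0$ and $r_j\ne0$. Let $n_{\mathfrak{G},\mathfrak{R}}$ be its number of equivalence classes. The decomposition number of an arbitrary $R$-module is $\mathrm{dn}(M)=\sup_{\mathfrak{G},\mathfrak{R}}\{n_{\mathfrak{G},\mathfrak{R}}\}$, over all sets $\mathfrak{G}$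 of nonzero generators of $M$ and all relationship sets $\mathfrak{R}$. When $M$ satisfies the Krull-Schmidt condition (any two decompositions of $M$ as finite direct sums of indecomposables share the same summands up to isomorphism and counting multiplicities) with indecomposable decomposition $M=I_1\oplus\cdots\oplus I_n$, $\mathrm{dn}(M)$ is defined as $n$. Blocks. Two matrices $A$ and $A'$ of the same size over $R$ are equivalent, $A\sim A'$, if $A'=P\cdot A\cdot Q$ for invertible square matrices $P$ and $Q$ over $R$. A $u\times v$ matrix $A$ over $R$ has $t$ disjoint columns (blocks) if there are $t$ pairwise disjoint sets of columns, the $k$-th ($1\le k\le t$) consisting of $n_k>0$ columns of $A$, such that the nonzero rows of these $n_k$ columns (the rows in which at least one of these columns has a nonzero entry) have entries zero in all other $v-n_k$ columns. The maximal number of blocks is the block number $\mathrm{bn}(A)$. *)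

theory Defs
  imports
    "HOL-Algebra.Module"
    "HOL-Algebra.AbelCoset"
    "HOL-Library.Extended_Nat"
    "HOL.Hull"
    "Jordan_Normal_Form.Matrix"
begin

section \<open>Left modules over a ring that need not be commutative\<close>

text \<open>The locale of \<^theory>\<open>HOL-Algebra.Module\<close> requires a commutative ring; the axioms
  are otherwise the same. The locale \<^locale>\<open>submodule\<close> does not use commutativity.\<close>

locale left_module = R?: ring + M?: abelian_group M for M (structure) +
  assumes smult_closed [simp, intro]:
      "\<lbrakk>a \<in> carrier R; x \<in> carrier M\<rbrakk> \<Longrightarrow> a \<odot>\<^bsub>M\<^esub> x \<in> carrier M"
    and smult_l_distr:
      "\<lbrakk>a \<in> carrier R; b \<in> carrier R; x \<in> carrier M\<rbrakk> \<Longrightarrow>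
        (a \<oplus> b) \<odot>\<^bsub>M\<^esub> x = a \<odot>\<^bsub>M\<^esub> x \<oplus>\<^bsub>M\<^esub> b \<odot>\<^bsub>M\<^esub> x"
    and smult_r_distr:
      "\<lbrakk>a \<in> carrier R; x \<in> carrier M; y \<in> carrier M\<rbrakk> \<Longrightarrow>
        a \<odot>\<^bsub>M\<^esub> (x \<oplus>\<^bsub>M\<^esub> y) = a \<odot>\<^bsub>M\<^esub> x \<oplus>\<^bsub>M\<^esub> a \<odot>\<^bsub>M\<^esub> y"
    and smult_assoc1:
      "\<lbrakk>a \<in> carrier R; b \<in> carrier R; x \<in> carrier M\<rbrakk> \<Longrightarrow>
        (a \<otimes> b) \<odot>\<^bsub>M\<^esub> x = a \<odot>\<^bsub>M\<^esub> (b \<odot>\<^bsub>M\<^esub> x)"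
    and smult_one [simp]: "x \<in> carrier M \<Longrightarrow> \<one> \<odot>\<^bsub>M\<^esub> x = x"

definition lm_hom ::
  "('a, 'x) ring_scheme \<Rightarrow> ('a, 'b, 'y) module_scheme \<Rightarrow> ('a, 'c, 'z) module_scheme \<Rightarrow> ('b \<Rightarrow> 'c) set"
  where "lm_hom R M N = {f. f \<in> carrier M \<rightarrow> carrier N \<and>
    (\<forall>x\<in>carrier M. \<forall>y\<in>carrier M. f (x \<oplus>\<^bsub>M\<^esub> y) = f x \<oplus>\<^bsub>N\<^esub> f y) \<and>
    (\<forall>a\<in>carrier R. \<forall>x\<in>carrier M. f (a \<odot>\<^bsub>M\<^esub> x) = a \<odot>\<^bsub>N\<^esub> f x)}"

definition lm_iso ::
  "('a, 'x) ring_scheme \<Rightarrow> ('a, 'b, 'y) module_scheme \<Rightarrow> ('a, 'c, 'z) module_scheme \<Rightarrow> ('b \<Rightarrow> 'c) set"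
  where "lm_iso R M N = {f \<in> lm_hom R M N. bij_betw f (carrier M) (carrier N)}"

definition generates :: "('a, 'x) ring_scheme \<Rightarrow> ('a, 'b, 'y) module_scheme \<Rightarrow> 'b set \<Rightarrow> bool"
  where "generates R M S \<longleftrightarrow>
    S \<subseteq> carrier M \<and> (\<lambda>N. submodule N R M) hull S = carrier M"

definition finitely_generated :: "('a, 'x) ring_scheme \<Rightarrow> ('a, 'b, 'y) module_scheme \<Rightarrow> bool"
  where "finitely_generated R M \<longleftrightarrow> (\<exists>S. finite S \<and> generates R M S)"

text \<open>Minimality of a generating set is with respect to inclusion.\<close>

definition minimal_basis :: "('a, 'x) ring_scheme \<Rightarrow> ('a, 'b, 'y) module_scheme \<Rightarrow> 'b set \<Rightarrow> bool"
  where "minimal_basis R M S \<longleftrightarrow> generates R M S \<and> (\<forall>T. T \<subset> S \<longrightarrow> \<not> generates R M T)"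

definition left_ideal :: "('a, 'x) ring_scheme \<Rightarrow> 'a set \<Rightarrow> bool"
  where "left_ideal R I \<longleftrightarrow>
    additive_subgroup I R \<and> (\<forall>a\<in>carrier R. \<forall>x\<in>I. a \<otimes>\<^bsub>R\<^esub> x \<in> I)"

definition left_noetherian :: "('a, 'x) ring_scheme \<Rightarrow> bool"
  where "left_noetherian R \<longleftrightarrow> ring R \<and>
    (\<forall>I. left_ideal R I \<longrightarrow> (\<exists>S. finite S \<and> S \<subseteq> I \<and> left_ideal R hull S = I))"


section \<open>Free modules and minimal resolutions\<close>

text \<open>The free left module on an index set: finitely supported coefficient functions. The
  multiplicative fields of the record are irrelevant.\<close>

definition free_module :: "('a, 'x) ring_scheme \<Rightarrow> 'i set \<Rightarrow> ('a, 'i \<Rightarrow> 'a) module"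
  where "free_module R X =
    \<lparr>carrier = {f. (\<forall>i\<in>X. f i \<in> carrier R) \<and> (\<forall>i. i \<notin> X \<longrightarrow> f i = \<zero>\<^bsub>R\<^esub>) \<and>
                   finite {i. f i \<noteq> \<zero>\<^bsub>R\<^esub>}},
     monoid.mult = undefined, one = undefined,
     zero = (\<lambda>_. \<zero>\<^bsub>R\<^esub>),
     add = (\<lambda>f g i. f i \<oplus>\<^bsub>R\<^esub> g i),
     smult = (\<lambda>a f i. a \<otimes>\<^bsub>R\<^esub> f i)\<rparr>"

definition free_unit :: "('a, 'x) ring_scheme \<Rightarrow> 'i \<Rightarrow> ('i \<Rightarrow> 'a)"
  where "free_unit R j = (\<lambda>i. if i = j then \<one>\<^bsub>R\<^esub> else \<zero>\<^bsub>R\<^esub>)"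

abbreviation free_rank :: "('a, 'x) ring_scheme \<Rightarrow> nat \<Rightarrow> ('a, nat \<Rightarrow> 'a) module"
  where "free_rank R n \<equiv> free_module R {..<n}"

text \<open>A resolution of \<open>M\<close> by free modules of finite rank:
  \<open>eps\<close> is the augmentation \<open>F\<^sub>0 \<rightarrow> M\<close> and \<open>d i\<close> is the differential \<open>F\<^sub>i\<^sub>+\<^sub>1 \<rightarrow> F\<^sub>i\<close>, where
  \<open>F\<^sub>i\<close> has rank \<open>n i\<close>. Finite resolutions are those with \<open>n i = 0\<close> for large \<open>i\<close>.\<close>

definition free_resolution ::
  "('a, 'x) ring_scheme \<Rightarrow> ('a, 'b, 'y) module_scheme \<Rightarrow> (nat \<Rightarrow> nat) \<Rightarrow>
   ((nat \<Rightarrow> 'a) \<Rightarrow> 'b) \<Rightarrow> (nat \<Rightarrow> (nat \<Rightarrow> 'a) \<Rightarrow> (nat \<Rightarrow> 'a)) \<Rightarrow> bool"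
  where "free_resolution R M n eps d \<longleftrightarrow>
    eps \<in> lm_hom R (free_rank R (n 0)) M \<and>
    eps ` carrier (free_rank R (n 0)) = carrier M \<and>
    (\<forall>i. d i \<in> lm_hom R (free_rank R (n (Suc i))) (free_rank R (n i))) \<and>
    d 0 ` carrier (free_rank R (n 1)) = a_kernel (free_rank R (n 0)) M eps \<and>
    (\<forall>i. d (Suc i) ` carrier (free_rank R (n (Suc (Suc i)))) =
         a_kernel (free_rank R (n (Suc i))) (free_rank R (n i)) (d i))"

text \<open>The free basis of \<open>R\<^sup>n\<close> is mapped bijectively onto a minimal basis of the module \<open>N\<close>.\<close>

definition minimal_on_basis ::
  "('a, 'x) ring_scheme \<Rightarrow> nat \<Rightarrow> ('a, 'b, 'y) module_scheme \<Rightarrow> ((nat \<Rightarrow> 'a) \<Rightarrow> 'b) \<Rightarrow> bool"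
  where "minimal_on_basis R n N f \<longleftrightarrow>
    inj_on (\<lambda>j. f (free_unit R j)) {..<n} \<and>
    minimal_basis R N ((\<lambda>j. f (free_unit R j)) ` {..<n})"

definition minimal_resolution ::
  "('a, 'x) ring_scheme \<Rightarrow> ('a, 'b, 'y) module_scheme \<Rightarrow> (nat \<Rightarrow> nat) \<Rightarrow>
   ((nat \<Rightarrow> 'a) \<Rightarrow> 'b) \<Rightarrow> (nat \<Rightarrow> (nat \<Rightarrow> 'a) \<Rightarrow> (nat \<Rightarrow> 'a)) \<Rightarrow> bool"
  where "minimal_resolution R M n eps d \<longleftrightarrow>
    free_resolution R M n eps d \<and>
    minimal_on_basis R (n 0) M eps \<and>
    (\<forall>i. minimal_on_basis R (n (Suc i))
      ((free_rank R (n i))\<lparr>carrier := d i ` carrier (free_rank R (n (Suc i)))\<rparr>) (d i))"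

text \<open>Isomorphism of the complexes of free modules; on the resolved module it induces an
  automorphism, not necessarily the identity.\<close>

definition resolutions_isomorphic ::
  "('a, 'x) ring_scheme \<Rightarrow> (nat \<Rightarrow> nat) \<Rightarrow> (nat \<Rightarrow> (nat \<Rightarrow> 'a) \<Rightarrow> (nat \<Rightarrow> 'a)) \<Rightarrow>
   (nat \<Rightarrow> nat) \<Rightarrow> (nat \<Rightarrow> (nat \<Rightarrow> 'a) \<Rightarrow> (nat \<Rightarrow> 'a)) \<Rightarrow> bool"
  where "resolutions_isomorphic R n d n' d' \<longleftrightarrow>
    (\<exists>\<phi>. (\<forall>i. \<phi> i \<in> lm_iso R (free_rank R (n i)) (free_rank R (n' i))) \<and>
         (\<forall>i. \<forall>x\<in>carrier (free_rank R (n (Suc i))). \<phi> i (d i x) = d' i (\<phi> (Suc i) x)))"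

text \<open>Every finitely generated left module is isomorphic to a quotient of some \<open>R\<^sup>n\<close>, whose
  elements are cosets in \<open>R\<^sup>n\<close>. Hence modules with elements of type \<open>(nat \<Rightarrow> 'a) set\<close>
  represent all finitely generated left \<open>R\<close>-modules.\<close>

definition unique_minimal_resolutions :: "('a, 'x) ring_scheme \<Rightarrow> bool"
  where "unique_minimal_resolutions R \<longleftrightarrow>
    (\<forall>N :: ('a, (nat \<Rightarrow> 'a) set) module.
      left_module R N \<and> finitely_generated R N \<longrightarrow>
        (\<exists>n eps d. minimal_resolution R N n eps d) \<and>
        (\<forall>n eps d n' eps' d'.
          minimal_resolution R N n eps d \<and> minimal_resolution R N n' eps' d' \<longrightarrow>
          resolutions_isomorphic R n d n' d'))"


section \<open>Relationship sets and the decomposition number\<close>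

text \<open>As \<open>G\<close> is a set of generators, the free basis \<open>{e\<^sub>i}\<close> is indexed by the generators
  themselves; an element of \<open>free_module R G\<close> assigns to each generator its coefficient.\<close>

definition relationship_submodule ::
  "('a, 'x) ring_scheme \<Rightarrow> ('a, 'b, 'y) module_scheme \<Rightarrow> 'b set \<Rightarrow> ('b \<Rightarrow> 'a) set"
  where "relationship_submodule R M G =
    {r \<in> carrier (free_module R G). (\<Oplus>\<^bsub>M\<^esub>g\<in>{g\<in>G. r g \<noteq> \<zero>\<^bsub>R\<^esub>}. r g \<odot>\<^bsub>M\<^esub> g) = \<zero>\<^bsub>M\<^esub>}"

definition relationship_set ::
  "('a, 'x) ring_scheme \<Rightarrow> ('a, 'b, 'y) module_scheme \<Rightarrow> 'b set \<Rightarrow> ('b \<Rightarrow> 'a) set \<Rightarrow> bool"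
  where "relationship_set R M G S \<longleftrightarrow>
    generates R ((free_module R G)\<lparr>carrier := relationship_submodule R M G\<rparr>) S"

definition relationship_matrix ::
  "nat \<Rightarrow> nat \<Rightarrow> (nat \<Rightarrow> 'b) \<Rightarrow> (nat \<Rightarrow> 'b \<Rightarrow> 'a) \<Rightarrow> 'a mat"
  where "relationship_matrix u v g r = mat u v (\<lambda>(i, j). r i (g j))"

definition link_relation ::
  "('a, 'x) ring_scheme \<Rightarrow> 'b set \<Rightarrow> ('b \<Rightarrow> 'a) set \<Rightarrow> ('b \<times> 'b) set"
  where "link_relation R G S =
    equiv G hull {(x, y) \<in> G \<times> G. \<exists>r\<in>S. r x \<noteq> \<zero>\<^bsub>R\<^esub> \<and> r y \<noteq> \<zero>\<^bsub>R\<^esub>}"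

definition enat_card :: "'s set \<Rightarrow> enat"
  where "enat_card X = (if finite X then enat (card X) else \<infinity>)"

definition class_number ::
  "('a, 'x) ring_scheme \<Rightarrow> 'b set \<Rightarrow> ('b \<Rightarrow> 'a) set \<Rightarrow> enat"
  where "class_number R G S = enat_card (G // link_relation R G S)"

definition indecomposable :: "('a, 'x) ring_scheme \<Rightarrow> ('a, 'b, 'y) module_scheme \<Rightarrow> bool"
  where "indecomposable R M \<longleftrightarrow> carrier M \<noteq> {\<zero>\<^bsub>M\<^esub>} \<and>
    (\<forall>A B. submodule A R M \<and> submodule B R M \<and>
      A \<inter> B = {\<zero>\<^bsub>M\<^esub>} \<and> A <+>\<^bsub>M\<^esub> B = carrier M \<longrightarrow> A = {\<zero>\<^bsub>M\<^esub>} \<or> B = {\<zero>\<^bsub>M\<^esub>})"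

definition direct_decomposition ::
  "('a, 'x) ring_scheme \<Rightarrow> ('a, 'b, 'y) module_scheme \<Rightarrow> nat \<Rightarrow> (nat \<Rightarrow> 'b set) \<Rightarrow> bool"
  where "direct_decomposition R M n N \<longleftrightarrow>
    (\<forall>i<n. submodule (N i) R M) \<and>
    (\<forall>x\<in>carrier M. \<exists>!f. f \<in> (\<Pi>\<^sub>E i\<in>{..<n}. N i) \<and> (\<Oplus>\<^bsub>M\<^esub>i\<in>{..<n}. f i) = x)"

definition indecomposable_decomposition ::
  "('a, 'x) ring_scheme \<Rightarrow> ('a, 'b, 'y) module_scheme \<Rightarrow> nat \<Rightarrow> (nat \<Rightarrow> 'b set) \<Rightarrow> bool"
  where "indecomposable_decomposition R M n N \<longleftrightarrow>
    direct_decomposition R M n N \<and> (\<forall>i<n. indecomposable R (M\<lparr>carrier := N i\<rparr>))"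

definition krull_schmidt :: "('a, 'x) ring_scheme \<Rightarrow> ('a, 'b, 'y) module_scheme \<Rightarrow> bool"
  where "krull_schmidt R M \<longleftrightarrow>
    (\<exists>n N. indecomposable_decomposition R M n N) \<and>
    (\<forall>n N m L.
      indecomposable_decomposition R M n N \<and> indecomposable_decomposition R M m L \<longrightarrow>
      (\<exists>\<pi>. bij_betw \<pi> {..<n} {..<m} \<and>
        (\<forall>i<n. lm_iso R (M\<lparr>carrier := N i\<rparr>) (M\<lparr>carrier := L (\<pi> i)\<rparr>) \<noteq> {})))"

text \<open>The two clauses in the definition of the decomposition number: the number of
  indecomposable summands in the Krull-Schmidt case, and the supremum in general.\<close>

definition decomposition_number ::
  "('a, 'x) ring_scheme \<Rightarrow> ('a, 'b, 'y) module_scheme \<Rightarrow> enat"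
  where "decomposition_number R M =
    (if krull_schmidt R M
     then enat (THE n. \<exists>N. indecomposable_decomposition R M n N)
     else Sup {class_number R G S | G S.
       generates R M G \<and> \<zero>\<^bsub>M\<^esub> \<notin> G \<and> relationship_set R M G S})"


section \<open>Matrices and blocks\<close>

text \<open>The type of matrices is used as a container only: its arithmetic is tied to type classes,
  whereas here the entries are multiplied in the ring \<open>R\<close>.\<close>

definition matrices :: "('a, 'x) ring_scheme \<Rightarrow> nat \<Rightarrow> nat \<Rightarrow> 'a mat set"
  where "matrices R u v = {A \<in> carrier_mat u v. \<forall>i<u. \<forall>j<v. A $$ (i, j) \<in> carrier R}"

definition ring_mat_mult :: "('a, 'x) ring_scheme \<Rightarrow> 'a mat \<Rightarrow> 'a mat \<Rightarrow> 'a mat"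
  where "ring_mat_mult R A B = mat (dim_row A) (dim_col B)
    (\<lambda>(i, j). \<Oplus>\<^bsub>R\<^esub>k\<in>{..<dim_col A}. A $$ (i, k) \<otimes>\<^bsub>R\<^esub> B $$ (k, j))"

definition ring_mat_one :: "('a, 'x) ring_scheme \<Rightarrow> nat \<Rightarrow> 'a mat"
  where "ring_mat_one R n = mat n n (\<lambda>(i, j). if i = j then \<one>\<^bsub>R\<^esub> else \<zero>\<^bsub>R\<^esub>)"

definition ring_mat_invertible :: "('a, 'x) ring_scheme \<Rightarrow> nat \<Rightarrow> 'a mat \<Rightarrow> bool"
  where "ring_mat_invertible R n P \<longleftrightarrow> P \<in> matrices R n n \<and>
    (\<exists>P'\<in>matrices R n n.
      ring_mat_mult R P P' = ring_mat_one R n \<and> ring_mat_mult R P' P = ring_mat_one R n)"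

definition mat_equivalent :: "('a, 'x) ring_scheme \<Rightarrow> nat \<Rightarrow> nat \<Rightarrow> 'a mat \<Rightarrow> 'a mat \<Rightarrow> bool"
  where "mat_equivalent R u v A A' \<longleftrightarrow> A \<in> matrices R u v \<and> A' \<in> matrices R u v \<and>
    (\<exists>P Q. ring_mat_invertible R u P \<and> ring_mat_invertible R v Q \<and>
      A' = ring_mat_mult R (ring_mat_mult R P A) Q)"

definition has_blocks :: "('a, 'x) ring_scheme \<Rightarrow> 'a mat \<Rightarrow> nat \<Rightarrow> bool"
  where "has_blocks R A t \<longleftrightarrow>
    (\<exists>C :: nat \<Rightarrow> nat set.
      (\<forall>k<t. C k \<noteq> {} \<and> C k \<subseteq> {..<dim_col A}) \<and>
      disjoint_family_on C {..<t} \<and>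
      (\<forall>k<t. \<forall>i<dim_row A. (\<exists>j\<in>C k. A $$ (i, j) \<noteq> \<zero>\<^bsub>R\<^esub>) \<longrightarrow>
        (\<forall>j\<in>{..<dim_col A} - C k. A $$ (i, j) = \<zero>\<^bsub>R\<^esub>)))"

definition block_number :: "('a, 'x) ring_scheme \<Rightarrow> 'a mat \<Rightarrow> nat"
  where "block_number R A = Max {t. has_blocks R A t}"

end

theory Submission
  imports Defs
begin

text \<open>
  Both sides of the theorem equal the largest number \<open>t\<close> such that \<open>M\<close> is a direct sum of \<open>t\<close>
  nonzero submodules.

  \<^emph>\<open>The decomposition number.\<close> A decomposition with the largest number of nonzero summands has
  indecomposable summands, so under the Krull-Schmidt condition its length is the number of
  indecomposable summands. Without this condition one compares with class numbers: the classes of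
  linked generators span the summands of a direct decomposition, and conversely the nonzero elements
  of the summands of a given decomposition, with all relations inside single summands, have at least
  as many classes as there are summands (\<open>decomposition_number_eqI\<close>).

  \<^emph>\<open>Blocks give summands.\<close> The relationship matrix \<open>A\<close> presents \<open>M\<close> as the quotient of \<open>R\<^sup>v\<close> by
  the span of the rows. An equivalent matrix presents \<open>M\<close> with respect to another basis of \<open>R\<^sup>v\<close>. If
  it has \<open>t\<close> blocks, then colouring the columns by blocks makes every row monochrome, and the images
  of the coordinate submodules of the colours form a direct decomposition. No summand vanishes, since
  otherwise fewer than \<open>v\<close> elements would generate \<open>M\<close> (\<open>blocks_imp_decomposition\<close>).

  \<^emph>\<open>Summands give blocks.\<close> In a finite generating set one may replace the generators by their
  components and then pass to a minimal subset, so a decomposition of \<open>M\<close> admits a minimal basis of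
  homogeneous elements. Their relations again split by colour and have a minimal basis of monochrome
  relations. This is a second minimal presentation of \<open>M\<close>, in block form. It extends to a minimal
  resolution, as does the presentation by \<open>G\<close> and a minimal subset of the rows of \<open>A\<close>; by uniqueness
  the two differ by isomorphisms of the free modules involved. These are automorphisms, because
  isomorphic free modules over a nonzero noetherian ring have the same rank. Row operations on \<open>A\<close>
  turn the superfluous rows into zero rows, so \<open>A\<close> itself is equivalent to the block matrix with zero
  rows added (\<open>row_reduction_to_minimal\<close>, \<open>decomposition_imp_blocks\<close>).

  Matrices are treated throughout as homomorphisms between free modules, and homomorphisms out of free
  modules are compared on the basis.
\<close>

section \<open>Submodules, spans and homomorphisms\<close>

context left_module
begin

lemma smult_zero_left: "x \<in> carrier M \<Longrightarrow> \<zero> \<odot>\<^bsub>M\<^esub> x = \<zero>\<^bsub>M\<^esub>"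
  using smult_l_distr[of \<zero> \<zero> x] by (metis M.add.r_cancel_one' R.l_zero R.zero_closed smult_closed)

lemma smult_zero_right: "a \<in> carrier R \<Longrightarrow> a \<odot>\<^bsub>M\<^esub> \<zero>\<^bsub>M\<^esub> = \<zero>\<^bsub>M\<^esub>"
  using smult_r_distr[of a "\<zero>\<^bsub>M\<^esub>" "\<zero>\<^bsub>M\<^esub>"]
  by (metis M.add.r_cancel_one' M.l_zero M.zero_closed smult_closed)

lemma smult_minus_one: "x \<in> carrier M \<Longrightarrow> (\<ominus> \<one>) \<odot>\<^bsub>M\<^esub> x = \<ominus>\<^bsub>M\<^esub> x"
  using smult_l_distr[of "\<ominus> \<one>" \<one> x] smult_zero_left
  by (metis M.minus_equality R.l_neg R.one_closed R.a_inv_closed smult_closed smult_one)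

text \<open>Closure under negation is automatic, because \<open>\<ominus> x = (\<ominus> \<one>) \<odot> x\<close>.\<close>

lemma submodule_iff:
  "submodule H R M \<longleftrightarrow> H \<subseteq> carrier M \<and> \<zero>\<^bsub>M\<^esub> \<in> H \<and>
     (\<forall>x\<in>H. \<forall>y\<in>H. x \<oplus>\<^bsub>M\<^esub> y \<in> H) \<and> (\<forall>a\<in>carrier R. \<forall>x\<in>H. a \<odot>\<^bsub>M\<^esub> x \<in> H)"
  (is "_ \<longleftrightarrow> ?rhs")
proof
  assume "submodule H R M"
  then show ?rhs
    unfolding submodule_def submodule_axioms_def
    using subgroup.subset[of H "add_monoid M"] subgroup.one_closed[of H "add_monoid M"]
      subgroup.m_closed[of H "add_monoid M"] by auto
next
  assume h: ?rhs
  then have "\<ominus>\<^bsub>M\<^esub> x \<in> H" if "x \<in> H" for x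
    using that smult_minus_one[of x] by (metis R.a_inv_closed R.one_closed subsetD)
  then have "inv\<^bsub>add_monoid M\<^esub> x \<in> H" if "x \<in> H" for x
    using that unfolding a_inv_def by blast
  with h show "submodule H R M"
    by (intro submodule.intro subgroup.intro submodule_axioms.intro) auto
qed

lemma submodule_neg:
  assumes "submodule H R M" "x \<in> H" shows "\<ominus>\<^bsub>M\<^esub> x \<in> H"
proof -
  have "(\<ominus> \<one>) \<odot>\<^bsub>M\<^esub> x \<in> H" "x \<in> carrier M"
    using assms by (auto simp: submodule_iff)
  then show ?thesis by (simp add: smult_minus_one)
qed

lemma submodule_carrier: "submodule (carrier M) R M"
  by (simp add: submodule_iff)

lemma submodule_zero: "submodule {\<zero>\<^bsub>M\<^esub>} R M"
  by (simp add: submodule_iff smult_zero_right)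

lemma submodule_finsum:
  assumes "submodule H R M" "finite I" "\<And>i. i \<in> I \<Longrightarrow> f i \<in> H"
  shows "(\<Oplus>\<^bsub>M\<^esub>i\<in>I. f i) \<in> H"
  using assms(2,3)
proof (induction I rule: finite_induct)
  case empty
  then show ?case using assms(1) by (simp add: submodule_iff)
next
  case (insert i I)
  have "H \<subseteq> carrier M" using assms(1) by (simp add: submodule_iff)
  then have "f \<in> I \<rightarrow> carrier M" "f i \<in> carrier M" using insert.prems by auto
  then have "(\<Oplus>\<^bsub>M\<^esub>i\<in>insert i I. f i) = f i \<oplus>\<^bsub>M\<^esub> (\<Oplus>\<^bsub>M\<^esub>i\<in>I. f i)"
    using insert.hyps by (simp add: M.finsum_insert)
  then show ?case using assms(1) insert by (simp add: submodule_iff)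
qed

lemma submodule_hull: "S \<subseteq> carrier M \<Longrightarrow> submodule ((\<lambda>N. submodule N R M) hull S) R M"
proof -
  assume S: "S \<subseteq> carrier M"
  have *: "submodule (\<Inter>T) R M" if T: "\<And>N. N \<in> T \<Longrightarrow> submodule N R M" "T \<noteq> {}" for T
  proof -
    obtain N where "N \<in> T" using T(2) by blast
    then have "\<Inter>T \<subseteq> carrier M" using T(1)[of N] unfolding submodule_iff by blast
    then show ?thesis using T(1) unfolding submodule_iff by simp
  qed
  have "{N. submodule N R M \<and> S \<subseteq> N} \<noteq> {}" using S submodule_carrier by blast
  then show ?thesis unfolding hull_def by (intro *) auto
qed

lemma generates_iff:
  "generates R M S \<longleftrightarrow> S \<subseteq> carrier M \<and> (\<forall>N. submodule N R M \<longrightarrow> S \<subseteq> N \<longrightarrow> N = carrier M)"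
proof
  assume g: "generates R M S"
  have "N = carrier M" if "submodule N R M" "S \<subseteq> N" for N
  proof -
    have "carrier M \<subseteq> N"
      using g hull_minimal[of S N "\<lambda>N. submodule N R M"] that by (simp add: generates_def)
    then show ?thesis using that(1) by (auto simp: submodule_iff)
  qed
  then show "S \<subseteq> carrier M \<and> (\<forall>N. submodule N R M \<longrightarrow> S \<subseteq> N \<longrightarrow> N = carrier M)"
    using g by (simp add: generates_def)
next
  assume "S \<subseteq> carrier M \<and> (\<forall>N. submodule N R M \<longrightarrow> S \<subseteq> N \<longrightarrow> N = carrier M)"
  then show "generates R M S"
    unfolding generates_def using submodule_hull[of S] hull_subset[of S] by blast
qed

lemma generatesD:
  "generates R M S \<Longrightarrow> submodule N R M \<Longrightarrow> S \<subseteq> N \<Longrightarrow> carrier M \<subseteq> N"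
  using generates_iff by blast

lemma left_module_submodule:
  assumes N: "submodule N R M"
  shows "left_module R (M\<lparr>carrier := N\<rparr>)"
proof -
  have sub: "N \<subseteq> carrier M" and z: "\<zero>\<^bsub>M\<^esub> \<in> N"
    and add: "\<And>x y. x \<in> N \<Longrightarrow> y \<in> N \<Longrightarrow> x \<oplus>\<^bsub>M\<^esub> y \<in> N"
    and sm: "\<And>a x. a \<in> carrier R \<Longrightarrow> x \<in> N \<Longrightarrow> a \<odot>\<^bsub>M\<^esub> x \<in> N"
    using N by (auto simp: submodule_iff)
  have "abelian_group (M\<lparr>carrier := N\<rparr>)"
  proof (rule abelian_groupI; simp)
    fix x assume x: "x \<in> N"
    show "\<exists>y\<in>N. y \<oplus>\<^bsub>M\<^esub> x = \<zero>\<^bsub>M\<^esub>"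
      using submodule_neg[OF N x] M.l_neg x sub by blast
  qed (use sub z add M.a_assoc M.a_comm M.l_zero in \<open>auto intro!: M.a_assoc M.a_comm\<close>)
  moreover have "left_module_axioms R (M\<lparr>carrier := N\<rparr>)"
    using sub sm by (auto simp: left_module_axioms_def smult_l_distr smult_r_distr smult_assoc1 subset_iff)
  ultimately show ?thesis
    by (intro left_module.intro R.ring_axioms)
qed

lemma submodule_of_submodule_iff:
  assumes N: "submodule N R M"
  shows "submodule H R (M\<lparr>carrier := N\<rparr>) \<longleftrightarrow> submodule H R M \<and> H \<subseteq> N"
proof -
  interpret N: left_module R "M\<lparr>carrier := N\<rparr>" by (rule left_module_submodule[OF N])
  have "N \<subseteq> carrier M" using N by (simp add: submodule_iff)
  then show ?thesis by (auto simp: N.submodule_iff submodule_iff)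
qed

lemma hull_of_submodule:
  assumes N: "submodule N R M" "S \<subseteq> N"
  shows "(\<lambda>H. submodule H R (M\<lparr>carrier := N\<rparr>)) hull S = (\<lambda>H. submodule H R M) hull S"
proof -
  have S: "S \<subseteq> carrier M" using N by (auto simp: submodule_iff)
  have sub: "(\<lambda>H. submodule H R M) hull S \<subseteq> N"
    by (rule hull_minimal[OF N(2)]) (rule N(1))
  show ?thesis
  proof (rule hull_unique[OF hull_subset])
    show "submodule ((\<lambda>H. submodule H R M) hull S) R (M\<lparr>carrier := N\<rparr>)"
      using submodule_hull[OF S] sub by (simp add: submodule_of_submodule_iff[OF N(1)])
    show "(\<lambda>H. submodule H R M) hull S \<subseteq> H"
      if "S \<subseteq> H" "submodule H R (M\<lparr>carrier := N\<rparr>)" for H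
      using that(2) by (intro hull_minimal that(1)) (simp add: submodule_of_submodule_iff[OF N(1)])
  qed
qed

lemma generates_submodule_iff:
  assumes N: "submodule N R M"
  shows "generates R (M\<lparr>carrier := N\<rparr>) S \<longleftrightarrow> S \<subseteq> N \<and> (\<lambda>H. submodule H R M) hull S = N"
  using hull_of_submodule[OF N] by (auto simp: generates_def)

lemma generates_submoduleD:
  assumes N: "submodule N R M" and g: "generates R (M\<lparr>carrier := N\<rparr>) S"
    and H: "submodule H R M" "S \<subseteq> H"
  shows "N \<subseteq> H"
  using g H unfolding generates_submodule_iff[OF N] by (metis hull_minimal)

text \<open>Some generating subset of least cardinality exists, and it is minimal for inclusion.\<close>

lemma minimal_basis_in_finite_generating_set:
  assumes "finite S" "generates R M S"
  obtains T where "T \<subseteq> S" "minimal_basis R M T"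
proof -
  let ?P = "\<lambda>T. T \<subseteq> S \<and> generates R M T"
  have "\<exists>T. ?P T \<and> (\<forall>T'. ?P T' \<longrightarrow> card T \<le> card T')"
    using ex_has_least_nat[of ?P S card] assms by auto
  then obtain T where T: "?P T" "\<And>T'. ?P T' \<Longrightarrow> card T \<le> card T'" by blast
  have "\<not> generates R M T'" if "T' \<subset> T" for T'
  proof
    assume "generates R M T'"
    then have "card T \<le> card T'" using T that by blast
    moreover have "card T' < card T" using that T(1) assms(1) finite_subset psubset_card_mono by blast
    ultimately show False by simp
  qed
  with T(1) show ?thesis using that by (auto simp: minimal_basis_def)
qed

lemma zero_notin_minimal_basis:
  assumes "minimal_basis R M T" shows "\<zero>\<^bsub>M\<^esub> \<notin> T"
proof
  assume z: "\<zero>\<^bsub>M\<^esub> \<in> T"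
  have "generates R M (T - {\<zero>\<^bsub>M\<^esub>})"
    unfolding generates_iff
  proof (intro conjI allI impI)
    show "T - {\<zero>\<^bsub>M\<^esub>} \<subseteq> carrier M" using assms by (auto simp: minimal_basis_def generates_iff)
    fix N assume N: "submodule N R M" "T - {\<zero>\<^bsub>M\<^esub>} \<subseteq> N"
    then have "T \<subseteq> N" by (auto simp: submodule_iff)
    with N assms show "N = carrier M" by (auto simp: minimal_basis_def generates_iff)
  qed
  with assms z show False by (auto simp: minimal_basis_def)
qed

end

text \<open>The facts about homomorphisms are stated without a locale: most arguments below compose
  homomorphisms between several modules with elements of different types.\<close>

lemma lm_homI:
  assumes "\<And>x. x \<in> carrier M \<Longrightarrow> f x \<in> carrier N"
    and "\<And>x y. x \<in> carrier M \<Longrightarrow> y \<in> carrier M \<Longrightarrow> f (x \<oplus>\<^bsub>M\<^esub> y) = f x \<oplus>\<^bsub>N\<^esub> f y"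
    and "\<And>a x. a \<in> carrier R \<Longrightarrow> x \<in> carrier M \<Longrightarrow> f (a \<odot>\<^bsub>M\<^esub> x) = a \<odot>\<^bsub>N\<^esub> f x"
  shows "f \<in> lm_hom R M N"
  using assms by (auto simp: lm_hom_def)

lemma lm_hom_closed: "f \<in> lm_hom R M N \<Longrightarrow> x \<in> carrier M \<Longrightarrow> f x \<in> carrier N"
  by (auto simp: lm_hom_def)

lemma lm_hom_add:
  "f \<in> lm_hom R M N \<Longrightarrow> x \<in> carrier M \<Longrightarrow> y \<in> carrier M \<Longrightarrow> f (x \<oplus>\<^bsub>M\<^esub> y) = f x \<oplus>\<^bsub>N\<^esub> f y"
  by (auto simp: lm_hom_def)

lemma lm_hom_smult:
  "f \<in> lm_hom R M N \<Longrightarrow> a \<in> carrier R \<Longrightarrow> x \<in> carrier M \<Longrightarrow> f (a \<odot>\<^bsub>M\<^esub> x) = a \<odot>\<^bsub>N\<^esub> f x"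
  by (auto simp: lm_hom_def)

lemma lm_hom_comp: "f \<in> lm_hom R M N \<Longrightarrow> h \<in> lm_hom R N L \<Longrightarrow> h \<circ> f \<in> lm_hom R M L"
  by (auto simp: lm_hom_def Pi_iff)

lemma lm_hom_id: "(\<lambda>x. x) \<in> lm_hom R M M"
  by (auto simp: lm_hom_def)

lemma lm_hom_zero:
  assumes "left_module R M" "left_module R N" "f \<in> lm_hom R M N"
  shows "f \<zero>\<^bsub>M\<^esub> = \<zero>\<^bsub>N\<^esub>"
proof -
  interpret M: left_module R M by fact
  interpret N: left_module R N by fact
  have "f (\<zero>\<^bsub>R\<^esub> \<odot>\<^bsub>M\<^esub> \<zero>\<^bsub>M\<^esub>) = \<zero>\<^bsub>R\<^esub> \<odot>\<^bsub>N\<^esub> f \<zero>\<^bsub>M\<^esub>"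
    using assms(3) by (simp add: lm_hom_smult)
  then show ?thesis
    using M.smult_zero_left N.smult_zero_left lm_hom_closed[OF assms(3)] by simp
qed

lemma lm_hom_neg:
  assumes "left_module R M" "left_module R N" "f \<in> lm_hom R M N" "x \<in> carrier M"
  shows "f (\<ominus>\<^bsub>M\<^esub> x) = \<ominus>\<^bsub>N\<^esub> f x"
proof -
  interpret M: left_module R M by fact
  interpret N: left_module R N by fact
  have "f ((\<ominus>\<^bsub>R\<^esub> \<one>\<^bsub>R\<^esub>) \<odot>\<^bsub>M\<^esub> x) = (\<ominus>\<^bsub>R\<^esub> \<one>\<^bsub>R\<^esub>) \<odot>\<^bsub>N\<^esub> f x"
    using assms by (simp add: lm_hom_smult)
  then show ?thesis
    using M.smult_minus_one N.smult_minus_one lm_hom_closed[OF assms(3)] assms(4) by simp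
qed

lemma submodule_vimage:
  assumes "left_module R M" "left_module R N" "f \<in> lm_hom R M N" "submodule H R N"
  shows "submodule {x \<in> carrier M. f x \<in> H} R M"
proof -
  interpret M: left_module R M by fact
  interpret N: left_module R N by fact
  show ?thesis
    using assms(3,4) lm_hom_zero[OF assms(1-3)]
    by (auto simp: M.submodule_iff N.submodule_iff lm_hom_add lm_hom_smult)
qed

lemma submodule_image:
  assumes "left_module R M" "left_module R N" "f \<in> lm_hom R M N" "submodule H R M"
  shows "submodule (f ` H) R N"
proof -
  interpret M: left_module R M by fact
  interpret N: left_module R N by fact
  have H: "H \<subseteq> carrier M" "\<zero>\<^bsub>M\<^esub> \<in> H" "\<And>x y. x \<in> H \<Longrightarrow> y \<in> H \<Longrightarrow> x \<oplus>\<^bsub>M\<^esub> y \<in> H"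
     "\<And>a x. a \<in> carrier R \<Longrightarrow> x \<in> H \<Longrightarrow> a \<odot>\<^bsub>M\<^esub> x \<in> H"
    using assms(4) by (auto simp: M.submodule_iff)
  show ?thesis
    unfolding N.submodule_iff
  proof (intro conjI ballI)
    show "f ` H \<subseteq> carrier N" using H lm_hom_closed[OF assms(3)] by auto
    show "\<zero>\<^bsub>N\<^esub> \<in> f ` H" using H(2) lm_hom_zero[OF assms(1-3)] by force
  next
    fix x y assume "x \<in> f ` H" "y \<in> f ` H"
    then obtain a b where "a \<in> H" "b \<in> H" "x = f a" "y = f b" by auto
    then have "x \<oplus>\<^bsub>N\<^esub> y = f (a \<oplus>\<^bsub>M\<^esub> b)" "a \<oplus>\<^bsub>M\<^esub> b \<in> H"
      using H(1,3) lm_hom_add[OF assms(3), of a b] by (auto simp: subset_iff)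
    then show "x \<oplus>\<^bsub>N\<^esub> y \<in> f ` H" by simp
  next
    fix a x assume "a \<in> carrier R" "x \<in> f ` H"
    then obtain b where b: "b \<in> H" "x = f b" "a \<in> carrier R" by auto
    then have "a \<odot>\<^bsub>N\<^esub> x = f (a \<odot>\<^bsub>M\<^esub> b)" "a \<odot>\<^bsub>M\<^esub> b \<in> H"
      using H(1,4) lm_hom_smult[OF assms(3), of a b] by (auto simp: subset_iff)
    then show "a \<odot>\<^bsub>N\<^esub> x \<in> f ` H" by simp
  qed
qed

lemma submodule_kernel:
  assumes "left_module R M" "left_module R N" "f \<in> lm_hom R M N"
  shows "submodule (a_kernel M N f) R M"
proof -
  interpret N: left_module R N by fact
  have "a_kernel M N f = {x \<in> carrier M. f x \<in> {\<zero>\<^bsub>N\<^esub>}}" by (auto simp: a_kernel_def')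
  then show ?thesis using submodule_vimage[OF assms N.submodule_zero] by simp
qed

lemma hull_image:
  assumes "left_module R M" "left_module R N" "f \<in> lm_hom R M N" "S \<subseteq> carrier M"
  shows "f ` ((\<lambda>H. submodule H R M) hull S) = (\<lambda>H. submodule H R N) hull (f ` S)"
    (is "f ` ?A = ?B")
proof -
  interpret M: left_module R M by fact
  interpret N: left_module R N by fact
  have fS: "f ` S \<subseteq> carrier N" using lm_hom_closed[OF assms(3)] assms(4) by blast
  show ?thesis
  proof
    have "S \<subseteq> {x \<in> carrier M. f x \<in> ?B}"
      using assms(4) hull_subset[of "f ` S" "\<lambda>H. submodule H R N"] by blast
    then have "?A \<subseteq> {x \<in> carrier M. f x \<in> ?B}"
      by (rule hull_minimal) (rule submodule_vimage[OF assms(1-3) N.submodule_hull[OF fS]])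
    then show "f ` ?A \<subseteq> ?B" by auto
    show "?B \<subseteq> f ` ?A"
      by (rule hull_minimal[OF image_mono[OF hull_subset]])
        (rule submodule_image[OF assms(1-3) M.submodule_hull[OF assms(4)]])
  qed
qed

lemma lm_hom_eq_on_generators:
  assumes "left_module R M" "left_module R N" "f \<in> lm_hom R M N" "h \<in> lm_hom R M N"
    and "generates R M S" "\<And>x. x \<in> S \<Longrightarrow> f x = h x" "x \<in> carrier M"
  shows "f x = h x"
proof -
  interpret M: left_module R M by fact
  interpret N: left_module R N by fact
  have "submodule {x \<in> carrier M. f x = h x} R M"
    using assms(3,4) lm_hom_zero[OF assms(1,2,3)] lm_hom_zero[OF assms(1,2,4)]
    by (auto simp: M.submodule_iff lm_hom_add lm_hom_smult)
  moreover have "S \<subseteq> {x \<in> carrier M. f x = h x}"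
    using assms(5,6) by (auto simp: M.generates_iff)
  ultimately show ?thesis using M.generatesD[OF assms(5)] assms(7) by blast
qed

lemma lm_isoD: "f \<in> lm_iso R M N \<Longrightarrow> f \<in> lm_hom R M N"
   "f \<in> lm_iso R M N \<Longrightarrow> inj_on f (carrier M)"
   "f \<in> lm_iso R M N \<Longrightarrow> f ` carrier M = carrier N"
  by (auto simp: lm_iso_def bij_betw_def)

lemma lm_isoI:
  assumes "f \<in> lm_hom R M N" "h \<in> carrier N \<rightarrow> carrier M"
    and "\<And>x. x \<in> carrier M \<Longrightarrow> h (f x) = x" "\<And>y. y \<in> carrier N \<Longrightarrow> f (h y) = y"
  shows "f \<in> lm_iso R M N"
  using assms by (auto simp: lm_iso_def intro!: bij_betw_byWitness[where f' = h] dest: lm_hom_closed)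

lemma lm_iso_inv:
  assumes "left_module R M" "f \<in> lm_iso R M N"
  shows "the_inv_into (carrier M) f \<in> lm_iso R N M"
proof -
  interpret left_module R M by fact
  let ?h = "the_inv_into (carrier M) f"
  note f = lm_isoD[OF assms(2)]
  have hc: "?h y \<in> carrier M" and fh: "f (?h y) = y" if "y \<in> carrier N" for y
    using that f the_inv_into_into[OF f(2), of y] f_the_inv_into_f[OF f(2), of y] by auto
  have hf: "?h (f x) = x" if "x \<in> carrier M" for x using that the_inv_into_f_f[OF f(2)] by simp
  have "?h \<in> lm_hom R N M"
  proof (rule lm_homI)
    fix x y assume "x \<in> carrier N" "y \<in> carrier N"
    then show "?h (x \<oplus>\<^bsub>N\<^esub> y) = ?h x \<oplus>\<^bsub>M\<^esub> ?h y"
      using hf[of "?h x \<oplus>\<^bsub>M\<^esub> ?h y"] hc fh lm_hom_add[OF f(1)] by simp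
  next
    fix a x assume "a \<in> carrier R" "x \<in> carrier N"
    then show "?h (a \<odot>\<^bsub>N\<^esub> x) = a \<odot>\<^bsub>M\<^esub> ?h x"
      using hf[of "a \<odot>\<^bsub>M\<^esub> ?h x"] hc fh lm_hom_smult[OF f(1)] by simp
  qed (rule hc)
  then show ?thesis
    using hc fh hf lm_hom_closed[OF f(1)] by (intro lm_isoI[where h = f]) auto
qed

lemma generates_image_iff:
  assumes "left_module R M" "left_module R N" "f \<in> lm_hom R M N" "f ` carrier M = carrier N"
    and "generates R M S"
  shows "generates R N (f ` S)"
  using assms hull_image[OF assms(1-3), of S] by (auto simp: generates_def)

lemma minimal_basis_iso:
  assumes M: "left_module R M" and N: "left_module R N" and f: "f \<in> lm_iso R M N"
    and S: "minimal_basis R M S"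
  shows "minimal_basis R N (f ` S)"
proof -
  let ?h = "the_inv_into (carrier M) f"
  note h = lm_iso_inv[OF M f]
  note f' = lm_isoD[OF f] and h' = lm_isoD[OF h]
  have gS: "generates R M S" and SM: "S \<subseteq> carrier M"
    using S by (auto simp: minimal_basis_def generates_def)
  have hf: "?h (f x) = x" if "x \<in> S" for x by (rule the_inv_into_f_f[OF f'(2)]) (use that SM in blast)
  have "\<not> generates R N T" if T: "T \<subset> f ` S" for T
  proof
    assume "generates R N T"
    then have "generates R M (?h ` T)" using generates_image_iff[OF N M h'(1,3)] by blast
    moreover have "?h ` T \<subset> S"
    proof -
      obtain s where s: "s \<in> S" "f s \<notin> T" using T by blast
      have "?h ` T \<subseteq> S" using T hf by force
      moreover have "s \<notin> ?h ` T"
      proof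
        assume "s \<in> ?h ` T"
        then obtain t where t: "t \<in> T" "s = ?h t" by blast
        then obtain s' where "t = f s'" "s' \<in> S" using T by blast
        then show False using t s hf by simp
      qed
      ultimately show ?thesis using s by blast
    qed
    ultimately show False using S unfolding minimal_basis_def by blast
  qed
  then show ?thesis
    using generates_image_iff[OF M N f'(1,3) gS] unfolding minimal_basis_def by blast
qed

section \<open>Free modules\<close>

lemma free_module_simps:
  "x \<in> carrier (free_module R X) \<longleftrightarrow>
     (\<forall>i\<in>X. x i \<in> carrier R) \<and> (\<forall>i. i \<notin> X \<longrightarrow> x i = \<zero>\<^bsub>R\<^esub>) \<and> finite {i. x i \<noteq> \<zero>\<^bsub>R\<^esub>}"
  "\<zero>\<^bsub>free_module R X\<^esub> = (\<lambda>_. \<zero>\<^bsub>R\<^esub>)"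
  "x \<oplus>\<^bsub>free_module R X\<^esub> y = (\<lambda>i. x i \<oplus>\<^bsub>R\<^esub> y i)"
  "a \<odot>\<^bsub>free_module R X\<^esub> x = (\<lambda>i. a \<otimes>\<^bsub>R\<^esub> x i)"
  by (simp_all add: free_module_def)

definition truncate :: "('a, 'x) ring_scheme \<Rightarrow> 'i set \<Rightarrow> ('i \<Rightarrow> 'a) \<Rightarrow> 'i \<Rightarrow> 'a"
  where "truncate R Y x = (\<lambda>i. if i \<in> Y then x i else \<zero>\<^bsub>R\<^esub>)"

text \<open>The homomorphism out of a free module with prescribed values on the basis. Summing over the
  support gives it a meaning also for infinite bases, as needed for arbitrary sets of generators.\<close>

definition free_lift ::
  "('a, 'x) ring_scheme \<Rightarrow> ('a, 'b, 'y) module_scheme \<Rightarrow> 'i set \<Rightarrow> ('i \<Rightarrow> 'b) \<Rightarrow> ('i \<Rightarrow> 'a) \<Rightarrow> 'b"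
  where "free_lift R M X m x = (\<Oplus>\<^bsub>M\<^esub>i\<in>{i\<in>X. x i \<noteq> \<zero>\<^bsub>R\<^esub>}. x i \<odot>\<^bsub>M\<^esub> m i)"

context ring
begin

lemma free_carrier_closed: "x \<in> carrier (free_module R X) \<Longrightarrow> x i \<in> carrier R"
  by (cases "i \<in> X") (auto simp: free_module_simps)

lemma free_carrier_finite:
  "finite X \<Longrightarrow> x \<in> carrier (free_module R X) \<longleftrightarrow> (\<forall>i\<in>X. x i \<in> carrier R) \<and> (\<forall>i. i \<notin> X \<longrightarrow> x i = \<zero>)"
  by (auto simp: free_module_simps intro: finite_subset[of _ X])

lemma left_module_free: "left_module R (free_module R X)"
proof -
  have "abelian_group (free_module R X)"
  proof (rule abelian_groupI)
    fix x y assume x: "x \<in> carrier (free_module R X)" and y: "y \<in> carrier (free_module R X)"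
    have "{i. x i \<oplus> y i \<noteq> \<zero>} \<subseteq> {i. x i \<noteq> \<zero>} \<union> {i. y i \<noteq> \<zero>}" by auto
    then have "finite {i. x i \<oplus> y i \<noteq> \<zero>}"
      by (rule finite_subset) (use x y in \<open>auto simp: free_module_simps\<close>)
    then show "x \<oplus>\<^bsub>free_module R X\<^esub> y \<in> carrier (free_module R X)"
      using x y by (auto simp: free_module_simps)
  next
    fix x assume x: "x \<in> carrier (free_module R X)"
    have "{i. \<ominus> x i \<noteq> \<zero>} \<subseteq> {i. x i \<noteq> \<zero>}" by auto
    then have "finite {i. \<ominus> x i \<noteq> \<zero>}"
      by (rule finite_subset) (use x in \<open>auto simp: free_module_simps\<close>)
    then have "(\<lambda>i. \<ominus> x i) \<in> carrier (free_module R X)" using x by (auto simp: free_module_simps)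
    moreover have "(\<lambda>i. \<ominus> x i) \<oplus>\<^bsub>free_module R X\<^esub> x = \<zero>\<^bsub>free_module R X\<^esub>"
      using free_carrier_closed[OF x] by (simp add: free_module_simps(2-) l_neg)
    ultimately show "\<exists>y\<in>carrier (free_module R X). y \<oplus>\<^bsub>free_module R X\<^esub> x = \<zero>\<^bsub>free_module R X\<^esub>" by blast
  next
    fix x y z assume "x \<in> carrier (free_module R X)" "y \<in> carrier (free_module R X)"
      "z \<in> carrier (free_module R X)"
    from this[THEN free_carrier_closed]
    show "x \<oplus>\<^bsub>free_module R X\<^esub> y \<oplus>\<^bsub>free_module R X\<^esub> z = x \<oplus>\<^bsub>free_module R X\<^esub> (y \<oplus>\<^bsub>free_module R X\<^esub> z)"
      by (simp add: free_module_simps(2-) a_assoc)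
  next
    fix x y assume "x \<in> carrier (free_module R X)" "y \<in> carrier (free_module R X)"
    from this[THEN free_carrier_closed]
    show "x \<oplus>\<^bsub>free_module R X\<^esub> y = y \<oplus>\<^bsub>free_module R X\<^esub> x"
      by (simp add: free_module_simps(2-) a_comm)
  next
    fix x assume "x \<in> carrier (free_module R X)"
    from free_carrier_closed[OF this]
    show "\<zero>\<^bsub>free_module R X\<^esub> \<oplus>\<^bsub>free_module R X\<^esub> x = x"
      by (simp add: free_module_simps(2-))
  qed (simp add: free_module_simps)
  moreover have "left_module_axioms R (free_module R X)"
  proof (unfold left_module_axioms_def, intro conjI allI impI)
    fix a x assume a: "a \<in> carrier R" and x: "x \<in> carrier (free_module R X)"
    have "{i. a \<otimes> x i \<noteq> \<zero>} \<subseteq> {i. x i \<noteq> \<zero>}" using a by auto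
    then have "finite {i. a \<otimes> x i \<noteq> \<zero>}"
      by (rule finite_subset) (use x in \<open>auto simp: free_module_simps\<close>)
    then show "a \<odot>\<^bsub>free_module R X\<^esub> x \<in> carrier (free_module R X)"
      using a x by (auto simp: free_module_simps)
  qed (simp_all add: free_module_simps(2-) fun_eq_iff l_distr r_distr m_assoc free_carrier_closed)
  ultimately show ?thesis
    by (intro left_module.intro ring_axioms)
qed

lemma free_add_closed:
  assumes "x \<in> carrier (free_module R X)" "y \<in> carrier (free_module R X)"
  shows "x \<oplus>\<^bsub>free_module R X\<^esub> y \<in> carrier (free_module R X)"
proof -
  interpret F: left_module R "free_module R X" by (rule left_module_free)
  show ?thesis using assms by (rule F.M.a_closed)
qed

lemma free_unit_closed: "j \<in> X \<Longrightarrow> free_unit R j \<in> carrier (free_module R X)"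
  by (auto simp: free_module_simps free_unit_def)

lemma truncate_closed:
  "x \<in> carrier (free_module R X) \<Longrightarrow> truncate R Y x \<in> carrier (free_module R X)"
  by (auto simp: free_module_simps truncate_def elim: finite_subset[rotated])

lemma truncate_closed_part:
  "x \<in> carrier (free_module R X) \<Longrightarrow> Y \<subseteq> X \<Longrightarrow> truncate R Y x \<in> carrier (free_module R Y)"
  by (auto simp: free_module_simps truncate_def elim: finite_subset[rotated])

lemma truncate_hom: "truncate R Y \<in> lm_hom R (free_module R X) (free_module R X)"
  by (rule lm_homI) (auto simp: truncate_closed, auto simp: truncate_def free_module_simps(2-))

lemma truncate_hom_part:
  "Y \<subseteq> X \<Longrightarrow> truncate R Y \<in> lm_hom R (free_module R X) (free_module R Y)"
  by (rule lm_homI) (auto simp: truncate_closed_part, auto simp: truncate_def free_module_simps(2-))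

lemma free_module_mono: "Y \<subseteq> X \<Longrightarrow> carrier (free_module R Y) \<subseteq> carrier (free_module R X)"
proof
  fix x assume "Y \<subseteq> X" and x: "x \<in> carrier (free_module R Y)"
  then show "x \<in> carrier (free_module R X)"
    using free_carrier_closed[OF x] unfolding free_module_simps by blast
qed

lemma inclusion_hom: "Y \<subseteq> X \<Longrightarrow> (\<lambda>x. x) \<in> lm_hom R (free_module R Y) (free_module R X)"
  by (rule lm_homI) (use free_module_mono in \<open>auto simp: free_module_simps(3,4)\<close>)

lemma free_generated_by_units: "generates R (free_module R X) (free_unit R ` X)"
proof -
  interpret F: left_module R "free_module R X" by (rule left_module_free)
  show ?thesis
    unfolding F.generates_iff
  proof (intro conjI allI impI)
    show "free_unit R ` X \<subseteq> carrier (free_module R X)" by (auto intro: free_unit_closed)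
    fix N assume N: "submodule N R (free_module R X)" and u: "free_unit R ` X \<subseteq> N"
    have "x \<in> N" if x: "x \<in> carrier (free_module R X)" for x
    proof -
      have "truncate R Z x \<in> N" if "finite Z" "Z \<subseteq> X" for Z
        using that
      proof (induction Z rule: finite_induct)
        case empty
        then show ?case using N by (simp add: truncate_def F.submodule_iff free_module_simps(2))
      next
        case (insert i Z)
        have "truncate R (insert i Z) x =
            truncate R Z x \<oplus>\<^bsub>free_module R X\<^esub> x i \<odot>\<^bsub>free_module R X\<^esub> free_unit R i"
          using insert.hyps free_carrier_closed[OF x]
          by (auto simp: truncate_def free_unit_def free_module_simps(2-) fun_eq_iff)
        moreover have "x i \<odot>\<^bsub>free_module R X\<^esub> free_unit R i \<in> N"
          using N u insert.prems free_carrier_closed[OF x] by (auto simp: F.submodule_iff)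
        ultimately show ?case using N insert by (simp add: F.submodule_iff)
      qed
      from this[of "{i. x i \<noteq> \<zero>}"] x have "truncate R {i. x i \<noteq> \<zero>} x \<in> N"
        by (auto simp: free_module_simps)
      moreover have "truncate R {i. x i \<noteq> \<zero>} x = x" by (auto simp: truncate_def)
      ultimately show ?thesis by simp
    qed
    then show "N = carrier (free_module R X)" using N by (auto simp: F.submodule_iff)
  qed
qed

lemma free_hom_eqI:
  assumes "left_module R M" "f \<in> lm_hom R (free_module R X) M" "h \<in> lm_hom R (free_module R X) M"
    and "\<And>i. i \<in> X \<Longrightarrow> f (free_unit R i) = h (free_unit R i)" "x \<in> carrier (free_module R X)"
  shows "f x = h x"
  by (rule lm_hom_eq_on_generators[OF left_module_free assms(1-3) free_generated_by_units])
    (use assms(4,5) in auto)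

end

context left_module
begin

lemma free_lift_eq_sum:
  assumes m: "\<And>i. i \<in> X \<Longrightarrow> m i \<in> carrier M" and x: "x \<in> carrier (free_module R X)"
    and Z: "finite Z" "Z \<subseteq> X" "\<And>i. i \<notin> Z \<Longrightarrow> x i = \<zero>"
  shows "free_lift R M X m x = (\<Oplus>\<^bsub>M\<^esub>i\<in>Z. x i \<odot>\<^bsub>M\<^esub> m i)"
  unfolding free_lift_def
  by (rule M.add.finprod_mono_neutral_cong_left)
    (use Z m R.free_carrier_closed[OF x] in \<open>auto simp: smult_zero_left\<close>)

lemma free_lift_hom:
  assumes m: "\<And>i. i \<in> X \<Longrightarrow> m i \<in> carrier M"
  shows "free_lift R M X m \<in> lm_hom R (free_module R X) M"
proof (rule lm_homI)
  fix x assume x: "x \<in> carrier (free_module R X)"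
  show "free_lift R M X m x \<in> carrier M"
    unfolding free_lift_def
    by (rule M.finsum_closed) (use m R.free_carrier_closed[OF x] in auto)
  fix y assume y: "y \<in> carrier (free_module R X)"
  let ?Z = "{i. x i \<noteq> \<zero>} \<union> {i. y i \<noteq> \<zero>}"
  have Z: "finite ?Z" "?Z \<subseteq> X" using x y by (auto simp: free_module_simps)
  note xy = R.free_carrier_closed[OF x] R.free_carrier_closed[OF y]
  have "x \<oplus>\<^bsub>free_module R X\<^esub> y \<in> carrier (free_module R X)"
    using x y by (rule R.free_add_closed)
  then have "free_lift R M X m (x \<oplus>\<^bsub>free_module R X\<^esub> y)
      = (\<Oplus>\<^bsub>M\<^esub>i\<in>?Z. (x i \<oplus> y i) \<odot>\<^bsub>M\<^esub> m i)"
    using Z by (subst free_lift_eq_sum[OF m, where Z = ?Z]) (auto simp: free_module_simps(3))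
  also have "\<dots> = (\<Oplus>\<^bsub>M\<^esub>i\<in>?Z. x i \<odot>\<^bsub>M\<^esub> m i \<oplus>\<^bsub>M\<^esub> y i \<odot>\<^bsub>M\<^esub> m i)"
    by (rule M.finsum_cong') (use Z m xy in \<open>auto simp: smult_l_distr\<close>)
  also have "\<dots> = (\<Oplus>\<^bsub>M\<^esub>i\<in>?Z. x i \<odot>\<^bsub>M\<^esub> m i) \<oplus>\<^bsub>M\<^esub> (\<Oplus>\<^bsub>M\<^esub>i\<in>?Z. y i \<odot>\<^bsub>M\<^esub> m i)"
    by (rule M.finsum_addf) (use Z m xy in auto)
  also have "(\<Oplus>\<^bsub>M\<^esub>i\<in>?Z. x i \<odot>\<^bsub>M\<^esub> m i) = free_lift R M X m x"
    by (rule free_lift_eq_sum[symmetric]) (use Z m x in auto)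
  also have "(\<Oplus>\<^bsub>M\<^esub>i\<in>?Z. y i \<odot>\<^bsub>M\<^esub> m i) = free_lift R M X m y"
    by (rule free_lift_eq_sum[symmetric]) (use Z m y in auto)
  finally show "free_lift R M X m (x \<oplus>\<^bsub>free_module R X\<^esub> y) =
      free_lift R M X m x \<oplus>\<^bsub>M\<^esub> free_lift R M X m y" .
next
  fix a x assume a: "a \<in> carrier R" and x: "x \<in> carrier (free_module R X)"
  let ?Z = "{i. x i \<noteq> \<zero>}"
  have Z: "finite ?Z" "?Z \<subseteq> X" using x by (auto simp: free_module_simps)
  note xc = R.free_carrier_closed[OF x]
  have *: "a \<odot>\<^bsub>M\<^esub> (\<Oplus>\<^bsub>M\<^esub>i\<in>A. x i \<odot>\<^bsub>M\<^esub> m i) = (\<Oplus>\<^bsub>M\<^esub>i\<in>A. a \<odot>\<^bsub>M\<^esub> (x i \<odot>\<^bsub>M\<^esub> m i))"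
    if "finite A" "A \<subseteq> X" for A
    using that
  proof (induction A rule: finite_induct)
    case empty
    then show ?case using a by (simp add: smult_zero_right)
  next
    case (insert i A)
    then have "(\<lambda>i. x i \<odot>\<^bsub>M\<^esub> m i) \<in> A \<rightarrow> carrier M" "x i \<odot>\<^bsub>M\<^esub> m i \<in> carrier M"
      using m xc by auto
    moreover from this have "(\<lambda>i. a \<odot>\<^bsub>M\<^esub> (x i \<odot>\<^bsub>M\<^esub> m i)) \<in> A \<rightarrow> carrier M" using a by auto
    ultimately show ?case
      using insert a by (simp add: M.finsum_insert M.finsum_closed smult_r_distr)
  qed
  have "a \<odot>\<^bsub>free_module R X\<^esub> x \<in> carrier (free_module R X)"
    using left_module.smult_closed[OF R.left_module_free] a x by blast
  then have "free_lift R M X m (a \<odot>\<^bsub>free_module R X\<^esub> x)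
      = (\<Oplus>\<^bsub>M\<^esub>i\<in>?Z. (a \<otimes> x i) \<odot>\<^bsub>M\<^esub> m i)"
    using Z a by (subst free_lift_eq_sum[OF m, where Z = ?Z]) (auto simp: free_module_simps(4))
  also have "\<dots> = (\<Oplus>\<^bsub>M\<^esub>i\<in>?Z. a \<odot>\<^bsub>M\<^esub> (x i \<odot>\<^bsub>M\<^esub> m i))"
    by (rule M.finsum_cong') (use Z m xc a in \<open>auto simp: smult_assoc1\<close>)
  also have "\<dots> = a \<odot>\<^bsub>M\<^esub> free_lift R M X m x"
    using *[OF Z] free_lift_eq_sum[OF m x Z] by simp
  finally show "free_lift R M X m (a \<odot>\<^bsub>free_module R X\<^esub> x) = a \<odot>\<^bsub>M\<^esub> free_lift R M X m x" .
qed

lemma free_lift_unit: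
  assumes m: "\<And>i. i \<in> X \<Longrightarrow> m i \<in> carrier M" and j: "j \<in> X"
  shows "free_lift R M X m (free_unit R j) = m j"
proof -
  have "free_lift R M X m (free_unit R j) = (\<Oplus>\<^bsub>M\<^esub>i\<in>{j}. free_unit R j i \<odot>\<^bsub>M\<^esub> m i)"
    by (rule free_lift_eq_sum[OF m R.free_unit_closed[OF j]]) (use j in \<open>auto simp: free_unit_def\<close>)
  also have "\<dots> = m j" using m[OF j] by (simp add: M.finsum_insert free_unit_def)
  finally show ?thesis .
qed

lemma free_lift_image:
  assumes "m ` X \<subseteq> carrier M"
  shows "free_lift R M X m ` carrier (free_module R X) = (\<lambda>H. submodule H R M) hull (m ` X)"
proof -
  have m: "\<And>i. i \<in> X \<Longrightarrow> m i \<in> carrier M" using assms by auto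
  have "free_lift R M X m ` (free_unit R ` X) = m ` X"
    using free_lift_unit[OF m] by (force simp: image_image)
  moreover have "free_lift R M X m ` ((\<lambda>H. submodule H R (free_module R X)) hull (free_unit R ` X))
      = (\<lambda>H. submodule H R M) hull (free_lift R M X m ` (free_unit R ` X))"
    by (rule hull_image[OF R.left_module_free left_module_axioms free_lift_hom[OF m]])
      (auto intro: R.free_unit_closed)
  ultimately show ?thesis
    using R.free_generated_by_units[of X] by (simp add: generates_def)
qed

end

text \<open>Vectors are pulled back along a bijection of index sets.\<close>

definition reindex :: "('a, 'x) ring_scheme \<Rightarrow> 'i set \<Rightarrow> ('i \<Rightarrow> 'j) \<Rightarrow> ('j \<Rightarrow> 'a) \<Rightarrow> 'i \<Rightarrow> 'a"
  where "reindex R X g y = (\<lambda>i. if i \<in> X then y (g i) else \<zero>\<^bsub>R\<^esub>)"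

context ring
begin

lemma reindex_hom:
  assumes g: "bij_betw g X Y"
  shows "reindex R X g \<in> lm_hom R (free_module R Y) (free_module R X)"
proof (rule lm_homI)
  fix y assume y: "y \<in> carrier (free_module R Y)"
  have "{i. reindex R X g y i \<noteq> \<zero>} \<subseteq> the_inv_into X g ` {j. y j \<noteq> \<zero>}"
  proof
    fix i assume "i \<in> {i. reindex R X g y i \<noteq> \<zero>}"
    then have "i \<in> X" "y (g i) \<noteq> \<zero>" by (auto simp: reindex_def split: if_splits)
    moreover from this have "i = the_inv_into X g (g i)"
      using g by (simp add: the_inv_into_f_f bij_betw_def)
    ultimately show "i \<in> the_inv_into X g ` {j. y j \<noteq> \<zero>}" by blast
  qed
  then have "finite {i. reindex R X g y i \<noteq> \<zero>}"
    by (rule finite_subset) (use y in \<open>auto simp: free_module_simps\<close>)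
  then show "reindex R X g y \<in> carrier (free_module R X)"
    using y g by (auto simp: free_module_simps reindex_def bij_betw_def)
qed (auto simp: reindex_def free_module_simps(2-))

lemma reindex_iso:
  assumes g: "bij_betw g X Y"
  shows "reindex R X g \<in> lm_iso R (free_module R Y) (free_module R X)"
proof (rule lm_isoI[where h = "reindex R Y (the_inv_into X g)"])
  note g' = bij_betw_the_inv_into[OF g]
  show "reindex R Y (the_inv_into X g) \<in> carrier (free_module R X) \<rightarrow> carrier (free_module R Y)"
    using lm_hom_closed[OF reindex_hom[OF g']] by auto
  show "reindex R Y (the_inv_into X g) (reindex R X g y) = y" if "y \<in> carrier (free_module R Y)" for y
    using that g g' by (auto simp: reindex_def free_module_simps fun_eq_iff bij_betw_def f_the_inv_into_f)
  show "reindex R X g (reindex R Y (the_inv_into X g) x) = x" if "x \<in> carrier (free_module R X)" for x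
    using that g by (auto simp: reindex_def free_module_simps fun_eq_iff bij_betw_def the_inv_into_f_f)
qed (rule reindex_hom[OF g])

lemma reindex_unit:
  assumes "bij_betw g X Y" "i \<in> X"
  shows "reindex R X g (free_unit R (g i)) = free_unit R i"
  using assms by (auto simp: reindex_def free_unit_def fun_eq_iff bij_betw_def inj_on_def)

end

section \<open>Noetherian rings and invariance of rank\<close>

context ring
begin

lemma left_ideal_coordinate:
  assumes K: "submodule K R (free_module R X)"
  shows "left_ideal R ((\<lambda>x. x i) ` K)"
proof -
  interpret F: left_module R "free_module R X" by (rule left_module_free)
  have K': "K \<subseteq> carrier (free_module R X)" "(\<lambda>_. \<zero>) \<in> K"
    "\<And>x y. x \<in> K \<Longrightarrow> y \<in> K \<Longrightarrow> (\<lambda>i. x i \<oplus> y i) \<in> K"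
    "\<And>a x. a \<in> carrier R \<Longrightarrow> x \<in> K \<Longrightarrow> (\<lambda>i. a \<otimes> x i) \<in> K"
    using K by (auto simp: F.submodule_iff free_module_simps(2-))
  have c: "x j \<in> carrier R" if "x \<in> K" for x j
    by (rule free_carrier_closed[OF subsetD[OF K'(1) that]])
  have "subgroup ((\<lambda>x. x i) ` K) (add_monoid R)"
  proof (rule subgroup.intro)
    show "(\<lambda>x. x i) ` K \<subseteq> carrier (add_monoid R)" using c by auto
    show "\<one>\<^bsub>add_monoid R\<^esub> \<in> (\<lambda>x. x i) ` K" using K'(2) by force
  next
    fix a b assume "a \<in> (\<lambda>x. x i) ` K" "b \<in> (\<lambda>x. x i) ` K"
    then obtain x y where "x \<in> K" "y \<in> K" "a = x i" "b = y i" by blast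
    then show "a \<otimes>\<^bsub>add_monoid R\<^esub> b \<in> (\<lambda>x. x i) ` K" using K'(3)[of x y] by force
  next
    fix a assume "a \<in> (\<lambda>x. x i) ` K"
    then obtain x where x: "x \<in> K" "a = x i" by blast
    then have "\<ominus> a = (\<ominus> \<one>) \<otimes> x i" using c by (simp add: l_minus)
    moreover have "(\<lambda>i. (\<ominus> \<one>) \<otimes> x i) \<in> K" using K'(4)[of "\<ominus> \<one>" x] x by simp
    ultimately have "\<ominus> a \<in> (\<lambda>x. x i) ` K" by (metis (no_types, lifting) image_eqI)
    then show "inv\<^bsub>add_monoid R\<^esub> a \<in> (\<lambda>x. x i) ` K" unfolding a_inv_def by blast
  qed
  moreover have "a \<otimes> b \<in> (\<lambda>x. x i) ` K" if a: "a \<in> carrier R" and b: "b \<in> (\<lambda>x. x i) ` K" for a b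
  proof -
    obtain x where "x \<in> K" "b = x i" using b by blast
    then show ?thesis using K'(4)[of a x] a by force
  qed
  ultimately show ?thesis
    unfolding left_ideal_def by (blast intro: additive_subgroup.intro)
qed

lemma submodule_free_part:
  assumes N: "submodule N R (free_module R X)" and Y: "Y \<subseteq> X"
  shows "submodule {x \<in> carrier (free_module R Y). x \<in> N} R (free_module R Y)"
  using submodule_vimage[OF left_module_free left_module_free inclusion_hom[OF Y] N] .

text \<open>A submodule of \<open>R\<^sup>n\<^sup>+\<^sup>1\<close> is an extension of a left ideal, its last coordinates, by a
  submodule of \<open>R\<^sup>n\<close>.\<close>

lemma submodule_free_rank_finitely_generated:
  assumes noeth: "left_noetherian R" and K: "submodule K R (free_rank R n)"
  shows "\<exists>S. finite S \<and> S \<subseteq> K \<and> (\<forall>H. submodule H R (free_rank R n) \<longrightarrow> S \<subseteq> H \<longrightarrow> K \<subseteq> H)"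
  using K
proof (induction n arbitrary: K)
  case 0
  interpret F: left_module R "free_rank R 0" by (rule left_module_free)
  have "carrier (free_rank R 0) = {\<zero>\<^bsub>free_rank R 0\<^esub>}" by (auto simp: free_module_simps fun_eq_iff)
  moreover have "K \<subseteq> carrier (free_rank R 0)" using 0 by (simp only: F.submodule_iff)
  moreover have "\<zero>\<^bsub>free_rank R 0\<^esub> \<in> H" if "submodule H R (free_rank R 0)" for H
    using that by (simp only: F.submodule_iff)
  ultimately have "K \<subseteq> H" if "submodule H R (free_rank R 0)" for H using that by auto
  then show ?case by (intro exI[of _ "{}"]) simp
next
  case (Suc n K)
  let ?F = "free_rank R (Suc n)"
  interpret F: left_module R ?F by (rule left_module_free)
  interpret E: left_module R "free_rank R n" by (rule left_module_free)
  note K = Suc.prems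
  have sub: "{..<n} \<subseteq> {..<Suc n}" by auto
  define I where "I = (\<lambda>x. x n) ` K"
  have "left_ideal R I" unfolding I_def by (rule left_ideal_coordinate[OF K])
  then obtain T where T: "finite T" "T \<subseteq> I" "left_ideal R hull T = I"
    using noeth unfolding left_noetherian_def by blast
  then have "\<forall>t\<in>T. \<exists>k\<in>K. k n = t" unfolding I_def by fastforce
  then obtain k where k: "\<And>t. t \<in> T \<Longrightarrow> k t \<in> K \<and> k t n = t" by metis
  define K0 where "K0 = {x \<in> carrier (free_rank R n). x \<in> K}"
  have K0: "submodule K0 R (free_rank R n)"
    unfolding K0_def by (rule submodule_free_part[OF K sub])
  obtain S0 where S0: "finite S0" "S0 \<subseteq> K0"
    "\<And>H. submodule H R (free_rank R n) \<Longrightarrow> S0 \<subseteq> H \<Longrightarrow> K0 \<subseteq> H"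
    using Suc.IH[OF K0] by blast
  have "K \<subseteq> H" if H: "submodule H R ?F" and S: "S0 \<union> k ` T \<subseteq> H" for H
  proof
    fix x assume x: "x \<in> K"
    have KH: "submodule (H \<inter> K) R ?F" using H K by (auto simp: F.submodule_iff)
    have "T \<subseteq> (\<lambda>x. x n) ` (H \<inter> K)"
    proof
      fix t assume "t \<in> T"
      then have "k t \<in> H \<inter> K" "t = k t n" using S k by auto
      then show "t \<in> (\<lambda>x. x n) ` (H \<inter> K)" by blast
    qed
    then have "I \<subseteq> (\<lambda>x. x n) ` (H \<inter> K)"
      using hull_minimal[of T _ "left_ideal R"] left_ideal_coordinate[OF KH] T(3) by blast
    moreover have "x n \<in> I" unfolding I_def using x by (rule imageI)
    ultimately have "x n \<in> (\<lambda>x. x n) ` (H \<inter> K)" by (rule subsetD)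
    then obtain h where h: "h \<in> H" "h \<in> K" "h n = x n" by auto
    have hx: "h \<in> carrier ?F" "x \<in> carrier ?F" using h x K by (auto simp: F.submodule_iff)
    let ?d = "x \<oplus>\<^bsub>?F\<^esub> (\<ominus>\<^bsub>R\<^esub> \<one>) \<odot>\<^bsub>?F\<^esub> h"
    have dK: "?d \<in> K" using h x K by (simp add: F.submodule_iff)
    have "?d n = \<zero>"
      using h(3) free_carrier_closed[OF hx(2), of n]
      by (simp add: free_module_simps(2-) l_minus r_neg)
    moreover have "?d \<in> carrier ?F" using dK K by (auto simp: F.submodule_iff)
    ultimately have "?d \<in> carrier (free_rank R n)"
      unfolding free_module_simps(1) by (metis lessThan_iff less_Suc_eq)
    then have dK0: "?d \<in> K0" using dK by (simp add: K0_def)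
    have "S0 \<subseteq> {x \<in> carrier (free_rank R n). x \<in> H}" using S S0(2) by (auto simp: K0_def)
    from S0(3)[OF submodule_free_part[OF H sub] this] dK0 have "?d \<in> H" by blast
    moreover have "x = ?d \<oplus>\<^bsub>?F\<^esub> h"
      using free_carrier_closed[OF hx(1)] free_carrier_closed[OF hx(2)]
      by (simp add: free_module_simps(2-) fun_eq_iff l_minus a_assoc l_neg)
    ultimately show "x \<in> H" using h(1) H by (metis F.submodule_iff)
  qed
  moreover have "finite (S0 \<union> k ` T)" using S0 T by simp
  moreover have "S0 \<union> k ` T \<subseteq> K" using S0(2) k by (auto simp: K0_def)
  ultimately show ?case by blast
qed

end

text \<open>The kernels of the powers of \<open>f\<close> form an ascending chain, whose union is finitely
  generated; hence the chain stops at some \<open>k\<close>. An element killed by \<open>f\<close> is \<open>f\<^sup>k y\<close> with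
  \<open>f\<^sup>k\<^sup>+\<^sup>1 y = 0\<close>, so it vanishes.\<close>

lemma (in left_module) surjective_endomorphism_injective:
  assumes noeth: "\<And>K. submodule K R M \<Longrightarrow>
      \<exists>S. finite S \<and> S \<subseteq> K \<and> (\<forall>H. submodule H R M \<longrightarrow> S \<subseteq> H \<longrightarrow> K \<subseteq> H)"
    and f: "f \<in> lm_hom R M M" "f ` carrier M = carrier M"
    and x: "x \<in> carrier M" "f x = \<zero>\<^bsub>M\<^esub>"
  shows "x = \<zero>\<^bsub>M\<^esub>"
proof -
  have fk: "f ^^ k \<in> lm_hom R M M" for k
  proof (induction k)
    case 0
    then show ?case using lm_hom_id[of R M] by (simp add: id_def)
  next
    case (Suc k)
    then show ?case using lm_hom_comp[OF Suc f(1)] by (simp add: comp_def)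
  qed
  have surj: "(f ^^ k) ` carrier M = carrier M" for k
  proof (induction k)
    case (Suc k)
    have "(f ^^ Suc k) ` carrier M = f ` ((f ^^ k) ` carrier M)" by (simp add: image_comp)
    then show ?case using Suc f(2) by simp
  qed simp
  have f0: "(f ^^ k) \<zero>\<^bsub>M\<^esub> = \<zero>\<^bsub>M\<^esub>" for k
    by (rule lm_hom_zero[OF left_module_axioms left_module_axioms fk])
  have mono: "(f ^^ l) y = \<zero>\<^bsub>M\<^esub>" if "(f ^^ k) y = \<zero>\<^bsub>M\<^esub>" "k \<le> l" for k l y
  proof -
    have "l = (l - k) + k" using that(2) by simp
    then have "(f ^^ l) y = (f ^^ (l - k)) ((f ^^ k) y)" by (metis comp_apply funpow_add)
    then show ?thesis using that(1) f0 by simp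
  qed
  define U where "U = {y \<in> carrier M. \<exists>k. (f ^^ k) y = \<zero>\<^bsub>M\<^esub>}"
  have U: "submodule U R M"
    unfolding submodule_iff
  proof (intro conjI ballI)
    show "\<zero>\<^bsub>M\<^esub> \<in> U" using f0 by (auto simp: U_def)
    fix a b assume "a \<in> U" "b \<in> U"
    then obtain k l where ab: "a \<in> carrier M" "b \<in> carrier M"
      "(f ^^ k) a = \<zero>\<^bsub>M\<^esub>" "(f ^^ l) b = \<zero>\<^bsub>M\<^esub>" by (auto simp: U_def)
    then have "(f ^^ max k l) a = \<zero>\<^bsub>M\<^esub>" "(f ^^ max k l) b = \<zero>\<^bsub>M\<^esub>" using mono by auto
    then have "(f ^^ max k l) (a \<oplus>\<^bsub>M\<^esub> b) = \<zero>\<^bsub>M\<^esub>" using lm_hom_add[OF fk] ab by simp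
    then show "a \<oplus>\<^bsub>M\<^esub> b \<in> U" using ab by (auto simp: U_def)
  next
    fix a y assume "a \<in> carrier R" "y \<in> U"
    then obtain k where "a \<in> carrier R" "y \<in> carrier M" "(f ^^ k) y = \<zero>\<^bsub>M\<^esub>" by (auto simp: U_def)
    then have "a \<odot>\<^bsub>M\<^esub> y \<in> carrier M" "(f ^^ k) (a \<odot>\<^bsub>M\<^esub> y) = \<zero>\<^bsub>M\<^esub>"
      using lm_hom_smult[OF fk] smult_zero_right by auto
    then show "a \<odot>\<^bsub>M\<^esub> y \<in> U" by (auto simp: U_def)
  qed (auto simp: U_def)
  obtain S where S: "finite S" "S \<subseteq> U" "\<And>H. submodule H R M \<Longrightarrow> S \<subseteq> H \<Longrightarrow> U \<subseteq> H"
    using noeth[OF U] by blast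
  have "\<forall>s\<in>S. \<exists>k. (f ^^ k) s = \<zero>\<^bsub>M\<^esub>" using S(2) by (auto simp: U_def)
  then obtain \<kappa> where \<kappa>: "\<And>s. s \<in> S \<Longrightarrow> (f ^^ \<kappa> s) s = \<zero>\<^bsub>M\<^esub>" by metis
  define k where "k = sum \<kappa> S"
  have "(f ^^ k) s = \<zero>\<^bsub>M\<^esub>" if "s \<in> S" for s
    using mono[OF \<kappa>[OF that]] member_le_sum[of s S \<kappa>] S(1) that by (simp add: k_def)
  then have "S \<subseteq> a_kernel M M (f ^^ k)" using S(2) by (auto simp: a_kernel_def' U_def)
  then have Uk: "U \<subseteq> a_kernel M M (f ^^ k)"
    by (intro S(3) submodule_kernel[OF left_module_axioms left_module_axioms fk])
  obtain y where y: "y \<in> carrier M" "x = (f ^^ k) y" using x(1) surj[of k] by blast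
  have "(f ^^ Suc k) y = f x" unfolding y(2) by simp
  then have "(f ^^ Suc k) y = \<zero>\<^bsub>M\<^esub>" unfolding x(2) .
  then have "y \<in> U" using y(1) unfolding U_def by blast
  then have "y \<in> a_kernel M M (f ^^ k)" using Uk by blast
  then show ?thesis unfolding y(2) by (simp add: a_kernel_def')
qed

context ring
begin

text \<open>If \<open>n < m\<close>, the projection of \<open>R\<^sup>m\<close> onto \<open>R\<^sup>n\<close> followed by the isomorphism would be a
  surjective endomorphism of \<open>R\<^sup>m\<close> that kills a basis vector.\<close>

lemma free_rank_iso_ge:
  assumes noeth: "left_noetherian R" and nz: "\<one> \<noteq> \<zero>"
    and f: "f \<in> lm_iso R (free_rank R n) (free_rank R m)"
  shows "m \<le> n"
proof (rule ccontr)
  assume "\<not> m \<le> n"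
  then have nm: "n < m" by simp
  interpret F: left_module R "free_rank R m" by (rule left_module_free)
  note f' = lm_isoD[OF f]
  have sub: "{..<n} \<subseteq> {..<m}" using nm by auto
  define e where "e = f \<circ> truncate R {..<n}"
  have e: "e \<in> lm_hom R (free_rank R m) (free_rank R m)"
    unfolding e_def by (rule lm_hom_comp[OF truncate_hom_part[OF sub] f'(1)])
  have surj: "e ` carrier (free_rank R m) = carrier (free_rank R m)"
  proof
    show "e ` carrier (free_rank R m) \<subseteq> carrier (free_rank R m)" using lm_hom_closed[OF e] by blast
    show "carrier (free_rank R m) \<subseteq> e ` carrier (free_rank R m)"
    proof
      fix y assume "y \<in> carrier (free_rank R m)"
      then have "y \<in> f ` carrier (free_rank R n)" unfolding f'(3) .
      then obtain x where x: "x \<in> carrier (free_rank R n)" "y = f x" by (elim imageE)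
      moreover have "truncate R {..<n} x = x"
        using x(1) by (intro ext) (simp add: truncate_def free_module_simps(1))
      ultimately have "y = e x" "x \<in> carrier (free_rank R m)"
        using subsetD[OF free_module_mono[OF sub]] by (simp_all add: e_def)
      then show "y \<in> e ` carrier (free_rank R m)" by blast
    qed
  qed
  have "truncate R {..<n} (free_unit R n) = \<zero>\<^bsub>free_rank R n\<^esub>"
    by (auto simp: truncate_def free_unit_def free_module_simps(2))
  then have e0: "e (free_unit R n) = \<zero>\<^bsub>free_rank R m\<^esub>"
    using lm_hom_zero[OF left_module_free left_module_free f'(1)] by (simp add: e_def)
  have u: "free_unit R n \<in> carrier (free_rank R m)" using nm by (intro free_unit_closed) simp
  have "free_unit R n = \<zero>\<^bsub>free_rank R m\<^esub>"
    by (rule F.surjective_endomorphism_injective[OF _ e surj u e0])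
      (rule submodule_free_rank_finitely_generated[OF noeth])
  then have "free_unit R n n = \<zero>" by (simp only: free_module_simps(2))
  then show False using nz by (simp add: free_unit_def)
qed

lemma free_rank_iso_unique:
  assumes "left_noetherian R" "\<one> \<noteq> \<zero>" "f \<in> lm_iso R (free_rank R n) (free_rank R m)"
  shows "n = m"
  using free_rank_iso_ge[OF assms] free_rank_iso_ge[OF assms(1,2) lm_iso_inv[OF left_module_free assms(3)]]
  by simp

end

text \<open>Over the zero ring all free modules are isomorphic, but there all modules are zero and have
  the empty minimal basis.\<close>

lemma (in left_module) minimal_on_basis_trivial_ring:
  assumes "minimal_on_basis R n M f" "\<one> = \<zero>"
  shows "n = 0"
proof (rule ccontr)
  assume "n \<noteq> 0"
  define T where "T = (\<lambda>j. f (free_unit R j)) ` {..<n}"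
  define x where "x = f (free_unit R 0)"
  have xT: "x \<in> T" using \<open>n \<noteq> 0\<close> by (simp add: T_def x_def)
  have T: "minimal_basis R M T" using assms(1) by (simp add: minimal_on_basis_def T_def)
  then have "T \<subseteq> carrier M" by (simp add: minimal_basis_def generates_def)
  then have x: "x \<in> carrier M" using xT ..
  have "x = \<one> \<odot>\<^bsub>M\<^esub> x" by (rule smult_one[OF x, symmetric])
  also have "\<dots> = \<zero>\<^bsub>M\<^esub>" unfolding assms(2) by (rule smult_zero_left[OF x])
  finally show False using zero_notin_minimal_basis[OF T] xT by simp
qed

section \<open>Minimal resolutions\<close>

lemma (in left_module) minimal_on_basis_free_lift:
  assumes T: "minimal_basis R M T" and b: "bij_betw b {..<n} T"
  shows "free_lift R M {..<n} b \<in> lm_hom R (free_rank R n) M"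
    and "free_lift R M {..<n} b ` carrier (free_rank R n) = carrier M"
    and "minimal_on_basis R n M (free_lift R M {..<n} b)"
proof -
  have bT: "b ` {..<n} = T" and inj: "inj_on b {..<n}" using b by (auto simp: bij_betw_def)
  have TM: "T \<subseteq> carrier M" and gT: "generates R M T"
    using T by (simp_all add: minimal_basis_def generates_def)
  have bM: "b ` {..<n} \<subseteq> carrier M" unfolding bT by (rule TM)
  then have bc: "\<And>i. i \<in> {..<n} \<Longrightarrow> b i \<in> carrier M" by blast
  show "free_lift R M {..<n} b \<in> lm_hom R (free_rank R n) M" by (rule free_lift_hom[OF bc])
  show "free_lift R M {..<n} b ` carrier (free_rank R n) = carrier M"
    unfolding free_lift_image[OF bM] bT using gT by (simp add: generates_def)
  have u: "free_lift R M {..<n} b (free_unit R j) = b j" if "j \<in> {..<n}" for j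
    by (rule free_lift_unit[OF bc that])
  have "(\<lambda>j. free_lift R M {..<n} b (free_unit R j)) ` {..<n} = T"
    unfolding bT[symmetric] by (rule image_cong[OF refl u])
  moreover have "inj_on (\<lambda>j. free_lift R M {..<n} b (free_unit R j)) {..<n}"
    using inj u by (simp add: inj_on_def)
  ultimately show "minimal_on_basis R n M (free_lift R M {..<n} b)"
    using T by (simp add: minimal_on_basis_def)
qed

lemma lm_hom_codomain_restrict:
  "f \<in> lm_hom R M (N\<lparr>carrier := K\<rparr>) \<Longrightarrow> K \<subseteq> carrier N \<Longrightarrow> f \<in> lm_hom R M N"
  by (auto simp: lm_hom_def)

lemma (in ring) minimal_cover_of_submodule:
  assumes noeth: "left_noetherian R" and K: "submodule K R (free_rank R k)"
  shows "\<exists>n d. d \<in> lm_hom R (free_rank R n) (free_rank R k) \<and> d ` carrier (free_rank R n) = K \<and>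
    minimal_on_basis R n ((free_rank R k)\<lparr>carrier := K\<rparr>) d"
proof -
  interpret F: left_module R "free_rank R k" by (rule left_module_free)
  interpret K: left_module R "(free_rank R k)\<lparr>carrier := K\<rparr>" by (rule F.left_module_submodule[OF K])
  obtain S where S: "finite S" "S \<subseteq> K"
    "\<And>H. submodule H R (free_rank R k) \<Longrightarrow> S \<subseteq> H \<Longrightarrow> K \<subseteq> H"
    using submodule_free_rank_finitely_generated[OF noeth K] by auto
  have "generates R ((free_rank R k)\<lparr>carrier := K\<rparr>) S"
    unfolding K.generates_iff F.submodule_of_submodule_iff[OF K] using S by auto
  then obtain T where T: "T \<subseteq> S" "minimal_basis R ((free_rank R k)\<lparr>carrier := K\<rparr>) T"
    using K.minimal_basis_in_finite_generating_set[OF S(1)] by metis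
  have "finite T" using T(1) S(1) by (rule finite_subset)
  then obtain b where b: "bij_betw b {..<card T} T"
    using ex_bij_betw_nat_finite[of T] by (auto simp: atLeast0LessThan)
  note * = K.minimal_on_basis_free_lift[OF T(2) b]
  have "K \<subseteq> carrier (free_rank R k)" using K by (simp add: F.submodule_iff)
  with * show ?thesis using lm_hom_codomain_restrict[OF *(1)] by auto
qed

text \<open>Over a left noetherian ring every syzygy is finitely generated, so a minimal presentation
  can be continued step by step to a minimal resolution.\<close>

lemma (in ring) minimal_resolution_extending:
  assumes noeth: "left_noetherian R" and M: "left_module R M"
    and eps: "eps \<in> lm_hom R (free_rank R n0) M" "eps ` carrier (free_rank R n0) = carrier M"
      "minimal_on_basis R n0 M eps"
    and d0: "d0 \<in> lm_hom R (free_rank R n1) (free_rank R n0)"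
      "d0 ` carrier (free_rank R n1) = a_kernel (free_rank R n0) M eps"
      "minimal_on_basis R n1 ((free_rank R n0)\<lparr>carrier := a_kernel (free_rank R n0) M eps\<rparr>) d0"
  obtains n d where "minimal_resolution R M n eps d" "n 0 = n0" "n 1 = n1" "d 0 = d0"
proof -
  \<comment> \<open>the triple \<open>(a, b, d)\<close> stands for a differential \<open>d\<close> from \<open>R\<^sup>b\<close> to \<open>R\<^sup>a\<close>\<close>
  define P where "P = (\<lambda>(i::nat) s. (case s of (a, b, d) \<Rightarrow>
     d \<in> lm_hom R (free_rank R b) (free_rank R a) \<and>
     minimal_on_basis R b ((free_rank R a)\<lparr>carrier := d ` carrier (free_rank R b)\<rparr>) d \<and>
     (i = 0 \<longrightarrow> s = (n0, n1, d0))))"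
  define Q where "Q = (\<lambda>(i::nat) s s'. (case s of (a, b, d) \<Rightarrow> (case s' of (a', b', d') \<Rightarrow> a' = b \<and>
     d' ` carrier (free_rank R b') = a_kernel (free_rank R b) (free_rank R a) d)))"
  have "\<exists>f. \<forall>i. P i (f i) \<and> Q i (f i) (f (Suc i))"
  proof (rule dependent_nat_choice)
    show "\<exists>s. P 0 s" using d0 by (intro exI[of _ "(n0, n1, d0)"]) (simp add: P_def)
    fix s i assume s: "P i s"
    obtain a b d where sd: "s = (a, b, d)" by (metis prod_cases3)
    have d: "d \<in> lm_hom R (free_rank R b) (free_rank R a)" using s by (simp add: P_def sd)
    obtain n' d' where
      "d' \<in> lm_hom R (free_rank R n') (free_rank R b)"
      "d' ` carrier (free_rank R n') = a_kernel (free_rank R b) (free_rank R a) d"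
      "minimal_on_basis R n'
        ((free_rank R b)\<lparr>carrier := a_kernel (free_rank R b) (free_rank R a) d\<rparr>) d'"
      using minimal_cover_of_submodule[OF noeth submodule_kernel[OF left_module_free left_module_free d]]
      by auto
    then show "\<exists>s'. P (Suc i) s' \<and> Q i s s'"
      by (intro exI[of _ "(b, n', d')"]) (simp add: P_def Q_def sd)
  qed
  then obtain f where f: "\<And>i. P i (f i)" "\<And>i. Q i (f i) (f (Suc i))" by blast
  define n where "n = (\<lambda>i. fst (f i))"
  define d where "d = (\<lambda>i. snd (snd (f i)))"
  have next_rank: "fst (snd (f i)) = n (Suc i)" for i
    using f(2)[of i] by (simp add: Q_def n_def split: prod.splits)
  have fi: "f i = (n i, n (Suc i), d i)" for i
    using next_rank[of i] by (simp add: prod_eq_iff n_def d_def)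
  have f0: "n 0 = n0" "n (Suc 0) = n1" "d 0 = d0"
    using f(1)[of 0] unfolding fi by (simp_all add: P_def)
  have dhom: "d i \<in> lm_hom R (free_rank R (n (Suc i))) (free_rank R (n i))" for i
    using f(1)[of i] unfolding fi by (simp add: P_def)
  have dmin: "minimal_on_basis R (n (Suc i))
      ((free_rank R (n i))\<lparr>carrier := d i ` carrier (free_rank R (n (Suc i)))\<rparr>) (d i)" for i
    using f(1)[of i] unfolding fi by (simp add: P_def)
  have dexact: "d (Suc i) ` carrier (free_rank R (n (Suc (Suc i)))) =
      a_kernel (free_rank R (n (Suc i))) (free_rank R (n i)) (d i)" for i
    using f(2)[of i] unfolding fi by (simp add: Q_def)
  have "minimal_resolution R M n eps d"
    unfolding minimal_resolution_def free_resolution_def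
    using eps d0(1,2) f0 dhom dmin dexact by simp
  then show ?thesis using that f0 by simp
qed

lemma minimal_resolution_iso:
  assumes M: "left_module R M" and N: "left_module R N" and \<phi>: "\<phi> \<in> lm_iso R M N"
    and res: "minimal_resolution R M n eps d"
  shows "minimal_resolution R N n (\<phi> \<circ> eps) d"
proof -
  interpret M: left_module R M by fact
  note \<phi>' = lm_isoD[OF \<phi>]
  have eps: "eps \<in> lm_hom R (free_rank R (n 0)) M" "eps ` carrier (free_rank R (n 0)) = carrier M"
    using res by (simp_all add: minimal_resolution_def free_resolution_def)
  have c: "eps x \<in> carrier M" if "x \<in> carrier (free_rank R (n 0))" for x
    by (rule lm_hom_closed[OF eps(1) that])
  have "\<phi> (eps x) = \<zero>\<^bsub>N\<^esub> \<longleftrightarrow> eps x = \<zero>\<^bsub>M\<^esub>" if "x \<in> carrier (free_rank R (n 0))" for x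
    using inj_on_eq_iff[OF \<phi>'(2) c[OF that] M.zero_closed] lm_hom_zero[OF M N \<phi>'(1)] by simp
  then have ker: "a_kernel (free_rank R (n 0)) N (\<phi> \<circ> eps) = a_kernel (free_rank R (n 0)) M eps"
    by (auto simp: a_kernel_def')
  have img: "(\<phi> \<circ> eps) ` carrier (free_rank R (n 0)) = carrier N"
    unfolding image_comp[symmetric] eps(2) by (rule \<phi>'(3))
  have mb: "inj_on (\<lambda>j. eps (free_unit R j)) {..<n 0}"
      "minimal_basis R M ((\<lambda>j. eps (free_unit R j)) ` {..<n 0})"
    using res by (simp_all add: minimal_resolution_def minimal_on_basis_def)
  have "(\<lambda>j. eps (free_unit R j)) ` {..<n 0} \<subseteq> carrier M"
    using mb(2) by (simp add: minimal_basis_def generates_def)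
  then have "inj_on (\<phi> \<circ> (\<lambda>j. eps (free_unit R j))) {..<n 0}"
    by (intro comp_inj_on mb(1) inj_on_subset[OF \<phi>'(2)])
  moreover have "minimal_basis R N (\<phi> ` ((\<lambda>j. eps (free_unit R j)) ` {..<n 0}))"
    by (rule minimal_basis_iso[OF M N \<phi> mb(2)])
  ultimately have "minimal_on_basis R (n 0) N (\<phi> \<circ> eps)"
    by (simp add: minimal_on_basis_def comp_def image_image)
  then show ?thesis
    using res ker img lm_hom_comp[OF eps(1) \<phi>'(1)]
    by (simp add: minimal_resolution_def free_resolution_def)
qed

lemma transport_module:
  fixes M :: "('a, 'b, 'y) module_scheme" and \<iota> :: "'b \<Rightarrow> 'c"
  assumes M: "left_module R M" and \<iota>: "inj_on \<iota> (carrier M)"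
  obtains N :: "('a, 'c) module" where "left_module R N" "\<iota> \<in> lm_iso R M N"
proof -
  interpret M: left_module R M by fact
  let ?h = "the_inv_into (carrier M) \<iota>"
  define N :: "('a, 'c) module" where "N = \<lparr>carrier = \<iota> ` carrier M, monoid.mult = undefined,
     one = undefined, zero = \<iota> \<zero>\<^bsub>M\<^esub>, add = (\<lambda>a b. \<iota> (?h a \<oplus>\<^bsub>M\<^esub> ?h b)),
     smult = (\<lambda>r a. \<iota> (r \<odot>\<^bsub>M\<^esub> ?h a))\<rparr>"
  have h: "?h (\<iota> x) = x" if "x \<in> carrier M" for x by (rule the_inv_into_f_f[OF \<iota> that])
  have cN: "carrier N = \<iota> ` carrier M" and zN: "\<zero>\<^bsub>N\<^esub> = \<iota> \<zero>\<^bsub>M\<^esub>" by (simp_all add: N_def)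
  have aN: "\<iota> x \<oplus>\<^bsub>N\<^esub> \<iota> y = \<iota> (x \<oplus>\<^bsub>M\<^esub> y)" if "x \<in> carrier M" "y \<in> carrier M" for x y
    using that h by (simp add: N_def)
  have sN: "r \<odot>\<^bsub>N\<^esub> \<iota> x = \<iota> (r \<odot>\<^bsub>M\<^esub> x)" if "x \<in> carrier M" for r x
    using that h by (simp add: N_def)
  have "abelian_group N"
  proof (rule abelian_groupI)
    fix x assume "x \<in> carrier N"
    then obtain a where a: "a \<in> carrier M" "x = \<iota> a" unfolding cN by auto
    then have "\<iota> (\<ominus>\<^bsub>M\<^esub> a) \<oplus>\<^bsub>N\<^esub> x = \<zero>\<^bsub>N\<^esub>" "\<iota> (\<ominus>\<^bsub>M\<^esub> a) \<in> carrier N"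
      by (simp_all add: aN zN cN M.l_neg)
    then show "\<exists>y\<in>carrier N. y \<oplus>\<^bsub>N\<^esub> x = \<zero>\<^bsub>N\<^esub>" by blast
  qed (auto simp: cN zN aN M.a_assoc intro!: arg_cong[where f = \<iota>] M.a_comm)
  moreover have "left_module_axioms R N"
    unfolding left_module_axioms_def cN
    by (auto simp: aN sN M.smult_l_distr M.smult_r_distr M.smult_assoc1)
  ultimately have "left_module R N"
    by (intro left_module.intro M.R.ring_axioms)
  moreover have "\<iota> \<in> lm_iso R M N"
    using \<iota> by (auto simp: lm_iso_def lm_hom_def bij_betw_def cN aN sN)
  ultimately show ?thesis by (rule that)
qed

text \<open>Uniqueness of minimal resolutions is assumed for modules whose elements are sets of vectors.
  The fibres of the augmentation \<open>R\<^sup>n \<rightarrow> M\<close> identify \<open>M\<close> with such a module.\<close>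

lemma minimal_resolutions_isomorphic:
  fixes R :: "('a, 'x) ring_scheme" and M :: "('a, 'b, 'y) module_scheme"
  assumes uniq: "unique_minimal_resolutions R" and M: "left_module R M"
    and res: "minimal_resolution R M n eps d" and res': "minimal_resolution R M n' eps' d'"
  shows "resolutions_isomorphic R n d n' d'"
proof -
  define \<iota> where "\<iota> = (\<lambda>m. {x \<in> carrier (free_rank R (n 0)). eps x = m})"
  have surj: "eps ` carrier (free_rank R (n 0)) = carrier M"
    using res by (simp add: minimal_resolution_def free_resolution_def)
  have "inj_on \<iota> (carrier M)"
  proof (rule inj_onI)
    fix a b assume "a \<in> carrier M" and eq: "\<iota> a = \<iota> b"
    then obtain x where "x \<in> carrier (free_rank R (n 0))" "eps x = a"
      unfolding surj[symmetric] by auto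
    then have "x \<in> \<iota> a" by (simp add: \<iota>_def)
    then have "x \<in> \<iota> b" unfolding eq .
    with \<open>eps x = a\<close> show "a = b" by (simp add: \<iota>_def)
  qed
  from transport_module[OF M this] obtain N :: "('a, (nat \<Rightarrow> 'a) set) module"
    where N: "left_module R N" and \<iota>: "\<iota> \<in> lm_iso R M N" by metis
  note resN = minimal_resolution_iso[OF M N \<iota> res] and resN' = minimal_resolution_iso[OF M N \<iota> res']
  have "finitely_generated R N"
    unfolding finitely_generated_def
    using resN by (intro exI[of _ "(\<lambda>j. (\<iota> \<circ> eps) (free_unit R j)) ` {..<n 0}"])
      (simp add: minimal_resolution_def minimal_on_basis_def minimal_basis_def)
  then have "left_module R N \<and> finitely_generated R N" using N by simp
  with uniq show ?thesis
    using resN resN' unfolding unique_minimal_resolutions_def by metis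
qed

text \<open>Both presentations extend to minimal resolutions. An isomorphism of these starts with the two
  isomorphisms of free modules, which are automorphisms by invariance of rank.\<close>

lemma (in ring) minimal_presentations_isomorphic:
  assumes noeth: "left_noetherian R" and uniq: "unique_minimal_resolutions R"
    and M: "left_module R M"
    and eps: "eps \<in> lm_hom R (free_rank R n0) M" "eps ` carrier (free_rank R n0) = carrier M"
      "minimal_on_basis R n0 M eps"
    and d: "d \<in> lm_hom R (free_rank R n1) (free_rank R n0)"
      "d ` carrier (free_rank R n1) = a_kernel (free_rank R n0) M eps"
      "minimal_on_basis R n1 ((free_rank R n0)\<lparr>carrier := a_kernel (free_rank R n0) M eps\<rparr>) d"
    and eps': "eps' \<in> lm_hom R (free_rank R n0') M" "eps' ` carrier (free_rank R n0') = carrier M"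
      "minimal_on_basis R n0' M eps'"
    and d': "d' \<in> lm_hom R (free_rank R n1') (free_rank R n0')"
      "d' ` carrier (free_rank R n1') = a_kernel (free_rank R n0') M eps'"
      "minimal_on_basis R n1' ((free_rank R n0')\<lparr>carrier := a_kernel (free_rank R n0') M eps'\<rparr>) d'"
  shows "n0' = n0 \<and> n1' = n1 \<and> (\<exists>\<phi> \<psi>. \<phi> \<in> lm_iso R (free_rank R n0) (free_rank R n0) \<and>
     \<psi> \<in> lm_iso R (free_rank R n1) (free_rank R n1) \<and>
     (\<forall>x\<in>carrier (free_rank R n1). \<phi> (d x) = d' (\<psi> x)))"
proof -
  obtain n D where res: "minimal_resolution R M n eps D" "n 0 = n0" "n 1 = n1" "D 0 = d"
    using minimal_resolution_extending[OF noeth M eps d] by metis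
  obtain n' D' where res': "minimal_resolution R M n' eps' D'" "n' 0 = n0'" "n' 1 = n1'" "D' 0 = d'"
    using minimal_resolution_extending[OF noeth M eps' d'] by metis
  obtain \<phi> where iso: "\<And>i. \<phi> i \<in> lm_iso R (free_rank R (n i)) (free_rank R (n' i))"
    and comm: "\<And>i x. x \<in> carrier (free_rank R (n (Suc i))) \<Longrightarrow> \<phi> i (D i x) = D' i (\<phi> (Suc i) x)"
    using minimal_resolutions_isomorphic[OF uniq M res(1) res'(1)]
    unfolding resolutions_isomorphic_def by auto
  have iso0: "\<phi> 0 \<in> lm_iso R (free_rank R n0) (free_rank R n0')"
    and iso1: "\<phi> 1 \<in> lm_iso R (free_rank R n1) (free_rank R n1')"
    using iso[of 0] iso[of 1] unfolding res(2,3) res'(2,3) by simp_all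
  have comm0: "\<phi> 0 (d x) = d' (\<phi> 1 x)" if "x \<in> carrier (free_rank R n1)" for x
    using comm[of x 0] that res(3,4) res'(4) by simp
  have "n0' = n0 \<and> n1' = n1"
  proof (cases "\<one> = \<zero>")
    case True
    interpret M: left_module R M by fact
    interpret F: left_module R "free_rank R n0" by (rule left_module_free)
    interpret F': left_module R "free_rank R n0'" by (rule left_module_free)
    note K = F.left_module_submodule[OF submodule_kernel[OF left_module_free M eps(1)]]
    note K' = F'.left_module_submodule[OF submodule_kernel[OF left_module_free M eps'(1)]]
    show ?thesis
      using M.minimal_on_basis_trivial_ring[OF eps(3) True] M.minimal_on_basis_trivial_ring[OF eps'(3) True]
        left_module.minimal_on_basis_trivial_ring[OF K d(3) True]
        left_module.minimal_on_basis_trivial_ring[OF K' d'(3) True] by simp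
  next
    case False
    then show ?thesis
      using free_rank_iso_unique[OF noeth False iso0] free_rank_iso_unique[OF noeth False iso1] by simp
  qed
  then show ?thesis using iso0 iso1 comm0 by blast
qed

section \<open>Direct decompositions and coloured presentations\<close>

context left_module
begin

lemma finsum_single:
  assumes "finite I" "i \<in> I" "x \<in> carrier M"
  shows "(\<Oplus>\<^bsub>M\<^esub>k\<in>I. if k = i then x else \<zero>\<^bsub>M\<^esub>) = x"
  using M.add.finprod_singleton_swap[of i I "\<lambda>_. x"] assms by simp

lemma decomposition_submodule:
  "direct_decomposition R M t N \<Longrightarrow> i < t \<Longrightarrow> submodule (N i) R M"
  by (simp add: direct_decomposition_def)

lemma decomposition_carrier:
  assumes "direct_decomposition R M t N" "i < t" "x \<in> N i" shows "x \<in> carrier M"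
  using decomposition_submodule[OF assms(1,2)] assms(3) unfolding submodule_iff by blast

lemma decomposition_exists:
  assumes "direct_decomposition R M t N" "x \<in> carrier M"
  obtains f where "\<And>i. i < t \<Longrightarrow> f i \<in> N i" "(\<Oplus>\<^bsub>M\<^esub>i\<in>{..<t}. f i) = x"
  using assms unfolding direct_decomposition_def by (metis PiE_mem lessThan_iff)

lemma decomposition_components_unique:
  assumes D: "direct_decomposition R M t N"
    and f: "\<And>i. i < t \<Longrightarrow> f i \<in> N i" and h: "\<And>i. i < t \<Longrightarrow> h i \<in> N i"
    and eq: "(\<Oplus>\<^bsub>M\<^esub>i\<in>{..<t}. f i) = (\<Oplus>\<^bsub>M\<^esub>i\<in>{..<t}. h i)" and i: "i < t"
  shows "f i = h i"
proof -
  have fc: "f \<in> {..<t} \<rightarrow> carrier M" and hc: "h \<in> {..<t} \<rightarrow> carrier M"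
    using decomposition_carrier[OF D] f h by auto
  let ?x = "\<Oplus>\<^bsub>M\<^esub>i\<in>{..<t}. f i"
  have "?x \<in> carrier M" by (rule M.finsum_closed[OF fc])
  define Q where "Q = (\<lambda>e. e \<in> (\<Pi>\<^sub>E i\<in>{..<t}. N i) \<and> (\<Oplus>\<^bsub>M\<^esub>i\<in>{..<t}. e i) = ?x)"
  have uex: "\<exists>!e. Q e"
    using D \<open>?x \<in> carrier M\<close> by (simp add: direct_decomposition_def Q_def)
  have sf: "(\<Oplus>\<^bsub>M\<^esub>i\<in>{..<t}. restrict f {..<t} i) = ?x"
    by (rule M.finsum_cong'[OF refl fc]) simp
  have "restrict f {..<t} \<in> (\<Pi>\<^sub>E i\<in>{..<t}. N i)" using f by auto
  then have Qf: "Q (restrict f {..<t})" unfolding Q_def using sf by (rule conjI)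
  have sh: "(\<Oplus>\<^bsub>M\<^esub>i\<in>{..<t}. restrict h {..<t} i) = ?x"
    unfolding eq by (rule M.finsum_cong'[OF refl hc]) simp
  have "restrict h {..<t} \<in> (\<Pi>\<^sub>E i\<in>{..<t}. N i)" using h by auto
  then have Qh: "Q (restrict h {..<t})" unfolding Q_def using sh by (rule conjI)
  have "restrict f {..<t} = restrict h {..<t}" using uex Qf Qh by blast
  then have "restrict f {..<t} i = restrict h {..<t} i" by simp
  with i show ?thesis by simp
qed

lemma decomposition_components_zero:
  assumes D: "direct_decomposition R M t N"
    and f: "\<And>i. i < t \<Longrightarrow> f i \<in> N i" and eq: "(\<Oplus>\<^bsub>M\<^esub>i\<in>{..<t}. f i) = \<zero>\<^bsub>M\<^esub>" and i: "i < t"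
  shows "f i = \<zero>\<^bsub>M\<^esub>"
proof (rule decomposition_components_unique[OF D f _ _ i])
  show "\<zero>\<^bsub>M\<^esub> \<in> N j" if "j < t" for j
    using decomposition_submodule[OF D that] by (simp add: submodule_iff)
qed (simp_all add: eq)

lemma decomposition_component_of_member:
  assumes D: "direct_decomposition R M t N" and k: "k < t" "x \<in> N k"
    and f: "\<And>i. i < t \<Longrightarrow> f i \<in> N i" and eq: "(\<Oplus>\<^bsub>M\<^esub>i\<in>{..<t}. f i) = x" and i: "i < t"
  shows "f i = (if i = k then x else \<zero>\<^bsub>M\<^esub>)"
proof (rule decomposition_components_unique[OF D f _ _ i])
  show "(if j = k then x else \<zero>\<^bsub>M\<^esub>) \<in> N j" if "j < t" for j
    using decomposition_submodule[OF D that] k(2) by (simp add: submodule_iff)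
  show "(\<Oplus>\<^bsub>M\<^esub>i\<in>{..<t}. f i) = (\<Oplus>\<^bsub>M\<^esub>i\<in>{..<t}. if i = k then x else \<zero>\<^bsub>M\<^esub>)"
    using finsum_single[of "{..<t}" k x] k decomposition_carrier[OF D k] eq by simp
qed simp

lemma decomposition_disjoint:
  assumes D: "direct_decomposition R M t N" and "i < t" "j < t" "i \<noteq> j" "x \<in> N i" "x \<in> N j"
  shows "x = \<zero>\<^bsub>M\<^esub>"
proof -
  have "(if i = j then x else \<zero>\<^bsub>M\<^esub>) = (if i = i then x else \<zero>\<^bsub>M\<^esub>)"
  proof (rule decomposition_component_of_member[OF D \<open>i < t\<close> \<open>x \<in> N i\<close> _ _ \<open>i < t\<close>])
    show "(if k = j then x else \<zero>\<^bsub>M\<^esub>) \<in> N k" if "k < t" for k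
      using decomposition_submodule[OF D that] \<open>x \<in> N j\<close> by (simp add: submodule_iff)
    show "(\<Oplus>\<^bsub>M\<^esub>k\<in>{..<t}. if k = j then x else \<zero>\<^bsub>M\<^esub>) = x"
      using \<open>j < t\<close> decomposition_carrier[OF D \<open>i < t\<close> \<open>x \<in> N i\<close>] by (intro finsum_single) simp_all
  qed
  then show ?thesis using \<open>i \<noteq> j\<close> by simp
qed

text \<open>Two families of components with the same sum differ by components of zero.\<close>

lemma direct_decompositionI:
  assumes N: "\<And>i. i < t \<Longrightarrow> submodule (N i) R M"
    and ex: "\<And>x. x \<in> carrier M \<Longrightarrow> \<exists>f. (\<forall>i<t. f i \<in> N i) \<and> (\<Oplus>\<^bsub>M\<^esub>i\<in>{..<t}. f i) = x"
    and ind: "\<And>f i. (\<And>i. i < t \<Longrightarrow> f i \<in> N i) \<Longrightarrow> (\<Oplus>\<^bsub>M\<^esub>i\<in>{..<t}. f i) = \<zero>\<^bsub>M\<^esub> \<Longrightarrow> i < t \<Longrightarrow> f i = \<zero>\<^bsub>M\<^esub>"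
  shows "direct_decomposition R M t N"
  unfolding direct_decomposition_def
proof (intro conjI allI impI ballI)
  have NM: "N i \<subseteq> carrier M" if "i < t" for i using N[OF that] unfolding submodule_iff by (elim conjE)
  fix x assume "x \<in> carrier M"
  then obtain f where f: "\<And>i. i < t \<Longrightarrow> f i \<in> N i" "(\<Oplus>\<^bsub>M\<^esub>i\<in>{..<t}. f i) = x" using ex by metis
  have fc: "f i \<in> carrier M" if "i < t" for i using NM[OF that] f(1)[OF that] by (rule subsetD)
  show "\<exists>!e. e \<in> (\<Pi>\<^sub>E i\<in>{..<t}. N i) \<and> (\<Oplus>\<^bsub>M\<^esub>i\<in>{..<t}. e i) = x"
  proof (rule ex1I[of _ "restrict f {..<t}"], intro conjI)
    show "restrict f {..<t} \<in> (\<Pi>\<^sub>E i\<in>{..<t}. N i)" using f(1) by auto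
    have "(\<Oplus>\<^bsub>M\<^esub>i\<in>{..<t}. restrict f {..<t} i) = (\<Oplus>\<^bsub>M\<^esub>i\<in>{..<t}. f i)"
      by (rule M.finsum_cong'[OF refl]) (use fc in auto)
    then show "(\<Oplus>\<^bsub>M\<^esub>i\<in>{..<t}. restrict f {..<t} i) = x" using f(2) by simp
  next
    fix e assume e: "e \<in> (\<Pi>\<^sub>E i\<in>{..<t}. N i) \<and> (\<Oplus>\<^bsub>M\<^esub>i\<in>{..<t}. e i) = x"
    then have eN: "e i \<in> N i" if "i < t" for i using that by auto
    have ec: "e i \<in> carrier M" if "i < t" for i using NM[OF that] eN[OF that] by (rule subsetD)
    define h where "h = (\<lambda>i. e i \<oplus>\<^bsub>M\<^esub> (\<ominus>\<^bsub>M\<^esub> f i))"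
    have hN: "h i \<in> N i" if "i < t" for i
      using N[OF that] eN[OF that] submodule_neg[OF N[OF that] f(1)[OF that]]
      by (simp add: h_def submodule_iff)
    have hc: "h i \<in> carrier M" if "i < t" for i using NM[OF that] hN[OF that] by (rule subsetD)
    have "(\<Oplus>\<^bsub>M\<^esub>i\<in>{..<t}. e i) = (\<Oplus>\<^bsub>M\<^esub>i\<in>{..<t}. h i \<oplus>\<^bsub>M\<^esub> f i)"
      by (rule M.finsum_cong'[OF refl]) (use ec fc in \<open>auto simp: h_def M.a_assoc M.l_neg\<close>)
    also have "\<dots> = (\<Oplus>\<^bsub>M\<^esub>i\<in>{..<t}. h i) \<oplus>\<^bsub>M\<^esub> (\<Oplus>\<^bsub>M\<^esub>i\<in>{..<t}. f i)"
      by (rule M.finsum_addf) (use hc fc in auto)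
    finally have "x = (\<Oplus>\<^bsub>M\<^esub>i\<in>{..<t}. h i) \<oplus>\<^bsub>M\<^esub> x" using e f(2) by simp
    moreover have "(\<Oplus>\<^bsub>M\<^esub>i\<in>{..<t}. h i) \<in> carrier M" by (rule M.finsum_closed) (use hc in auto)
    ultimately have h0: "(\<Oplus>\<^bsub>M\<^esub>i\<in>{..<t}. h i) = \<zero>\<^bsub>M\<^esub>"
      using \<open>x \<in> carrier M\<close> M.add.r_cancel_one'[of x "\<Oplus>\<^bsub>M\<^esub>i\<in>{..<t}. h i"] by simp
    have "e i = f i" if "i < t" for i
      using ind[of h, OF hN h0 that] ec[OF that] fc[OF that] M.minus_equality[of "e i" "\<ominus>\<^bsub>M\<^esub> f i"]
      by (simp add: h_def)
    then show "e = restrict f {..<t}" using e by (auto simp: PiE_def extensional_def fun_eq_iff)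
  qed
qed (rule N)

text \<open>Splitting the \<open>k\<close>-th component splits every element. If new components add up to zero, then
  those in \<open>A\<close> and \<open>B\<close> together form a component in \<open>N k\<close>, which is zero; hence both lie in
  \<open>A \<inter> B\<close>.\<close>

lemma decomposition_refine:
  assumes D: "direct_decomposition R M t N" and k: "k < t"
    and A: "submodule A R M" and B: "submodule B R M"
    and AB: "A \<inter> B = {\<zero>\<^bsub>M\<^esub>}" and sum: "A <+>\<^bsub>M\<^esub> B = N k"
  shows "direct_decomposition R M (Suc t) (N(k := A, t := B))"
proof (rule direct_decompositionI)
  fix i assume "i < Suc t"
  then show "submodule ((N(k := A, t := B)) i) R M"
    using A B decomposition_submodule[OF D] by simp
next
  have AM: "A \<subseteq> carrier M" and BM: "B \<subseteq> carrier M" using A B by (simp_all add: submodule_iff)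
  fix x assume "x \<in> carrier M"
  then obtain f where f: "\<And>i. i < t \<Longrightarrow> f i \<in> N i" "(\<Oplus>\<^bsub>M\<^esub>i\<in>{..<t}. f i) = x"
    using decomposition_exists[OF D] by metis
  have fc: "f i \<in> carrier M" if "i < t" for i using decomposition_carrier[OF D that f(1)[OF that]] .
  obtain a b where ab: "a \<in> A" "b \<in> B" "f k = a \<oplus>\<^bsub>M\<^esub> b"
    using f(1)[OF k] unfolding sum[symmetric] set_add_def' by auto
  have abc: "a \<in> carrier M" "b \<in> carrier M" using ab AM BM by auto
  let ?g = "f(k := a, t := b)"
  have "(\<Oplus>\<^bsub>M\<^esub>i\<in>{..<Suc t}. ?g i) = b \<oplus>\<^bsub>M\<^esub> (\<Oplus>\<^bsub>M\<^esub>i\<in>{..<t}. ?g i)"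
    unfolding lessThan_Suc by (subst M.finsum_insert) (use fc abc in auto)
  moreover have "(\<Oplus>\<^bsub>M\<^esub>i\<in>{..<t}. f i)
      = (\<Oplus>\<^bsub>M\<^esub>i\<in>{..<t}. ?g i \<oplus>\<^bsub>M\<^esub> (if i = k then b else \<zero>\<^bsub>M\<^esub>))"
    by (rule M.finsum_cong'[OF refl]) (use fc abc ab(3) in auto)
  moreover have "\<dots> = (\<Oplus>\<^bsub>M\<^esub>i\<in>{..<t}. ?g i) \<oplus>\<^bsub>M\<^esub> (\<Oplus>\<^bsub>M\<^esub>i\<in>{..<t}. if i = k then b else \<zero>\<^bsub>M\<^esub>)"
    by (rule M.finsum_addf) (use fc abc in auto)
  moreover have "(\<Oplus>\<^bsub>M\<^esub>i\<in>{..<t}. if i = k then b else \<zero>\<^bsub>M\<^esub>) = b"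
    by (rule finsum_single) (use k abc in auto)
  moreover have "(\<Oplus>\<^bsub>M\<^esub>i\<in>{..<t}. ?g i) \<in> carrier M" by (rule M.finsum_closed) (use fc abc in auto)
  ultimately have "(\<Oplus>\<^bsub>M\<^esub>i\<in>{..<Suc t}. ?g i) = x"
    using f(2) abc by (simp add: M.a_comm)
  moreover have "\<forall>i<Suc t. ?g i \<in> (N(k := A, t := B)) i" using f(1) ab by (auto simp: less_Suc_eq)
  ultimately show "\<exists>f. (\<forall>i<Suc t. f i \<in> (N(k := A, t := B)) i) \<and> (\<Oplus>\<^bsub>M\<^esub>i\<in>{..<Suc t}. f i) = x" by blast
next
  have AM: "A \<subseteq> carrier M" and BM: "B \<subseteq> carrier M" using A B by (simp_all add: submodule_iff)
  fix g i assume g: "\<And>i. i < Suc t \<Longrightarrow> g i \<in> (N(k := A, t := B)) i"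
    and g0: "(\<Oplus>\<^bsub>M\<^esub>i\<in>{..<Suc t}. g i) = \<zero>\<^bsub>M\<^esub>" and i: "i < Suc t"
  have gA: "g k \<in> A" and gB: "g t \<in> B"
    using g[of k] g[of t] k by (simp_all split: if_splits)
  have gN: "g j \<in> N j" if "j < t" "j \<noteq> k" for j
    using g[of j] that by simp
  have gc: "g i \<in> carrier M" if "i < Suc t" for i
    using that gA gB gN AM BM decomposition_carrier[OF D]
    by (cases "i = k"; cases "i = t") (auto simp: less_Suc_eq)
  have kt: "g k \<in> carrier M" "g t \<in> carrier M" using gc k by auto
  define f where "f = (\<lambda>i. g i \<oplus>\<^bsub>M\<^esub> (if i = k then g t else \<zero>\<^bsub>M\<^esub>))"
  have "(\<Oplus>\<^bsub>M\<^esub>i\<in>{..<t}. f i)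
      = (\<Oplus>\<^bsub>M\<^esub>i\<in>{..<t}. g i) \<oplus>\<^bsub>M\<^esub> (\<Oplus>\<^bsub>M\<^esub>i\<in>{..<t}. if i = k then g t else \<zero>\<^bsub>M\<^esub>)"
    unfolding f_def by (rule M.finsum_addf) (use gc in auto)
  also have "(\<Oplus>\<^bsub>M\<^esub>i\<in>{..<t}. if i = k then g t else \<zero>\<^bsub>M\<^esub>) = g t"
    by (rule finsum_single) (use k gc in auto)
  also have "(\<Oplus>\<^bsub>M\<^esub>i\<in>{..<t}. g i) \<oplus>\<^bsub>M\<^esub> g t = g t \<oplus>\<^bsub>M\<^esub> (\<Oplus>\<^bsub>M\<^esub>i\<in>{..<t}. g i)"
    by (rule M.a_comm[OF M.finsum_closed]) (use gc in auto)
  also have "\<dots> = (\<Oplus>\<^bsub>M\<^esub>i\<in>{..<Suc t}. g i)"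
    unfolding lessThan_Suc by (subst M.finsum_insert) (use gc in auto)
  finally have f0: "(\<Oplus>\<^bsub>M\<^esub>i\<in>{..<t}. f i) = \<zero>\<^bsub>M\<^esub>" using g0 by simp
  have fN: "f j \<in> N j" if "j < t" for j
  proof (cases "j = k")
    case True
    have "f k \<in> A <+>\<^bsub>M\<^esub> B" using gA gB by (auto simp: f_def set_add_def')
    then show ?thesis using sum True by simp
  next
    case False
    then show ?thesis using gN[OF that False] gc[of j] that by (simp add: f_def)
  qed
  have fz: "f j = \<zero>\<^bsub>M\<^esub>" if "j < t" for j
    by (rule decomposition_components_zero[OF D fN f0 that])
  have "g k \<oplus>\<^bsub>M\<^esub> g t = \<zero>\<^bsub>M\<^esub>" using fz[OF k] by (simp add: f_def)
  then have "g k = \<ominus>\<^bsub>M\<^esub> g t" using M.minus_equality[of "g k" "g t"] kt by simp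
  then have "g k \<in> A \<inter> B" using gA submodule_neg[OF B gB] by simp
  then have gk: "g k = \<zero>\<^bsub>M\<^esub>" unfolding AB by simp
  then have gt: "g t = \<zero>\<^bsub>M\<^esub>" using \<open>g k \<oplus>\<^bsub>M\<^esub> g t = \<zero>\<^bsub>M\<^esub>\<close> kt by simp
  show "g i = \<zero>\<^bsub>M\<^esub>"
  proof (cases "i = t \<or> i = k")
    case True
    then show ?thesis using gk gt by auto
  next
    case False
    then show ?thesis using fz[of i] gc[of i] i by (simp add: f_def)
  qed
qed

end

definition colour_part :: "('a, 'x) ring_scheme \<Rightarrow> 'i set \<Rightarrow> ('i \<Rightarrow> nat) \<Rightarrow> nat \<Rightarrow> ('i \<Rightarrow> 'a) \<Rightarrow> 'i \<Rightarrow> 'a"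
  where "colour_part R X c k = truncate R {i \<in> X. c i = k}"

context ring
begin

lemma colour_part_hom: "colour_part R X c k \<in> lm_hom R (free_module R X) (free_module R X)"
  unfolding colour_part_def by (rule truncate_hom)

lemma colour_part_closed:
  "x \<in> carrier (free_module R X) \<Longrightarrow> colour_part R X c k x \<in> carrier (free_module R {i \<in> X. c i = k})"
  unfolding colour_part_def by (rule truncate_closed_part) auto

lemma finsum_colour_parts:
  assumes M: "left_module R M" and eps: "eps \<in> lm_hom R (free_module R X) M"
    and x: "x \<in> carrier (free_module R X)"
  shows "(\<Oplus>\<^bsub>M\<^esub>k\<in>{..<n}. eps (colour_part R X c k x)) = eps (truncate R {i \<in> X. c i < n} x)"
proof (induction n)
  case 0
  interpret M: left_module R M by fact
  have "truncate R {i \<in> X. c i < 0} x = \<zero>\<^bsub>free_module R X\<^esub>"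
    by (simp add: truncate_def free_module_simps(2))
  then have "eps (truncate R {i \<in> X. c i < 0} x) = \<zero>\<^bsub>M\<^esub>"
    using lm_hom_zero[OF left_module_free M eps] by simp
  then show ?case by simp
next
  case (Suc n)
  interpret M: left_module R M by fact
  have c: "eps (truncate R Y x) \<in> carrier M" for Y
    by (rule lm_hom_closed[OF eps truncate_closed[OF x]])
  then have c': "eps (colour_part R X c k x) \<in> carrier M" for k unfolding colour_part_def .
  have "truncate R {i \<in> X. c i < Suc n} x
      = colour_part R X c n x \<oplus>\<^bsub>free_module R X\<^esub> truncate R {i \<in> X. c i < n} x"
    using free_carrier_closed[OF x]
    by (auto simp: truncate_def colour_part_def free_module_simps(3) fun_eq_iff less_Suc_eq)
  then have "eps (truncate R {i \<in> X. c i < Suc n} x)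
      = eps (colour_part R X c n x) \<oplus>\<^bsub>M\<^esub> eps (truncate R {i \<in> X. c i < n} x)"
    using lm_hom_add[OF eps truncate_closed[OF x] truncate_closed[OF x]] by (simp add: colour_part_def)
  moreover have "(\<Oplus>\<^bsub>M\<^esub>k\<in>{..<Suc n}. eps (colour_part R X c k x))
      = eps (colour_part R X c n x) \<oplus>\<^bsub>M\<^esub> (\<Oplus>\<^bsub>M\<^esub>k\<in>{..<n}. eps (colour_part R X c k x))"
    unfolding lessThan_Suc by (rule M.M.finsum_insert) (use c' in auto)
  ultimately show ?case using Suc by simp
qed

lemma truncate_all_colours:
  assumes "x \<in> carrier (free_module R X)" "\<And>i. i \<in> X \<Longrightarrow> c i < t"
  shows "truncate R {i \<in> X. c i < t} x = x"
  using assms by (auto simp: truncate_def free_module_simps(1) fun_eq_iff)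

text \<open>The part of one colour of a monochrome vector is the vector itself or zero, and taking this
  part is linear.\<close>

lemma kernel_colour_closed_if_monochrome:
  assumes K: "submodule K R (free_module R X)"
    and S: "generates R ((free_module R X)\<lparr>carrier := K\<rparr>) S"
    and mono: "\<And>s i j. s \<in> S \<Longrightarrow> i \<in> X \<Longrightarrow> j \<in> X \<Longrightarrow> s i \<noteq> \<zero> \<Longrightarrow> s j \<noteq> \<zero> \<Longrightarrow> c i = c j"
    and x: "x \<in> K"
  shows "colour_part R X c k x \<in> K"
proof -
  interpret F: left_module R "free_module R X" by (rule left_module_free)
  have SK: "S \<subseteq> K" using S by (simp add: generates_def)
  have KF: "K \<subseteq> carrier (free_module R X)" and zK: "(\<lambda>_. \<zero>) \<in> K"
    using K by (simp_all add: F.submodule_iff free_module_simps(2))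
  let ?H = "{x \<in> carrier (free_module R X). colour_part R X c k x \<in> K}"
  have "S \<subseteq> ?H"
  proof
    fix s assume s: "s \<in> S"
    then have sF: "s \<in> carrier (free_module R X)" using SK KF by auto
    have "colour_part R X c k s = s \<or> colour_part R X c k s = (\<lambda>_. \<zero>)"
    proof (cases "\<exists>j\<in>X. s j \<noteq> \<zero> \<and> c j = k")
      case True
      then obtain j where j: "j \<in> X" "s j \<noteq> \<zero>" "c j = k" by auto
      have "s i = \<zero>" if "\<not> (i \<in> X \<and> c i = k)" for i
        using that j mono[OF s _ j(1) _ j(2), of i] sF by (auto simp: free_module_simps(1))
      then have "colour_part R X c k s = s" by (auto simp: colour_part_def truncate_def fun_eq_iff)
      then show ?thesis ..
    next
      case False
      then have "colour_part R X c k s = (\<lambda>_. \<zero>)"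
        by (auto simp: colour_part_def truncate_def fun_eq_iff)
      then show ?thesis ..
    qed
    then have "colour_part R X c k s \<in> K" using s SK zK by auto
    then show "s \<in> ?H" using sF by simp
  qed
  moreover have "submodule ?H R (free_module R X)"
    by (rule submodule_vimage[OF left_module_free left_module_free colour_part_hom K])
  ultimately have "K \<subseteq> ?H" using F.generates_submoduleD[OF K S] by simp
  then show ?thesis using x by auto
qed

text \<open>A colouring of the basis splits a free module into coordinate submodules. The decomposition
  passes to the quotient by a submodule that contains the coloured parts of its elements.\<close>

lemma coloured_presentation_decomposition:
  assumes M: "left_module R M" and eps: "eps \<in> lm_hom R (free_module R X) M"
    and surj: "eps ` carrier (free_module R X) = carrier M"
    and c: "\<And>i. i \<in> X \<Longrightarrow> c i < t"
    and closed: "\<And>k x. k < t \<Longrightarrow> x \<in> a_kernel (free_module R X) M eps \<Longrightarrow>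
      colour_part R X c k x \<in> a_kernel (free_module R X) M eps"
  shows "direct_decomposition R M t (\<lambda>k. eps ` carrier (free_module R {i \<in> X. c i = k}))"
proof -
  interpret M: left_module R M by fact
  show ?thesis
  proof (rule M.direct_decompositionI)
    fix k
    have sub: "{i \<in> X. c i = k} \<subseteq> X" by auto
    have "eps \<circ> (\<lambda>x. x) \<in> lm_hom R (free_module R {i \<in> X. c i = k}) M"
      by (rule lm_hom_comp[OF inclusion_hom[OF sub] eps])
    then have h: "eps \<in> lm_hom R (free_module R {i \<in> X. c i = k}) M" by (simp add: comp_def)
    show "submodule (eps ` carrier (free_module R {i \<in> X. c i = k})) R M"
      by (rule submodule_image[OF left_module_free M h left_module.submodule_carrier[OF left_module_free]])
  next
    fix m assume "m \<in> carrier M"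
    then obtain x where x: "x \<in> carrier (free_module R X)" "m = eps x" unfolding surj[symmetric] by auto
    have "(\<Oplus>\<^bsub>M\<^esub>k\<in>{..<t}. eps (colour_part R X c k x)) = m"
      using finsum_colour_parts[OF M eps x(1), where c = c and n = t]
        truncate_all_colours[OF x(1), where c = c and t = t] c x(2) by simp
    then show "\<exists>f. (\<forall>k<t. f k \<in> eps ` carrier (free_module R {i \<in> X. c i = k})) \<and>
        (\<Oplus>\<^bsub>M\<^esub>k\<in>{..<t}. f k) = m"
      using colour_part_closed[OF x(1)] by (intro exI[of _ "\<lambda>k. eps (colour_part R X c k x)"]) simp
  next
    fix f k assume f: "\<And>i. i < t \<Longrightarrow> f i \<in> eps ` carrier (free_module R {j \<in> X. c j = i})"
      and f0: "(\<Oplus>\<^bsub>M\<^esub>i\<in>{..<t}. f i) = \<zero>\<^bsub>M\<^esub>" and k: "k < t"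
    have "\<forall>i\<in>{..<t}. \<exists>x. x \<in> carrier (free_module R {j \<in> X. c j = i}) \<and> f i = eps x" using f by auto
    then obtain X' where X': "\<And>i. i < t \<Longrightarrow> X' i \<in> carrier (free_module R {j \<in> X. c j = i})"
      "\<And>i. i < t \<Longrightarrow> f i = eps (X' i)" by (metis lessThan_iff)
    \<comment> \<open>the vectors of the different colours have disjoint supports and are glued to one vector\<close>
    define x where "x = (\<lambda>i. if i \<in> X then X' (c i) i else \<zero>)"
    have fin: "finite {i. X' l i \<noteq> \<zero>}" if "l < t" for l
      using X'(1)[OF that] by (simp add: free_module_simps(1))
    have "{i. x i \<noteq> \<zero>} \<subseteq> (\<Union>l\<in>{..<t}. {i. X' l i \<noteq> \<zero>})"
      using c by (auto simp: x_def split: if_splits)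
    then have "finite {i. x i \<noteq> \<zero>}" by (rule finite_subset) (use fin in auto)
    moreover have "x i \<in> carrier R" if "i \<in> X" for i
      using free_carrier_closed[OF X'(1)[OF c[OF that]]] that by (simp add: x_def)
    ultimately have x: "x \<in> carrier (free_module R X)" by (simp add: free_module_simps(1) x_def)
    have part: "colour_part R X c l x = X' l" if "l < t" for l
      using X'(1)[OF that] by (auto simp: colour_part_def truncate_def x_def free_module_simps(1) fun_eq_iff)
    have "f l \<in> carrier M" if "l < t" for l
    proof -
      have "X' l \<in> carrier (free_module R X)"
        by (rule subsetD[OF free_module_mono X'(1)[OF that]]) auto
      then show ?thesis unfolding X'(2)[OF that] by (rule lm_hom_closed[OF eps])
    qed
    then have fc: "f \<in> {..<t} \<rightarrow> carrier M" by auto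
    have "eps x = (\<Oplus>\<^bsub>M\<^esub>l\<in>{..<t}. eps (colour_part R X c l x))"
      using finsum_colour_parts[OF M eps x, where c = c and n = t]
        truncate_all_colours[OF x, where c = c and t = t] c by simp
    also have "\<dots> = (\<Oplus>\<^bsub>M\<^esub>l\<in>{..<t}. f l)"
      by (rule M.M.finsum_cong'[OF refl fc]) (simp add: part X'(2))
    finally have "x \<in> a_kernel (free_module R X) M eps" using f0 x by (simp add: a_kernel_def')
    from closed[OF k this] show "f k = \<zero>\<^bsub>M\<^esub>"
      using part[OF k] X'(2)[OF k] by (simp add: a_kernel_def')
  qed
qed

lemma coloured_image:
  assumes M: "left_module R M" and eps: "eps \<in> lm_hom R (free_module R X) M"
    and N: "submodule H R M" and Y: "Y \<subseteq> X" "\<And>i. i \<in> Y \<Longrightarrow> eps (free_unit R i) \<in> H"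
    and x: "x \<in> carrier (free_module R Y)"
  shows "eps x \<in> H"
proof -
  interpret F: left_module R "free_module R Y" by (rule left_module_free)
  have "eps \<circ> (\<lambda>x. x) \<in> lm_hom R (free_module R Y) M"
    by (rule lm_hom_comp[OF inclusion_hom[OF Y(1)] eps])
  then have h: "eps \<in> lm_hom R (free_module R Y) M" by (simp add: comp_def)
  have "free_unit R ` Y \<subseteq> {x \<in> carrier (free_module R Y). eps x \<in> H}"
    using Y(2) by (auto intro: free_unit_closed)
  from F.generatesD[OF free_generated_by_units submodule_vimage[OF left_module_free M h N] this]
  show ?thesis using x by auto
qed

text \<open>Conversely, for generators chosen inside the summands the relations split by colour: the
  coloured parts of a relation are the components of zero.\<close>

lemma decomposition_coloured_kernel:
  assumes M: "left_module R M" and eps: "eps \<in> lm_hom R (free_module R X) M"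
    and D: "direct_decomposition R M t N"
    and c: "\<And>i. i \<in> X \<Longrightarrow> c i < t" "\<And>i. i \<in> X \<Longrightarrow> eps (free_unit R i) \<in> N (c i)"
    and k: "k < t" and x: "x \<in> a_kernel (free_module R X) M eps"
  shows "colour_part R X c k x \<in> a_kernel (free_module R X) M eps"
proof -
  interpret M: left_module R M by fact
  have xF: "x \<in> carrier (free_module R X)" and x0: "eps x = \<zero>\<^bsub>M\<^esub>" using x by (simp_all add: a_kernel_def')
  have "eps (colour_part R X c k x) = \<zero>\<^bsub>M\<^esub>"
  proof (rule M.decomposition_components_zero[OF D _ _ k, where f = "\<lambda>k. eps (colour_part R X c k x)"])
    show "eps (colour_part R X c l x) \<in> N l" if l: "l < t" for l
      by (rule coloured_image[OF M eps M.decomposition_submodule[OF D l] _ _ colour_part_closed[OF xF]])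
        (use c(2) in auto)
    show "(\<Oplus>\<^bsub>M\<^esub>l\<in>{..<t}. eps (colour_part R X c l x)) = \<zero>\<^bsub>M\<^esub>"
      using finsum_colour_parts[OF M eps xF, where c = c and n = t]
        truncate_all_colours[OF xF, where c = c and t = t] c(1) x0 by simp
  qed
  moreover have "colour_part R X c k x \<in> carrier (free_module R X)"
    by (rule lm_hom_closed[OF colour_part_hom xF])
  ultimately show ?thesis by (simp add: a_kernel_def')
qed

text \<open>If no generator were taken from \<open>N k\<close>, then every element would have the component zero
  in \<open>N k\<close>.\<close>

lemma decomposition_all_colours_occur:
  assumes M: "left_module R M" and eps: "eps \<in> lm_hom R (free_module R X) M"
    and surj: "eps ` carrier (free_module R X) = carrier M"
    and D: "direct_decomposition R M t N"
    and c: "\<And>i. i \<in> X \<Longrightarrow> c i < t" "\<And>i. i \<in> X \<Longrightarrow> eps (free_unit R i) \<in> N (c i)"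
    and k: "k < t" "N k \<noteq> {\<zero>\<^bsub>M\<^esub>}"
  shows "\<exists>i\<in>X. c i = k"
proof (rule ccontr)
  assume "\<not> ?thesis"
  then have no: "{i \<in> X. c i = k} = {}" by auto
  interpret M: left_module R M by fact
  have "\<zero>\<^bsub>M\<^esub> \<in> N k" using M.decomposition_submodule[OF D k(1)] by (simp add: M.submodule_iff)
  then obtain y where y: "y \<in> N k" "y \<noteq> \<zero>\<^bsub>M\<^esub>" using k(2) by auto
  then have "y \<in> carrier M" using M.decomposition_carrier[OF D k(1)] by simp
  then obtain x where x: "x \<in> carrier (free_module R X)" "y = eps x" unfolding surj[symmetric] by auto
  have "eps (colour_part R X c k x) = (if k = k then y else \<zero>\<^bsub>M\<^esub>)"
  proof (rule M.decomposition_component_of_member[OF D k(1) y(1) _ _ k(1),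
        where f = "\<lambda>k. eps (colour_part R X c k x)"])
    show "eps (colour_part R X c l x) \<in> N l" if l: "l < t" for l
      by (rule coloured_image[OF M eps M.decomposition_submodule[OF D l] _ _ colour_part_closed[OF x(1)]])
        (use c(2) in auto)
    show "(\<Oplus>\<^bsub>M\<^esub>l\<in>{..<t}. eps (colour_part R X c l x)) = y"
      using finsum_colour_parts[OF M eps x(1), where c = c and n = t]
        truncate_all_colours[OF x(1), where c = c and t = t] c(1) x(2) by simp
  qed
  moreover have "colour_part R X c k x = \<zero>\<^bsub>free_module R X\<^esub>"
    by (simp add: colour_part_def no truncate_def free_module_simps(2))
  ultimately show False using y(2) lm_hom_zero[OF left_module_free M eps] by simp
qed

end

section \<open>Homogeneous minimal bases\<close>

text \<open>The components of finitely many generators are again finitely many generators, and every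
  subset of them is homogeneous. So a minimal basis can be found without combining minimal bases of
  the summands.\<close>

lemma (in left_module) homogeneous_minimal_basis:
  assumes fg: "finitely_generated R M" and D: "direct_decomposition R M t N"
  obtains T where "finite T" "minimal_basis R M T" "\<forall>x\<in>T. \<exists>k<t. x \<in> N k"
proof -
  obtain S where S: "finite S" "generates R M S" using fg by (auto simp: finitely_generated_def)
  have SM: "S \<subseteq> carrier M" using S(2) by (simp add: generates_def)
  have "\<exists>f. (\<forall>i<t. f i \<in> N i) \<and> (\<Oplus>\<^bsub>M\<^esub>i\<in>{..<t}. f i) = x" if "x \<in> S" for x
    using decomposition_exists[OF D, of x] SM that by (metis subsetD)
  then obtain f where f: "\<And>x i. x \<in> S \<Longrightarrow> i < t \<Longrightarrow> f x i \<in> N i"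
    "\<And>x. x \<in> S \<Longrightarrow> (\<Oplus>\<^bsub>M\<^esub>i\<in>{..<t}. f x i) = x" by metis
  let ?S = "(\<Union>x\<in>S. f x ` {..<t})"
  have fin: "finite ?S" using S(1) by simp
  have "generates R M ?S"
    unfolding generates_iff
  proof (intro conjI allI impI)
    show "?S \<subseteq> carrier M" using f(1) decomposition_carrier[OF D] by auto
    fix H assume H: "submodule H R M" "?S \<subseteq> H"
    have "x \<in> H" if "x \<in> S" for x
    proof -
      have "(\<Oplus>\<^bsub>M\<^esub>i\<in>{..<t}. f x i) \<in> H"
        by (rule submodule_finsum[OF H(1)]) (use H(2) that in auto)
      then show ?thesis using f(2)[OF that] by simp
    qed
    then have "S \<subseteq> H" ..
    then show "H = carrier M" using S(2) H(1) by (simp add: generates_iff)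
  qed
  from minimal_basis_in_finite_generating_set[OF fin this]
  obtain T where T: "T \<subseteq> ?S" "minimal_basis R M T" by metis
  show ?thesis
  proof (rule that[OF finite_subset[OF T(1) fin] T(2)], rule ballI)
    fix x assume "x \<in> T"
    then obtain y i where "y \<in> S" "i < t" "x = f y i" using T(1) by auto
    then show "\<exists>k<t. x \<in> N k" using f(1) by auto
  qed
qed

context ring
begin

lemma mem_if_colour_parts_mem:
  assumes H: "submodule H R (free_module R X)" and x: "x \<in> carrier (free_module R X)"
    and c: "\<And>i. i \<in> X \<Longrightarrow> c i < t" and parts: "\<And>k. k < t \<Longrightarrow> colour_part R X c k x \<in> H"
  shows "x \<in> H"
proof -
  interpret F: left_module R "free_module R X" by (rule left_module_free)
  have "(\<Oplus>\<^bsub>free_module R X\<^esub>k\<in>{..<t}. colour_part R X c k x) = x"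
    using finsum_colour_parts[OF left_module_free lm_hom_id x, where c = c and n = t]
      truncate_all_colours[OF x, where c = c and t = t] c by simp
  moreover have "(\<Oplus>\<^bsub>free_module R X\<^esub>k\<in>{..<t}. colour_part R X c k x) \<in> H"
    by (rule F.submodule_finsum[OF H]) (use parts in auto)
  ultimately show ?thesis by simp
qed

lemma colour_part_monochrome:
  "colour_part R X c k x i \<noteq> \<zero> \<Longrightarrow> c i = k"
  by (auto simp: colour_part_def truncate_def split: if_splits)

text \<open>The same argument for relations, with their coloured parts in place of the components.\<close>

lemma monochrome_minimal_basis:
  assumes noeth: "left_noetherian R" and K: "submodule K R (free_rank R n)"
    and c: "\<And>i. i < n \<Longrightarrow> c i < t"
    and closed: "\<And>k x. k < t \<Longrightarrow> x \<in> K \<Longrightarrow> colour_part R {..<n} c k x \<in> K"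
  obtains T where "finite T" "minimal_basis R ((free_rank R n)\<lparr>carrier := K\<rparr>) T"
    "\<forall>s\<in>T. \<forall>i j. s i \<noteq> \<zero> \<longrightarrow> s j \<noteq> \<zero> \<longrightarrow> c i = c j"
proof -
  interpret F: left_module R "free_rank R n" by (rule left_module_free)
  interpret K: left_module R "(free_rank R n)\<lparr>carrier := K\<rparr>" by (rule F.left_module_submodule[OF K])
  have KF: "K \<subseteq> carrier (free_rank R n)" using K by (simp add: F.submodule_iff)
  obtain S where S: "finite S" "S \<subseteq> K"
    "\<And>H. submodule H R (free_rank R n) \<Longrightarrow> S \<subseteq> H \<Longrightarrow> K \<subseteq> H"
    using submodule_free_rank_finitely_generated[OF noeth K] by auto
  let ?S = "(\<Union>s\<in>S. (\<lambda>k. colour_part R {..<n} c k s) ` {..<t})"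
  have fin: "finite ?S" using S(1) by simp
  have "generates R ((free_rank R n)\<lparr>carrier := K\<rparr>) ?S"
    unfolding K.generates_iff F.submodule_of_submodule_iff[OF K]
  proof (intro conjI allI impI)
    show "?S \<subseteq> carrier ((free_rank R n)\<lparr>carrier := K\<rparr>)" using S(2) closed by auto
    fix H assume H: "submodule H R (free_rank R n) \<and> H \<subseteq> K" "?S \<subseteq> H"
    have "s \<in> H" if s: "s \<in> S" for s
    proof (rule mem_if_colour_parts_mem[where c = c and t = t])
      show "submodule H R (free_rank R n)" using H(1) by simp
      show "s \<in> carrier (free_rank R n)" using s S(2) KF by auto
      show "colour_part R {..<n} c k s \<in> H" if "k < t" for k using H(2) s that by auto
    qed (use c in simp)
    then have "K \<subseteq> H" using H(1) by (intro S(3)) auto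
    then show "H = carrier ((free_rank R n)\<lparr>carrier := K\<rparr>)" using H(1) by auto
  qed
  from K.minimal_basis_in_finite_generating_set[OF fin this]
  obtain T where T: "T \<subseteq> ?S" "minimal_basis R ((free_rank R n)\<lparr>carrier := K\<rparr>) T" by metis
  show ?thesis
  proof (rule that[OF finite_subset[OF T(1) fin] T(2)], intro ballI allI impI)
    fix s i j assume "s \<in> T" and ij: "s i \<noteq> \<zero>" "s j \<noteq> \<zero>"
    then obtain x k where "s = colour_part R {..<n} c k x" using T(1) by auto
    then show "c i = c j" using ij colour_part_monochrome by metis
  qed
qed

end

section \<open>The decomposition number\<close>

lemma equiv_link_relation: "equiv G (link_relation R G S)"
proof -
  let ?E = "{(x, y) \<in> G \<times> G. \<exists>r\<in>S. r x \<noteq> \<zero>\<^bsub>R\<^esub> \<and> r y \<noteq> \<zero>\<^bsub>R\<^esub>}"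
  have "equiv G (G \<times> G)" by (auto simp: equiv_def refl_on_def sym_def trans_def)
  then have ne: "G \<times> G \<in> {r. equiv G r \<and> ?E \<subseteq> r}" by auto
  show ?thesis
    unfolding link_relation_def hull_def
  proof (rule equivI)
    show "\<Inter>{r. equiv G r \<and> ?E \<subseteq> r} \<subseteq> G \<times> G" using ne by blast
    show "refl_on G (\<Inter>{r. equiv G r \<and> ?E \<subseteq> r})"
      by (auto simp: equiv_def refl_on_def)
    show "sym (\<Inter>{r. equiv G r \<and> ?E \<subseteq> r})"
      by (auto simp: equiv_def sym_def)
    show "trans (\<Inter>{r. equiv G r \<and> ?E \<subseteq> r})"
      unfolding trans_def equiv_def by blast
  qed
qed

lemma ex_subset_of_enat_card:
  assumes "\<not> enat_card Q \<le> enat n"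
  obtains F where "F \<subseteq> Q" "finite F" "card F = Suc n"
proof (cases "finite Q")
  case True
  then have "Suc n \<le> card Q" using assms by (simp add: enat_card_def)
  then show ?thesis using that obtain_subset_with_card_n by metis
next
  case False
  then show ?thesis using that infinite_arbitrarily_large by metis
qed

lemma relationship_submodule_kernel:
  "relationship_submodule R M G = a_kernel (free_module R G) M (free_lift R M G (\<lambda>g. g))"
  by (simp add: relationship_submodule_def a_kernel_def' free_lift_def)

context left_module
begin

lemma generators_lift:
  assumes "generates R M G"
  shows "free_lift R M G (\<lambda>g. g) \<in> lm_hom R (free_module R G) M"
    and "free_lift R M G (\<lambda>g. g) ` carrier (free_module R G) = carrier M"
    and "\<And>x. x \<in> G \<Longrightarrow> free_lift R M G (\<lambda>g. g) (free_unit R x) = x"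
proof -
  have GM: "G \<subseteq> carrier M" using assms by (simp add: generates_def)
  then have c: "\<And>x. x \<in> G \<Longrightarrow> x \<in> carrier M" by auto
  show "free_lift R M G (\<lambda>g. g) \<in> lm_hom R (free_module R G) M" by (rule free_lift_hom[OF c])
  show "free_lift R M G (\<lambda>g. g) ` carrier (free_module R G) = carrier M"
    using free_lift_image[of "\<lambda>g. g" G] GM assms by (simp add: generates_def)
  show "\<And>x. x \<in> G \<Longrightarrow> free_lift R M G (\<lambda>g. g) (free_unit R x) = x" by (rule free_lift_unit[OF c])
qed

text \<open>The classes of the link relation colour the generators in such a way that every given
  relation is monochrome; merging surplus classes leaves one nonzero summand per colour.\<close>

lemma class_number_le:
  assumes G: "generates R M G" and z: "\<zero>\<^bsub>M\<^esub> \<notin> G" and S: "relationship_set R M G S"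
    and max: "\<And>t L. direct_decomposition R M t L \<Longrightarrow> (\<And>k. k < t \<Longrightarrow> L k \<noteq> {\<zero>\<^bsub>M\<^esub>}) \<Longrightarrow> t \<le> n"
  shows "class_number R G S \<le> enat n"
proof (rule ccontr)
  let ?L = "link_relation R G S" and ?F = "free_module R G" and ?eps = "free_lift R M G (\<lambda>g. g)"
  note eps = generators_lift[OF G]
  assume "\<not> class_number R G S \<le> enat n"
  then obtain F where F: "F \<subseteq> G // ?L" "finite F" "card F = Suc n"
    unfolding class_number_def by (rule ex_subset_of_enat_card)
  obtain e where e: "bij_betw e {..<Suc n} F"
    using ex_bij_betw_nat_finite[OF F(2)] F(3) by (auto simp: atLeast0LessThan)
  define col where "col = (\<lambda>C. if C \<in> F then the_inv_into {..<Suc n} e C else 0)"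
  define c where "c = (\<lambda>x. col (?L `` {x}))"
  have "the_inv_into {..<Suc n} e C \<in> {..<Suc n}" if "C \<in> F" for C
    by (rule the_inv_into_into) (use e that in \<open>auto simp: bij_betw_def\<close>)
  then have col: "col C < Suc n" for C by (auto simp: col_def)
  have mono: "c i = c j" if s: "s \<in> S" "i \<in> G" "j \<in> G" "s i \<noteq> \<zero>" "s j \<noteq> \<zero>" for s i j
  proof -
    have "(i, j) \<in> ?L"
      unfolding link_relation_def by (rule hull_inc) (use s in blast)
    then show ?thesis unfolding c_def using equiv_class_eq[OF equiv_link_relation] by metis
  qed
  have S': "generates R (?F\<lparr>carrier := a_kernel ?F M ?eps\<rparr>) S"
    using S by (simp only: relationship_set_def relationship_submodule_kernel)
  have closed: "colour_part R G c k x \<in> a_kernel ?F M ?eps" if "x \<in> a_kernel ?F M ?eps" for k x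
    by (rule R.kernel_colour_closed_if_monochrome[OF
          submodule_kernel[OF R.left_module_free left_module_axioms eps(1)] S' mono that])
  have D: "direct_decomposition R M (Suc n) (\<lambda>k. ?eps ` carrier (free_module R {i \<in> G. c i = k}))"
    by (rule R.coloured_presentation_decomposition[OF left_module_axioms eps(1,2)])
      (simp_all add: closed, simp add: c_def col)
  have "?eps ` carrier (free_module R {i \<in> G. c i = k}) \<noteq> {\<zero>\<^bsub>M\<^esub>}" if k: "k < Suc n" for k
  proof -
    have eF: "e k \<in> F" using e k by (auto simp: bij_betw_def)
    then have "e k \<in> G // ?L" using F(1) by auto
    then obtain x where x: "e k = ?L `` {x}" "x \<in> G" by (rule quotientE)
    have "the_inv_into {..<Suc n} e (e k) = k"
      by (rule the_inv_into_f_f) (use e k in \<open>auto simp: bij_betw_def\<close>)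
    then have "c x = k" using eF by (simp add: c_def x(1)[symmetric] col_def)
    then have "free_unit R x \<in> carrier (free_module R {i \<in> G. c i = k})"
      using x(2) by (intro R.free_unit_closed) simp
    then have "?eps (free_unit R x) \<in> ?eps ` carrier (free_module R {i \<in> G. c i = k})"
      by (rule imageI)
    then have mem: "x \<in> ?eps ` carrier (free_module R {i \<in> G. c i = k})"
      unfolding eps(3)[OF x(2)] .
    show ?thesis
    proof
      assume eq: "?eps ` carrier (free_module R {i \<in> G. c i = k}) = {\<zero>\<^bsub>M\<^esub>}"
      have "x = \<zero>\<^bsub>M\<^esub>" using mem unfolding eq by simp
      then show False using x(2) z by simp
    qed
  qed
  then have "Suc n \<le> n" by (rule max[OF D])
  then show False by simp
qed

text \<open>All nonzero elements of the summands together generate, and all relations between elements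
  of one summand together generate the relations.\<close>

lemma class_number_ge:
  assumes D: "direct_decomposition R M n N" and nz: "\<And>k. k < n \<Longrightarrow> N k \<noteq> {\<zero>\<^bsub>M\<^esub>}"
  obtains G S where "generates R M G" "\<zero>\<^bsub>M\<^esub> \<notin> G" "relationship_set R M G S"
    "enat n \<le> class_number R G S"
proof -
  define G where "G = (\<Union>k<n. N k) - {\<zero>\<^bsub>M\<^esub>}"
  define c where "c = (\<lambda>x. SOME k. k < n \<and> x \<in> N k)"
  have c: "c x < n" "x \<in> N (c x)" if "x \<in> G" for x
    using someI_ex[of "\<lambda>k. k < n \<and> x \<in> N k"] that by (auto simp: G_def c_def)
  have z: "\<zero>\<^bsub>M\<^esub> \<notin> G" by (simp add: G_def)
  have G: "generates R M G"
    unfolding generates_iff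
  proof (intro conjI allI impI)
    show GM: "G \<subseteq> carrier M" using decomposition_carrier[OF D] by (auto simp: G_def)
    fix H assume H: "submodule H R M" "G \<subseteq> H"
    have "x \<in> H" if x: "x \<in> carrier M" for x
    proof -
      obtain f where f: "\<And>i. i < n \<Longrightarrow> f i \<in> N i" "(\<Oplus>\<^bsub>M\<^esub>i\<in>{..<n}. f i) = x"
        using decomposition_exists[OF D x] by metis
      have "f i \<in> H" if "i < n" for i
        using f(1)[OF that] H that by (cases "f i = \<zero>\<^bsub>M\<^esub>") (auto simp: G_def submodule_iff)
      then have "(\<Oplus>\<^bsub>M\<^esub>i\<in>{..<n}. f i) \<in> H" by (intro submodule_finsum[OF H(1)]) auto
      then show ?thesis unfolding f(2) .
    qed
    then show "H = carrier M" using H(1) by (auto simp: submodule_iff)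
  qed
  let ?F = "free_module R G" and ?eps = "free_lift R M G (\<lambda>g. g)"
  note eps = generators_lift[OF G]
  define K where "K = a_kernel ?F M ?eps"
  have K: "submodule K R ?F"
    unfolding K_def by (rule submodule_kernel[OF R.left_module_free left_module_axioms eps(1)])
  interpret F: left_module R ?F by (rule R.left_module_free)
  interpret K: left_module R "?F\<lparr>carrier := K\<rparr>" by (rule F.left_module_submodule[OF K])
  have KF: "K \<subseteq> carrier ?F" using K by (simp add: F.submodule_iff)
  define S where "S = {x \<in> K. \<forall>i j. x i \<noteq> \<zero> \<longrightarrow> x j \<noteq> \<zero> \<longrightarrow> c i = c j}"
  have part: "colour_part R G c k x \<in> S" if "x \<in> K" "k < n" for x k
  proof -
    have xK: "colour_part R G c k x \<in> K"
      using that R.decomposition_coloured_kernel[OF left_module_axioms eps(1) D, where c = c] c eps(3)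
      by (simp add: K_def)
    have "c i = c j"
      if "colour_part R G c k x i \<noteq> \<zero>" "colour_part R G c k x j \<noteq> \<zero>" for i j
      using R.colour_part_monochrome[OF that(1)] R.colour_part_monochrome[OF that(2)] by simp
    with xK show ?thesis unfolding S_def by blast
  qed
  have "generates R (?F\<lparr>carrier := K\<rparr>) S"
    unfolding K.generates_iff F.submodule_of_submodule_iff[OF K]
  proof (intro conjI allI impI)
    show "S \<subseteq> carrier (?F\<lparr>carrier := K\<rparr>)" by (auto simp: S_def)
    fix H assume H: "submodule H R ?F \<and> H \<subseteq> K" "S \<subseteq> H"
    have "x \<in> H" if x: "x \<in> K" for x
      by (rule R.mem_if_colour_parts_mem[where X = G and c = c and t = n])
        (use H x KF c part in auto)
    then show "H = carrier (?F\<lparr>carrier := K\<rparr>)" using H(1) by auto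
  qed
  then have S: "relationship_set R M G S"
    by (simp add: relationship_set_def relationship_submodule_kernel K_def)
  let ?L = "link_relation R G S"
  have "equiv G {(x, y) \<in> G \<times> G. c x = c y}"
    by (auto simp: equiv_def refl_on_def sym_def trans_def)
  then have L: "?L \<subseteq> {(x, y) \<in> G \<times> G. c x = c y}"
    unfolding link_relation_def by (intro hull_minimal) (auto simp: S_def)
  have "\<exists>x. x \<in> G \<and> x \<in> N k" if "k < n" for k
  proof -
    have "\<zero>\<^bsub>M\<^esub> \<in> N k" using decomposition_submodule[OF D that] by (simp add: submodule_iff)
    then show ?thesis using nz[OF that] that by (auto simp: G_def)
  qed
  then obtain p where p: "\<And>k. k < n \<Longrightarrow> p k \<in> G" "\<And>k. k < n \<Longrightarrow> p k \<in> N k" by metis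
  have cp: "c (p k) = k" if "k < n" for k
    using decomposition_disjoint[OF D c(1)[OF p(1)[OF that]] that _ c(2)[OF p(1)[OF that]] p(2)[OF that]]
      p(1)[OF that] z by metis
  have "inj_on (\<lambda>k. ?L `` {p k}) {..<n}"
  proof (rule inj_onI)
    fix i j assume "i \<in> {..<n}" "j \<in> {..<n}" and eq: "?L `` {p i} = ?L `` {p j}"
    then have ij: "i < n" "j < n" by auto
    have "(p i, p j) \<in> ?L"
      using eq_equiv_class[OF eq equiv_link_relation p(1)[OF ij(2)]] .
    then have "c (p i) = c (p j)" using L by auto
    then show "i = j" using cp ij by simp
  qed
  moreover have "(\<lambda>k. ?L `` {p k}) ` {..<n} \<subseteq> G // ?L" using p(1) by (auto intro: quotientI)
  ultimately have "enat n \<le> class_number R G S"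
    using card_inj_on_le[of "\<lambda>k. ?L `` {p k}" "{..<n}" "G // ?L"]
    by (auto simp: class_number_def enat_card_def)
  with G z S show ?thesis by (rule that)
qed

text \<open>A decomposition with the largest number of nonzero summands has indecomposable summands, for
  otherwise one of them could be split. So under the Krull-Schmidt condition it is the
  indecomposable decomposition, and otherwise its length is the supremum of the class numbers.\<close>

lemma decomposition_number_eqI:
  assumes D: "direct_decomposition R M n N" and nz: "\<And>k. k < n \<Longrightarrow> N k \<noteq> {\<zero>\<^bsub>M\<^esub>}"
    and max: "\<And>t L. direct_decomposition R M t L \<Longrightarrow> (\<And>k. k < t \<Longrightarrow> L k \<noteq> {\<zero>\<^bsub>M\<^esub>}) \<Longrightarrow> t \<le> n"
  shows "decomposition_number R M = enat n"
proof (cases "krull_schmidt R M")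
  case True
  have "indecomposable R (M\<lparr>carrier := N k\<rparr>)" if k: "k < n" for k
    unfolding indecomposable_def
  proof (intro conjI allI impI)
    note Nk = decomposition_submodule[OF D k]
    show "carrier (M\<lparr>carrier := N k\<rparr>) \<noteq> {\<zero>\<^bsub>M\<lparr>carrier := N k\<rparr>\<^esub>}" using nz[OF k] by simp
    fix A B assume AB: "submodule A R (M\<lparr>carrier := N k\<rparr>) \<and> submodule B R (M\<lparr>carrier := N k\<rparr>) \<and>
      A \<inter> B = {\<zero>\<^bsub>M\<lparr>carrier := N k\<rparr>\<^esub>} \<and> A <+>\<^bsub>M\<lparr>carrier := N k\<rparr>\<^esub> B = carrier (M\<lparr>carrier := N k\<rparr>)"
    show "A = {\<zero>\<^bsub>M\<lparr>carrier := N k\<rparr>\<^esub>} \<or> B = {\<zero>\<^bsub>M\<lparr>carrier := N k\<rparr>\<^esub>}"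
    proof (rule ccontr)
      assume "\<not> ?thesis"
      then have ne: "A \<noteq> {\<zero>\<^bsub>M\<^esub>}" "B \<noteq> {\<zero>\<^bsub>M\<^esub>}" by auto
      have AB': "submodule A R M" "submodule B R M" "A \<inter> B = {\<zero>\<^bsub>M\<^esub>}" "A <+>\<^bsub>M\<^esub> B = N k"
        using AB by (simp_all add: submodule_of_submodule_iff[OF Nk] set_add_def')
      have "Suc n \<le> n"
        by (rule max[OF decomposition_refine[OF D k AB']]) (use ne nz in \<open>auto simp: less_Suc_eq\<close>)
      then show False by simp
    qed
  qed
  then have I: "indecomposable_decomposition R M n N" using D by (simp add: indecomposable_decomposition_def)
  have "(THE m. \<exists>L. indecomposable_decomposition R M m L) = n"
  proof (rule the_equality)
    show "\<exists>L. indecomposable_decomposition R M n L" using I by auto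
    fix m assume "\<exists>L. indecomposable_decomposition R M m L"
    then obtain L where "indecomposable_decomposition R M m L" by auto
    moreover have "\<And>m L k K. indecomposable_decomposition R M m L \<and> indecomposable_decomposition R M k K \<Longrightarrow>
        \<exists>\<pi>. bij_betw \<pi> {..<m} {..<k}"
      using True unfolding krull_schmidt_def by blast
    ultimately obtain \<pi> where "bij_betw \<pi> {..<m} {..<n}" using I by blast
    then show "m = n" using bij_betw_same_card[of \<pi> "{..<m}" "{..<n}"] by simp
  qed
  then show ?thesis using True by (simp add: decomposition_number_def)
next
  case False
  let ?C = "{class_number R G S | G S. generates R M G \<and> \<zero>\<^bsub>M\<^esub> \<notin> G \<and> relationship_set R M G S}"
  obtain G S where GS: "generates R M G" "\<zero>\<^bsub>M\<^esub> \<notin> G" "relationship_set R M G S"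
    "enat n \<le> class_number R G S" by (rule class_number_ge[OF D nz])
  have le: "class_number R G S \<le> enat n"
    if "generates R M G" "\<zero>\<^bsub>M\<^esub> \<notin> G" "relationship_set R M G S" for G S
    by (rule class_number_le[OF that max])
  have "Sup ?C = enat n"
  proof (rule antisym)
    show "Sup ?C \<le> enat n" by (rule Sup_least) (use le in auto)
    have "class_number R G S \<in> ?C" using GS(1-3) by auto
    then have "class_number R G S \<le> Sup ?C" by (rule Sup_upper)
    with GS(4) show "enat n \<le> Sup ?C" by (rule order_trans)
  qed
  then show ?thesis using False by (simp add: decomposition_number_def)
qed

end

section \<open>Matrices as homomorphisms of free modules\<close>

text \<open>Vectors are rows, so a matrix acts from the right and \<open>x (A B) = (x A) B\<close>.\<close>

definition row_map :: "('a, 'x) ring_scheme \<Rightarrow> 'a mat \<Rightarrow> (nat \<Rightarrow> 'a) \<Rightarrow> nat \<Rightarrow> 'a"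
  where "row_map R A x = (\<lambda>j. if j < dim_col A
    then \<Oplus>\<^bsub>R\<^esub>i\<in>{..<dim_row A}. x i \<otimes>\<^bsub>R\<^esub> A $$ (i, j) else \<zero>\<^bsub>R\<^esub>)"

definition hom_mat ::
  "('a, 'x) ring_scheme \<Rightarrow> nat \<Rightarrow> nat \<Rightarrow> ((nat \<Rightarrow> 'a) \<Rightarrow> nat \<Rightarrow> 'a) \<Rightarrow> 'a mat"
  where "hom_mat R u v f = mat u v (\<lambda>(i, j). f (free_unit R i) j)"

lemma matricesD:
  "A \<in> matrices R u v \<Longrightarrow> dim_row A = u" "A \<in> matrices R u v \<Longrightarrow> dim_col A = v"
  "A \<in> matrices R u v \<Longrightarrow> i < u \<Longrightarrow> j < v \<Longrightarrow> A $$ (i, j) \<in> carrier R"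
  by (auto simp: matrices_def)

context ring
begin

lemma row_map_hom:
  assumes A: "A \<in> matrices R u v"
  shows "row_map R A \<in> lm_hom R (free_rank R u) (free_rank R v)"
proof (rule lm_homI)
  note Ad = matricesD[OF A]
  fix x assume x: "x \<in> carrier (free_rank R u)"
  note xc = free_carrier_closed[OF x]
  have xA: "(\<lambda>i. x i \<otimes> A $$ (i, j)) \<in> {..<u} \<rightarrow> carrier R" if "j < v" for j
    using xc Ad(3) that by auto
  show "row_map R A x \<in> carrier (free_rank R v)"
    unfolding free_carrier_finite[OF finite_lessThan] using finsum_closed[OF xA]
    by (simp add: row_map_def Ad)
  {
    fix y assume y: "y \<in> carrier (free_rank R u)"
    note yc = free_carrier_closed[OF y]
    have yA: "(\<lambda>i. y i \<otimes> A $$ (i, j)) \<in> {..<u} \<rightarrow> carrier R" if "j < v" for j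
      using yc Ad(3) that by auto
    have "(\<Oplus>i\<in>{..<u}. (x i \<oplus> y i) \<otimes> A $$ (i, j))
        = (\<Oplus>i\<in>{..<u}. x i \<otimes> A $$ (i, j)) \<oplus> (\<Oplus>i\<in>{..<u}. y i \<otimes> A $$ (i, j))" if j: "j < v" for j
    proof -
      have "(\<Oplus>i\<in>{..<u}. (x i \<oplus> y i) \<otimes> A $$ (i, j))
          = (\<Oplus>i\<in>{..<u}. x i \<otimes> A $$ (i, j) \<oplus> y i \<otimes> A $$ (i, j))"
        by (rule finsum_cong'[OF refl]) (use xc yc Ad(3) j in \<open>auto simp: l_distr\<close>)
      then show ?thesis using finsum_addf[OF xA[OF j] yA[OF j]] by simp
    qed
    then show "row_map R A (x \<oplus>\<^bsub>free_rank R u\<^esub> y) = row_map R A x \<oplus>\<^bsub>free_rank R v\<^esub> row_map R A y"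
      by (simp add: row_map_def free_module_simps(3) Ad fun_eq_iff)
  }
  fix a assume a: "a \<in> carrier R"
  have "(\<Oplus>i\<in>{..<u}. (a \<otimes> x i) \<otimes> A $$ (i, j)) = a \<otimes> (\<Oplus>i\<in>{..<u}. x i \<otimes> A $$ (i, j))" if j: "j < v" for j
  proof -
    have "(\<Oplus>i\<in>{..<u}. (a \<otimes> x i) \<otimes> A $$ (i, j)) = (\<Oplus>i\<in>{..<u}. a \<otimes> (x i \<otimes> A $$ (i, j)))"
      by (rule finsum_cong'[OF refl]) (use xc a Ad(3) j in \<open>auto simp: m_assoc\<close>)
    then show ?thesis using finsum_rdistr[OF finite_lessThan a xA[OF j]] by simp
  qed
  then show "row_map R A (a \<odot>\<^bsub>free_rank R u\<^esub> x) = a \<odot>\<^bsub>free_rank R v\<^esub> row_map R A x"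
    using a by (simp add: row_map_def free_module_simps(4) Ad fun_eq_iff)
qed

lemma row_map_unit:
  assumes A: "A \<in> matrices R u v" and i: "i < u"
  shows "row_map R A (free_unit R i) = (\<lambda>j. if j < v then A $$ (i, j) else \<zero>)"
proof -
  note Ad = matricesD[OF A]
  have "(\<Oplus>k\<in>{..<u}. free_unit R i k \<otimes> A $$ (k, j)) = A $$ (i, j)" if j: "j < v" for j
  proof -
    have "(\<Oplus>k\<in>{..<u}. free_unit R i k \<otimes> A $$ (k, j))
        = (\<Oplus>k\<in>{..<u}. if k = i then A $$ (k, j) else \<zero>)"
      by (rule finsum_cong'[OF refl]) (use Ad(3) j i in \<open>auto simp: free_unit_def\<close>)
    also have "\<dots> = A $$ (i, j)"
      using add.finprod_singleton_swap[of i "{..<u}" "\<lambda>k. A $$ (k, j)"] Ad(3) i j by auto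
    finally show ?thesis .
  qed
  then show ?thesis by (simp add: row_map_def Ad fun_eq_iff)
qed

lemma matrices_eqI:
  assumes A: "A \<in> matrices R u v" and B: "B \<in> matrices R u v"
    and eq: "\<And>i. i < u \<Longrightarrow> row_map R A (free_unit R i) = row_map R B (free_unit R i)"
  shows "A = B"
proof (rule eq_matI)
  fix i j assume "i < dim_row B" "j < dim_col B"
  then have ij: "i < u" "j < v" using matricesD[OF B] by auto
  have "row_map R A (free_unit R i) j = row_map R B (free_unit R i) j" using eq[OF ij(1)] by simp
  then show "A $$ (i, j) = B $$ (i, j)"
    using ij by (simp add: row_map_unit[OF A ij(1)] row_map_unit[OF B ij(1)])
qed (use matricesD[OF A] matricesD[OF B] in simp_all)

lemma hom_mat_matrices:
  assumes f: "f \<in> lm_hom R (free_rank R u) (free_rank R v)"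
  shows "hom_mat R u v f \<in> matrices R u v"
proof -
  have "f (free_unit R i) j \<in> carrier R" if "i < u" for i j
    by (rule free_carrier_closed[OF lm_hom_closed[OF f free_unit_closed]]) (use that in simp)
  then show ?thesis by (simp add: hom_mat_def matrices_def)
qed

lemma row_map_hom_mat:
  assumes f: "f \<in> lm_hom R (free_rank R u) (free_rank R v)" and x: "x \<in> carrier (free_rank R u)"
  shows "row_map R (hom_mat R u v f) x = f x"
proof (rule free_hom_eqI[OF left_module_free row_map_hom[OF hom_mat_matrices[OF f]] f _ x])
  fix i assume "i \<in> {..<u}"
  then have i: "i < u" by simp
  have "f (free_unit R i) \<in> carrier (free_rank R v)"
    by (rule lm_hom_closed[OF f free_unit_closed]) (use i in simp)
  then show "row_map R (hom_mat R u v f) (free_unit R i) = f (free_unit R i)"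
    unfolding row_map_unit[OF hom_mat_matrices[OF f] i]
    using i by (auto simp: hom_mat_def free_module_simps(1) fun_eq_iff)
qed

lemma ring_mat_mult_matrices:
  assumes A: "A \<in> matrices R u v" and B: "B \<in> matrices R v w"
  shows "ring_mat_mult R A B \<in> matrices R u w"
proof -
  have "(\<Oplus>k\<in>{..<v}. A $$ (i, k) \<otimes> B $$ (k, j)) \<in> carrier R" if "i < u" "j < w" for i j
    by (rule finsum_closed) (use matricesD[OF A] matricesD[OF B] that in auto)
  then show ?thesis
    by (simp add: ring_mat_mult_def matrices_def matricesD[OF A] matricesD[OF B])
qed

lemma row_map_mult:
  assumes A: "A \<in> matrices R u v" and B: "B \<in> matrices R v w" and x: "x \<in> carrier (free_rank R u)"
  shows "row_map R (ring_mat_mult R A B) x = row_map R B (row_map R A x)"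
proof -
  note AB = ring_mat_mult_matrices[OF A B]
  have h: "row_map R B \<circ> row_map R A \<in> lm_hom R (free_rank R u) (free_rank R w)"
    by (rule lm_hom_comp[OF row_map_hom[OF A] row_map_hom[OF B]])
  have "row_map R (ring_mat_mult R A B) x = (row_map R B \<circ> row_map R A) x"
  proof (rule free_hom_eqI[OF left_module_free row_map_hom[OF AB] h _ x])
    fix i assume "i \<in> {..<u}"
    then have i: "i < u" by simp
    have "(\<Oplus>k\<in>{..<v}. A $$ (i, k) \<otimes> B $$ (k, j))
        = (\<Oplus>k\<in>{..<v}. (if k < v then A $$ (i, k) else \<zero>) \<otimes> B $$ (k, j))" if "j < w" for j
      by (rule finsum_cong'[OF refl]) (use matricesD[OF A] matricesD[OF B] that i in auto)
    then show "row_map R (ring_mat_mult R A B) (free_unit R i) = (row_map R B \<circ> row_map R A) (free_unit R i)"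
      using i unfolding comp_apply row_map_unit[OF AB i] row_map_unit[OF A i]
      by (simp add: ring_mat_mult_def row_map_def matricesD[OF A] matricesD[OF B] fun_eq_iff)
  qed
  then show ?thesis by simp
qed

lemma ring_mat_one_matrices: "ring_mat_one R n \<in> matrices R n n"
  by (simp add: ring_mat_one_def matrices_def)

lemma row_map_one:
  assumes x: "x \<in> carrier (free_rank R n)"
  shows "row_map R (ring_mat_one R n) x = x"
proof (rule free_hom_eqI[OF left_module_free row_map_hom[OF ring_mat_one_matrices] lm_hom_id _ x])
  fix i assume "i \<in> {..<n}"
  then have i: "i < n" by simp
  then show "row_map R (ring_mat_one R n) (free_unit R i) = free_unit R i"
    unfolding row_map_unit[OF ring_mat_one_matrices i]
    by (auto simp: ring_mat_one_def free_unit_def fun_eq_iff)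
qed

lemma row_map_iso:
  assumes "ring_mat_invertible R n P"
  shows "row_map R P \<in> lm_iso R (free_rank R n) (free_rank R n)"
proof -
  obtain P' where P: "P \<in> matrices R n n" "P' \<in> matrices R n n"
    "ring_mat_mult R P P' = ring_mat_one R n" "ring_mat_mult R P' P = ring_mat_one R n"
    using assms by (auto simp: ring_mat_invertible_def)
  have c: "row_map R P' x \<in> carrier (free_rank R n)" if "x \<in> carrier (free_rank R n)" for x
    by (rule lm_hom_closed[OF row_map_hom[OF P(2)] that])
  have i1: "row_map R P' (row_map R P x) = x" if "x \<in> carrier (free_rank R n)" for x
    using row_map_mult[OF P(1,2) that] row_map_one[OF that] by (simp add: P(3))
  have i2: "row_map R P (row_map R P' x) = x" if "x \<in> carrier (free_rank R n)" for x
    using row_map_mult[OF P(2,1) that] row_map_one[OF that] by (simp add: P(4))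
  have c': "row_map R P' \<in> carrier (free_rank R n) \<rightarrow> carrier (free_rank R n)" by (simp add: c)
  show ?thesis
  proof (rule lm_isoI[OF row_map_hom[OF P(1)] c'])
    show "row_map R P' (row_map R P x) = x" if "x \<in> carrier (free_rank R n)" for x by (rule i1[OF that])
    show "row_map R P (row_map R P' x) = x" if "x \<in> carrier (free_rank R n)" for x by (rule i2[OF that])
  qed
qed

lemma hom_mat_invertible:
  assumes p: "p \<in> lm_iso R (free_rank R n) (free_rank R n)"
  shows "ring_mat_invertible R n (hom_mat R n n p)"
proof -
  let ?q = "the_inv_into (carrier (free_rank R n)) p"
  note q = lm_iso_inv[OF left_module_free p]
  note p' = lm_isoD[OF p] and q' = lm_isoD[OF q]
  note P = hom_mat_matrices[OF p'(1)] and Q = hom_mat_matrices[OF q'(1)]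
  have qp: "?q (p x) = x" if "x \<in> carrier (free_rank R n)" for x
    by (rule the_inv_into_f_f[OF p'(2) that])
  have pq: "p (?q x) = x" if "x \<in> carrier (free_rank R n)" for x
    by (rule f_the_inv_into_f[OF p'(2)]) (simp add: p'(3) that)
  have u: "free_unit R i \<in> carrier (free_rank R n)" if "i < n" for i
    by (rule free_unit_closed) (simp add: that)
  have "ring_mat_mult R (hom_mat R n n p) (hom_mat R n n ?q) = ring_mat_one R n"
  proof (rule matrices_eqI[OF ring_mat_mult_matrices[OF P Q] ring_mat_one_matrices])
    fix i assume i: "i < n"
    show "row_map R (ring_mat_mult R (hom_mat R n n p) (hom_mat R n n ?q)) (free_unit R i)
      = row_map R (ring_mat_one R n) (free_unit R i)"
      unfolding row_map_mult[OF P Q u[OF i]] row_map_one[OF u[OF i]] row_map_hom_mat[OF p'(1) u[OF i]]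
        row_map_hom_mat[OF q'(1) lm_hom_closed[OF p'(1) u[OF i]]]
      by (rule qp[OF u[OF i]])
  qed
  moreover have "ring_mat_mult R (hom_mat R n n ?q) (hom_mat R n n p) = ring_mat_one R n"
  proof (rule matrices_eqI[OF ring_mat_mult_matrices[OF Q P] ring_mat_one_matrices])
    fix i assume i: "i < n"
    show "row_map R (ring_mat_mult R (hom_mat R n n ?q) (hom_mat R n n p)) (free_unit R i)
      = row_map R (ring_mat_one R n) (free_unit R i)"
      unfolding row_map_mult[OF Q P u[OF i]] row_map_one[OF u[OF i]] row_map_hom_mat[OF q'(1) u[OF i]]
        row_map_hom_mat[OF p'(1) lm_hom_closed[OF q'(1) u[OF i]]]
      by (rule pq[OF u[OF i]])
  qed
  ultimately show ?thesis using P Q by (auto simp: ring_mat_invertible_def)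
qed

lemma mat_equivalent_if_row_maps:
  assumes A: "A \<in> matrices R u v" and A': "A' \<in> matrices R u v"
    and p: "p \<in> lm_iso R (free_rank R u) (free_rank R u)"
    and q: "q \<in> lm_iso R (free_rank R v) (free_rank R v)"
    and eq: "\<And>i. i < u \<Longrightarrow> row_map R A' (free_unit R i) = q (row_map R A (p (free_unit R i)))"
  shows "mat_equivalent R u v A A'"
proof -
  note P = hom_mat_matrices[OF lm_isoD(1)[OF p]] and Q = hom_mat_matrices[OF lm_isoD(1)[OF q]]
  note PA = ring_mat_mult_matrices[OF P A]
  note PAQ = ring_mat_mult_matrices[OF PA Q]
  have "A' = ring_mat_mult R (ring_mat_mult R (hom_mat R u u p) A) (hom_mat R v v q)"
  proof (rule matrices_eqI[OF A' PAQ])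
    fix i assume i: "i < u"
    have x: "free_unit R i \<in> carrier (free_rank R u)" by (rule free_unit_closed) (simp add: i)
    note px = lm_hom_closed[OF lm_isoD(1)[OF p] x]
    show "row_map R A' (free_unit R i) = row_map R (ring_mat_mult R (ring_mat_mult R (hom_mat R u u p) A)
        (hom_mat R v v q)) (free_unit R i)"
      unfolding row_map_mult[OF PA Q x] row_map_mult[OF P A x] row_map_hom_mat[OF lm_isoD(1)[OF p] x]
        row_map_hom_mat[OF lm_isoD(1)[OF q] lm_hom_closed[OF row_map_hom[OF A] px]]
      by (rule eq[OF i])
  qed
  then show ?thesis
    unfolding mat_equivalent_def using A A' hom_mat_invertible[OF p] hom_mat_invertible[OF q] by auto
qed

lemma mat_equivalent_row_maps:
  assumes "mat_equivalent R u v A A'"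
  obtains p q where "p \<in> lm_iso R (free_rank R u) (free_rank R u)"
    "q \<in> lm_iso R (free_rank R v) (free_rank R v)"
    "\<forall>x\<in>carrier (free_rank R u). row_map R A' x = q (row_map R A (p x))"
proof -
  obtain P Q where A: "A \<in> matrices R u v" and inv: "ring_mat_invertible R u P" "ring_mat_invertible R v Q"
    and A': "A' = ring_mat_mult R (ring_mat_mult R P A) Q"
    using assms by (auto simp: mat_equivalent_def)
  have P: "P \<in> matrices R u u" and Q: "Q \<in> matrices R v v"
    using inv by (simp_all add: ring_mat_invertible_def)
  have "row_map R A' x = row_map R Q (row_map R A (row_map R P x))" if "x \<in> carrier (free_rank R u)" for x
    unfolding A' row_map_mult[OF ring_mat_mult_matrices[OF P A] Q that] row_map_mult[OF P A that] ..
  then show ?thesis by (intro that[OF row_map_iso[OF inv(1)] row_map_iso[OF inv(2)]] ballI)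
qed

lemma mat_equivalent_refl: "A \<in> matrices R u v \<Longrightarrow> mat_equivalent R u v A A"
  by (rule mat_equivalent_if_row_maps[where p = "\<lambda>x. x" and q = "\<lambda>x. x"])
    (auto simp: lm_iso_def lm_hom_id bij_betw_def)

lemma mat_equivalent_sym:
  assumes "mat_equivalent R u v A A'"
  shows "mat_equivalent R u v A' A"
proof -
  have A: "A \<in> matrices R u v" and A': "A' \<in> matrices R u v"
    using assms by (simp_all add: mat_equivalent_def)
  obtain p q where p: "p \<in> lm_iso R (free_rank R u) (free_rank R u)"
    and q: "q \<in> lm_iso R (free_rank R v) (free_rank R v)"
    and pq: "\<forall>x\<in>carrier (free_rank R u). row_map R A' x = q (row_map R A (p x))"
    by (rule mat_equivalent_row_maps[OF assms])
  note p' = lm_iso_inv[OF left_module_free p] and q' = lm_iso_inv[OF left_module_free q]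
  show ?thesis
  proof (rule mat_equivalent_if_row_maps[OF A' A p' q'])
    fix i assume i: "i < u"
    let ?x = "the_inv_into (carrier (free_rank R u)) p (free_unit R i)"
    have e: "free_unit R i \<in> carrier (free_rank R u)" by (rule free_unit_closed) (simp add: i)
    have "row_map R A' ?x = q (row_map R A (p ?x))"
      by (rule bspec[OF pq lm_hom_closed[OF lm_isoD(1)[OF p'] e]])
    also have "p ?x = free_unit R i"
      by (rule f_the_inv_into_f[OF lm_isoD(2)[OF p]]) (simp add: lm_isoD(3)[OF p] e)
    finally show "row_map R A (free_unit R i) =
        the_inv_into (carrier (free_rank R v)) q (row_map R A' ?x)"
      using the_inv_into_f_f[OF lm_isoD(2)[OF q] lm_hom_closed[OF row_map_hom[OF A] e]] by simp
  qed
qed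

lemma row_map_image:
  assumes A: "A \<in> matrices R u v"
  shows "row_map R A ` carrier (free_rank R u) = (\<lambda>H. submodule H R (free_rank R v)) hull
    ((\<lambda>i. row_map R A (free_unit R i)) ` {..<u})"
proof -
  have "free_unit R ` {..<u} \<subseteq> carrier (free_rank R u)" by (auto intro: free_unit_closed)
  from hull_image[OF left_module_free left_module_free row_map_hom[OF A] this]
  show ?thesis
    using free_generated_by_units[of "{..<u}"] by (simp add: generates_def image_image)
qed

end

section \<open>Blocks and colourings of the columns\<close>

text \<open>Columns outside all blocks may join any block: a row meeting one of them vanishes on every
  block.\<close>

lemma has_blocks_colouring:
  assumes A: "dim_row A = u" "dim_col A = v" and B: "has_blocks R A t" and t: "0 < t"
  obtains c :: "nat \<Rightarrow> nat" where "\<forall>j<v. c j < t" "\<forall>k<t. \<exists>j<v. c j = k"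
    "\<forall>i<u. \<forall>j<v. \<forall>j'<v. A $$ (i, j) \<noteq> \<zero>\<^bsub>R\<^esub> \<longrightarrow> A $$ (i, j') \<noteq> \<zero>\<^bsub>R\<^esub> \<longrightarrow> c j = c j'"
proof -
  obtain C where C: "\<And>k. k < t \<Longrightarrow> C k \<noteq> {}" "\<And>k. k < t \<Longrightarrow> C k \<subseteq> {..<v}"
    "disjoint_family_on C {..<t}"
    "\<And>k i j j'. k < t \<Longrightarrow> i < u \<Longrightarrow> j \<in> C k \<Longrightarrow> A $$ (i, j) \<noteq> \<zero>\<^bsub>R\<^esub> \<Longrightarrow> j' < v \<Longrightarrow> j' \<notin> C k \<Longrightarrow>
      A $$ (i, j') = \<zero>\<^bsub>R\<^esub>"
    using B unfolding has_blocks_def A by (auto simp: Ball_def) metis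
  define c where "c = (\<lambda>j. if \<exists>k<t. j \<in> C k then SOME k. k < t \<and> j \<in> C k else 0)"
  have cC: "c j = k" if "k < t" "j \<in> C k" for j k
  proof -
    have ex: "\<exists>k<t. j \<in> C k" using that by auto
    then have "c j < t \<and> j \<in> C (c j)"
      using someI_ex[of "\<lambda>k. k < t \<and> j \<in> C k"] by (simp add: c_def)
    then show ?thesis using C(3) that unfolding disjoint_family_on_def by auto
  qed
  have c0: "c j = 0" if "\<not> (\<exists>k<t. j \<in> C k)" for j unfolding c_def using that by (rule if_not_P)
  have lt: "c j < t" for j
  proof (cases "\<exists>k<t. j \<in> C k")
    case True
    then obtain k where "k < t" "j \<in> C k" by auto
    then show ?thesis using cC[of k j] by simp
  next
    case False
    then show ?thesis using c0 t by simp
  qed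
  show ?thesis
  proof (rule that; intro allI impI)
    show "c j < t" for j by (rule lt)
    show "\<exists>j<v. c j = k" if "k < t" for k using C(1,2)[OF that] cC[OF that] by auto
    fix i j j' assume i: "i < u" and j: "j < v" "j' < v" "A $$ (i, j) \<noteq> \<zero>\<^bsub>R\<^esub>" "A $$ (i, j') \<noteq> \<zero>\<^bsub>R\<^esub>"
    have "c a = c b" if "k < t" "a \<in> C k" "a < v" "b < v" "A $$ (i, a) \<noteq> \<zero>\<^bsub>R\<^esub>" "A $$ (i, b) \<noteq> \<zero>\<^bsub>R\<^esub>" for a b k
    proof -
      have "b \<in> C k" using C(4)[OF that(1) i that(2,5,4)] that(6) by auto
      then show ?thesis using cC[OF that(1)] that(2) by simp
    qed
    note same = this
    consider k where "k < t" "j \<in> C k" | k where "k < t" "j' \<in> C k"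
      | "\<not> (\<exists>k<t. j \<in> C k)" "\<not> (\<exists>k<t. j' \<in> C k)" by auto
    then show "c j = c j'"
    proof cases
      case 1
      show ?thesis by (rule same[OF 1 j])
    next
      case 2
      show ?thesis by (rule same[OF 2 j(2,1,4,3), symmetric])
    next
      case 3
      then show ?thesis using c0 by simp
    qed
  qed
qed

lemma colouring_has_blocks:
  assumes A: "dim_row A = u" "dim_col A = v"
    and ne: "\<And>k. k < t \<Longrightarrow> \<exists>j<v. c j = k"
    and mono: "\<And>i j j'. i < u \<Longrightarrow> j < v \<Longrightarrow> j' < v \<Longrightarrow> A $$ (i, j) \<noteq> \<zero>\<^bsub>R\<^esub> \<Longrightarrow> A $$ (i, j') \<noteq> \<zero>\<^bsub>R\<^esub> \<Longrightarrow> c j = c j'"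
  shows "has_blocks R A t"
  unfolding has_blocks_def A
proof (intro exI[of _ "\<lambda>k. {j. j < v \<and> c j = k}"] conjI allI impI ballI)
  fix k assume "k < t"
  then show "{j. j < v \<and> c j = k} \<noteq> {}" using ne by auto
next
  fix k i j assume k: "k < t" "i < u" "\<exists>j\<in>{j. j < v \<and> c j = k}. A $$ (i, j) \<noteq> \<zero>\<^bsub>R\<^esub>"
    and j: "j \<in> {..<v} - {j. j < v \<and> c j = k}"
  then obtain j' where "j' < v" "c j' = k" "A $$ (i, j') \<noteq> \<zero>\<^bsub>R\<^esub>" by auto
  then show "A $$ (i, j) = \<zero>\<^bsub>R\<^esub>" using mono[OF k(2), of j j'] j by auto
qed (auto simp: disjoint_family_on_def)

lemma has_blocks_le:
  assumes "has_blocks R A t"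
  shows "t \<le> dim_col A"
proof -
  obtain C where C: "\<And>k. k < t \<Longrightarrow> C k \<noteq> {}" "\<And>k. k < t \<Longrightarrow> C k \<subseteq> {..<dim_col A}"
    "disjoint_family_on C {..<t}"
    using assms unfolding has_blocks_def by auto
  define p where "p = (\<lambda>k. SOME j. j \<in> C k)"
  have p: "p k \<in> C k" if "k < t" for k unfolding p_def using C(1)[OF that] by (simp add: some_in_eq)
  have "inj_on p {..<t}"
  proof (rule inj_onI)
    fix i j assume ij: "i \<in> {..<t}" "j \<in> {..<t}" "p i = p j"
    then have "p i \<in> C i \<inter> C j" using p[of i] p[of j] by auto
    then show "i = j" using C(3) ij unfolding disjoint_family_on_def by auto
  qed
  moreover have "p ` {..<t} \<subseteq> {..<dim_col A}" using subsetD[OF C(2) p] by auto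
  ultimately show ?thesis using card_inj_on_le[of p "{..<t}" "{..<dim_col A}"] by simp
qed

lemma block_number_attained: "has_blocks R A (block_number R A)"
  and has_blocks_le_block_number: "has_blocks R A t \<Longrightarrow> t \<le> block_number R A"
proof -
  have "has_blocks R A 0" by (auto simp: has_blocks_def disjoint_family_on_def)
  then have ne: "{t. has_blocks R A t} \<noteq> {}" by auto
  have fin: "finite {t. has_blocks R A t}"
    by (rule finite_subset[of _ "{..dim_col A}"]) (auto dest: has_blocks_le)
  show "has_blocks R A (block_number R A)" using Max_in[OF fin ne] by (simp add: block_number_def)
  show "has_blocks R A t \<Longrightarrow> t \<le> block_number R A" using Max_ge[OF fin] by (simp add: block_number_def)
qed

section \<open>Block forms and direct decompositions\<close>

context ring
begin

text \<open>A finite generating set contains a minimal basis, and all minimal bases have the same number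
  of elements because their presentations are isomorphic.\<close>

lemma generating_set_card_ge:
  assumes noeth: "left_noetherian R" and uniq: "unique_minimal_resolutions R"
    and M: "left_module R M"
    and eps: "eps \<in> lm_hom R (free_rank R v) M" "eps ` carrier (free_rank R v) = carrier M"
      "minimal_on_basis R v M eps"
    and X: "finite X" "generates R M X"
  shows "v \<le> card X"
proof -
  interpret M: left_module R M by fact
  obtain T where T: "T \<subseteq> X" "minimal_basis R M T"
    using M.minimal_basis_in_finite_generating_set[OF X] by metis
  have finT: "finite T" using T(1) X(1) by (rule finite_subset)
  obtain b where b: "bij_betw b {..<card T} T"
    using ex_bij_betw_nat_finite[OF finT] by (auto simp: atLeast0LessThan)
  note eps' = M.minimal_on_basis_free_lift[OF T(2) b]
  note K = submodule_kernel[OF left_module_free M eps(1)]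
  note K' = submodule_kernel[OF left_module_free M eps'(1)]
  obtain n d where d: "d \<in> lm_hom R (free_rank R n) (free_rank R v)"
    "d ` carrier (free_rank R n) = a_kernel (free_rank R v) M eps"
    "minimal_on_basis R n ((free_rank R v)\<lparr>carrier := a_kernel (free_rank R v) M eps\<rparr>) d"
    using minimal_cover_of_submodule[OF noeth K] by auto
  obtain n' d' where d': "d' \<in> lm_hom R (free_rank R n') (free_rank R (card T))"
    "d' ` carrier (free_rank R n') = a_kernel (free_rank R (card T)) M (free_lift R M {..<card T} b)"
    "minimal_on_basis R n' ((free_rank R (card T))\<lparr>carrier :=
      a_kernel (free_rank R (card T)) M (free_lift R M {..<card T} b)\<rparr>) d'"
    using minimal_cover_of_submodule[OF noeth K'] by auto
  have "card T = v"
    using minimal_presentations_isomorphic[OF noeth uniq M eps d eps' d'] by simp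
  then show ?thesis using card_mono[OF X(1) T(1)] by simp
qed

text \<open>If \<open>A' = P A Q\<close>, the rows of \<open>A'\<close> generate the relations between the images of the basis
  under the presentation changed by \<open>Q\<close>. Each row meets the columns of one colour only.\<close>

lemma blocks_imp_decomposition:
  assumes noeth: "left_noetherian R" and uniq: "unique_minimal_resolutions R"
    and M: "left_module R M"
    and eps: "eps \<in> lm_hom R (free_rank R v) M" "eps ` carrier (free_rank R v) = carrier M"
      "minimal_on_basis R v M eps"
    and A: "A \<in> matrices R u v" "row_map R A ` carrier (free_rank R u) = a_kernel (free_rank R v) M eps"
    and A': "mat_equivalent R u v A A'" "has_blocks R A' t" "0 < t"
  obtains N where "direct_decomposition R M t N" "\<And>k. k < t \<Longrightarrow> N k \<noteq> {\<zero>\<^bsub>M\<^esub>}"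
proof -
  interpret M: left_module R M by fact
  have A'm: "A' \<in> matrices R u v" using A'(1) by (simp add: mat_equivalent_def)
  note A'd = matricesD[OF A'm]
  obtain c where c': "\<forall>j<v. c j < t" "\<forall>k<t. \<exists>j<v. c j = k"
    "\<forall>i<u. \<forall>j<v. \<forall>j'<v. A' $$ (i, j) \<noteq> \<zero> \<longrightarrow> A' $$ (i, j') \<noteq> \<zero> \<longrightarrow> c j = c j'"
    by (rule has_blocks_colouring[OF A'd(1,2) A'(2,3)])
  note c = c'[rule_format]
  obtain p q where p: "p \<in> lm_iso R (free_rank R u) (free_rank R u)"
    and q: "q \<in> lm_iso R (free_rank R v) (free_rank R v)"
    and pq': "\<forall>x\<in>carrier (free_rank R u). row_map R A' x = q (row_map R A (p x))"
    by (rule mat_equivalent_row_maps[OF A'(1)])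
  note pq = bspec[OF pq']
  let ?F = "free_rank R v" and ?q' = "the_inv_into (carrier (free_rank R v)) q"
  note q' = lm_iso_inv[OF left_module_free q]
  note qD = lm_isoD[OF q] and q'D = lm_isoD[OF q']
  have q'q: "?q' (q x) = x" if "x \<in> carrier ?F" for x by (rule the_inv_into_f_f[OF qD(2) that])
  have qq': "q (?q' x) = x" if "x \<in> carrier ?F" for x
    by (rule f_the_inv_into_f[OF qD(2)]) (simp add: qD(3) that)
  define eps' where "eps' = eps \<circ> ?q'"
  have eps': "eps' \<in> lm_hom R ?F M" unfolding eps'_def by (rule lm_hom_comp[OF q'D(1) eps(1)])
  have surj': "eps' ` carrier ?F = carrier M"
    unfolding eps'_def image_comp[symmetric] q'D(3) by (rule eps(2))
  let ?K = "a_kernel ?F M eps'"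
  have K: "submodule ?K R ?F" by (rule submodule_kernel[OF left_module_free M eps'])
  have "q ` a_kernel ?F M eps = ?K"
  proof
    show "q ` a_kernel ?F M eps \<subseteq> ?K"
      using q'q lm_hom_closed[OF qD(1)] by (auto simp: a_kernel_def' eps'_def)
    show "?K \<subseteq> q ` a_kernel ?F M eps"
    proof
      fix x assume "x \<in> ?K"
      then have x: "x \<in> carrier ?F" "eps (?q' x) = \<zero>\<^bsub>M\<^esub>" by (simp_all add: a_kernel_def' eps'_def)
      then have "?q' x \<in> a_kernel ?F M eps" using lm_hom_closed[OF q'D(1)] by (simp add: a_kernel_def')
      then have "q (?q' x) \<in> q ` a_kernel ?F M eps" by (rule imageI)
      then show "x \<in> q ` a_kernel ?F M eps" unfolding qq'[OF x(1)] .
    qed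
  qed
  moreover have "row_map R A' ` carrier (free_rank R u) = q ` (row_map R A ` (p ` carrier (free_rank R u)))"
    unfolding image_image by (rule image_cong[OF refl pq])
  ultimately have imA': "row_map R A' ` carrier (free_rank R u) = ?K"
    unfolding lm_isoD(3)[OF p] A(2) by simp
  let ?S = "(\<lambda>i. row_map R A' (free_unit R i)) ` {..<u}"
  interpret F: left_module R ?F by (rule left_module_free)
  have hull: "(\<lambda>H. submodule H R ?F) hull ?S = ?K" using row_map_image[OF A'm] imA' by simp
  have "?S \<subseteq> ?K" using hull_subset[of ?S "\<lambda>H. submodule H R ?F"] unfolding hull .
  then have S: "generates R (?F\<lparr>carrier := ?K\<rparr>) ?S" using hull by (simp add: F.generates_submodule_iff[OF K])
  have mono: "c i = c j"
    if s: "s \<in> ?S" "i \<in> {..<v}" "j \<in> {..<v}" "s i \<noteq> \<zero>" "s j \<noteq> \<zero>" for s i j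
  proof -
    obtain l where l: "l < u" "s = row_map R A' (free_unit R l)" using s(1) by auto
    have "A' $$ (l, i) \<noteq> \<zero>" "A' $$ (l, j) \<noteq> \<zero>"
      using s(2-5) unfolding l(2) row_map_unit[OF A'm l(1)] by simp_all
    then show ?thesis using c(3)[OF l(1), of i j] s(2,3) by simp
  qed
  define N where "N = (\<lambda>k. eps' ` carrier (free_module R {i \<in> {..<v}. c i = k}))"
  have D: "direct_decomposition R M t N"
    unfolding N_def
  proof (rule coloured_presentation_decomposition[OF M eps' surj'])
    show "c i < t" if "i \<in> {..<v}" for i using c(1) that by simp
    show "colour_part R {..<v} c k x \<in> ?K" if "k < t" "x \<in> ?K" for k x
      by (rule kernel_colour_closed_if_monochrome[OF K S mono that(2)])
  qed
  have u: "eps' (free_unit R j) \<in> N (c j)" if "j < v" for j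
    unfolding N_def by (rule imageI, rule free_unit_closed) (simp add: that)
  have "N k \<noteq> {\<zero>\<^bsub>M\<^esub>}" if k: "k < t" for k
  proof
    \<comment> \<open>otherwise the columns of the other colours give fewer than \<open>v\<close> generators\<close>
    assume Nk: "N k = {\<zero>\<^bsub>M\<^esub>}"
    let ?J = "{j \<in> {..<v}. c j \<noteq> k}" and ?X = "(\<lambda>j. eps' (free_unit R j)) ` {j \<in> {..<v}. c j \<noteq> k}"
    have gU: "generates R M (eps' ` (free_unit R ` {..<v}))"
      by (rule generates_image_iff[OF left_module_free M eps' surj' free_generated_by_units])
    have "generates R M ?X"
      unfolding M.generates_iff
    proof (intro conjI allI impI)
      show "?X \<subseteq> carrier M"
        using gU by (auto simp: generates_def)
      fix H assume H: "submodule H R M" "?X \<subseteq> H"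
      have "eps' (free_unit R j) \<in> H" if j: "j < v" for j
      proof (cases "c j = k")
        case True
        then have "eps' (free_unit R j) = \<zero>\<^bsub>M\<^esub>" using u[OF j] Nk by simp
        then show ?thesis using H(1) by (simp add: M.submodule_iff)
      next
        case False
        then show ?thesis using H(2) j by auto
      qed
      then have "eps' ` (free_unit R ` {..<v}) \<subseteq> H" by auto
      then show "H = carrier M" using gU H(1) by (simp add: M.generates_iff)
    qed
    then have "v \<le> card ?X"
      by (intro generating_set_card_ge[OF noeth uniq M eps]) simp_all
    also have "\<dots> \<le> card ?J" by (rule card_image_le) simp
    also have "\<dots> < card {..<v}"
      using c(2)[OF k] by (intro psubset_card_mono) auto
    finally show False by simp
  qed
  with D show ?thesis by (rule that)
qed

lemma surjective_endomorphism_iso: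
  assumes noeth: "left_noetherian R" and p: "p \<in> lm_hom R (free_rank R n) (free_rank R n)"
    and surj: "p ` carrier (free_rank R n) = carrier (free_rank R n)"
  shows "p \<in> lm_iso R (free_rank R n) (free_rank R n)"
proof -
  let ?F = "free_rank R n"
  interpret F: left_module R ?F by (rule left_module_free)
  have ker: "x = \<zero>\<^bsub>?F\<^esub>" if "x \<in> carrier ?F" "p x = \<zero>\<^bsub>?F\<^esub>" for x
    by (rule F.surjective_endomorphism_injective[OF _ p surj that])
      (rule submodule_free_rank_finitely_generated[OF noeth])
  have "inj_on p (carrier ?F)"
  proof (rule inj_onI)
    fix x y assume xy: "x \<in> carrier ?F" "y \<in> carrier ?F" "p x = p y"
    have ny: "\<ominus>\<^bsub>?F\<^esub> y \<in> carrier ?F" by (rule F.M.a_inv_closed[OF xy(2)])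
    have "p (x \<oplus>\<^bsub>?F\<^esub> \<ominus>\<^bsub>?F\<^esub> y) = p y \<oplus>\<^bsub>?F\<^esub> \<ominus>\<^bsub>?F\<^esub> p y"
      unfolding lm_hom_add[OF p xy(1) ny] lm_hom_neg[OF left_module_free left_module_free p xy(2)] xy(3) ..
    also have "\<dots> = \<zero>\<^bsub>?F\<^esub>" by (rule F.M.r_neg[OF lm_hom_closed[OF p xy(2)]])
    finally have "x \<oplus>\<^bsub>?F\<^esub> \<ominus>\<^bsub>?F\<^esub> y = \<zero>\<^bsub>?F\<^esub>" by (rule ker[OF F.M.a_closed[OF xy(1) ny]])
    then have "\<ominus>\<^bsub>?F\<^esub> (\<ominus>\<^bsub>?F\<^esub> y) = x" by (rule F.M.minus_equality[OF _ ny xy(1)])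
    then show "x = y" using F.M.minus_minus[OF xy(2)] by simp
  qed
  then show ?thesis using p surj by (simp add: lm_iso_def bij_betw_def)
qed

text \<open>The rows of a relation matrix generate the relations, but perhaps not minimally. A minimal
  subset of the rows already generates them, and adding to each of the other rows a combination of
  the chosen ones makes it zero. The chosen rows, regarded as the homomorphism \<open>d\<close>, may moreover be
  changed by any automorphism \<open>\<psi>\<close> of \<open>R\<^sup>w\<close>. Both changes form one endomorphism \<open>p\<close> of \<open>R\<^sup>u\<close>. It is
  surjective, hence invertible.\<close>

lemma row_reduction_to_minimal:
  assumes noeth: "left_noetherian R"
    and A: "A \<in> matrices R u v" and inj: "inj_on (\<lambda>i. row_map R A (free_unit R i)) {..<u}"
  obtains w d where "d \<in> lm_hom R (free_rank R w) (free_rank R v)"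
    "d ` carrier (free_rank R w) = row_map R A ` carrier (free_rank R u)"
    "minimal_on_basis R w ((free_rank R v)\<lparr>carrier := row_map R A ` carrier (free_rank R u)\<rparr>) d"
    "\<forall>\<psi>\<in>lm_iso R (free_rank R w) (free_rank R w).
      \<exists>p\<in>lm_iso R (free_rank R u) (free_rank R u). \<forall>i<u.
        row_map R A (p (free_unit R i)) = \<zero>\<^bsub>free_rank R v\<^esub> \<or>
        (\<exists>j<w. row_map R A (p (free_unit R i)) = d (\<psi> (free_unit R j)))"
proof -
  let ?F = "free_rank R v" and ?U = "free_rank R u"
  define K where "K = row_map R A ` carrier ?U"
  define row where "row = (\<lambda>i. row_map R A (free_unit R i))"
  note hA = row_map_hom[OF A]
  interpret F: left_module R ?F by (rule left_module_free)
  interpret U: left_module R ?U by (rule left_module_free)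
  have K: "submodule K R ?F"
    unfolding K_def by (rule submodule_image[OF left_module_free left_module_free hA U.submodule_carrier])
  have KF: "K \<subseteq> carrier ?F" using K by (simp add: F.submodule_iff)
  interpret K: left_module R "?F\<lparr>carrier := K\<rparr>" by (rule F.left_module_submodule[OF K])
  have hull: "(\<lambda>H. submodule H R ?F) hull (row ` {..<u}) = K"
    using row_map_image[OF A] by (simp add: K_def row_def)
  have rowK: "row ` {..<u} \<subseteq> K"
    using hull_subset[of "row ` {..<u}" "\<lambda>H. submodule H R ?F"] unfolding hull .
  have "generates R (?F\<lparr>carrier := K\<rparr>) (row ` {..<u})"
    using rowK hull by (simp add: F.generates_submodule_iff[OF K])
  from K.minimal_basis_in_finite_generating_set[OF _ this]
  obtain T where T: "T \<subseteq> row ` {..<u}" "minimal_basis R (?F\<lparr>carrier := K\<rparr>) T" by auto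
  define W where "W = {i. i < u \<and> row i \<in> T}"
  have Wu: "W \<subseteq> {..<u}" by (auto simp: W_def)
  then have finW: "finite W" by (rule finite_subset) simp
  define w where "w = card W"
  obtain \<beta> where \<beta>: "bij_betw \<beta> {..<w} W"
    using ex_bij_betw_nat_finite[OF finW] by (auto simp: atLeast0LessThan w_def)
  have "row ` W = T" using T(1) by (auto simp: W_def)
  moreover have "inj_on row W" using inj_on_subset[OF inj Wu] by (simp add: row_def)
  ultimately have "bij_betw row W T" by (simp add: bij_betw_def)
  then have b: "bij_betw (row \<circ> \<beta>) {..<w} T" by (rule bij_betw_trans[OF \<beta>])
  define d where "d = free_lift R (?F\<lparr>carrier := K\<rparr>) {..<w} (row \<circ> \<beta>)"
  note dm = K.minimal_on_basis_free_lift[OF T(2) b, folded d_def]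
  have dF: "d \<in> lm_hom R (free_rank R w) ?F" by (rule lm_hom_codomain_restrict[OF dm(1) KF])
  have dK: "d ` carrier (free_rank R w) = K" using dm(2) by simp
  have du: "d (free_unit R j) = row (\<beta> j)" if "j < w" for j
  proof -
    have \<beta>W: "\<And>i. i \<in> {..<w} \<Longrightarrow> (row \<circ> \<beta>) i \<in> carrier (?F\<lparr>carrier := K\<rparr>)"
      using \<beta> rowK Wu by (auto simp: bij_betw_def)
    have "d (free_unit R j) = (row \<circ> \<beta>) j"
      unfolding d_def by (rule K.free_lift_unit[OF \<beta>W]) (simp_all add: that)
    then show ?thesis by simp
  qed
  \<comment> \<open>the isomorphism \<open>R\<^sup>w \<rightarrow> R\<^sup>W\<close> given by \<open>\<beta>\<close>\<close>
  define \<gamma> where "\<gamma> = reindex R W (the_inv_into {..<w} \<beta>)"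
  note \<beta>' = bij_betw_the_inv_into[OF \<beta>]
  have \<gamma>: "\<gamma> \<in> lm_iso R (free_rank R w) (free_module R W)" unfolding \<gamma>_def by (rule reindex_iso[OF \<beta>'])
  have "\<gamma> \<in> lm_hom R (free_rank R w) (free_module R W)" by (rule lm_isoD(1)[OF \<gamma>])
  from lm_hom_comp[OF this inclusion_hom[OF Wu]]
  have \<gamma>U: "\<gamma> \<in> lm_hom R (free_rank R w) ?U" by (simp add: comp_def)
  have \<gamma>u: "\<gamma> (free_unit R j) = free_unit R (\<beta> j)" if "j < w" for j
  proof -
    have "\<beta> j \<in> W" using \<beta> that by (auto simp: bij_betw_def)
    moreover have "the_inv_into {..<w} \<beta> (\<beta> j) = j"
      by (rule the_inv_into_f_f) (use \<beta> that in \<open>auto simp: bij_betw_def\<close>)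
    ultimately show ?thesis using reindex_unit[OF \<beta>', of "\<beta> j"] by (simp add: \<gamma>_def)
  qed
  have A\<gamma>: "row_map R A (\<gamma> x) = d x" if "x \<in> carrier (free_rank R w)" for x
  proof -
    have "(row_map R A \<circ> \<gamma>) x = d x"
      by (rule free_hom_eqI[OF left_module_free lm_hom_comp[OF \<gamma>U hA] dF _ that])
        (simp add: \<gamma>u du row_def)
    then show ?thesis by simp
  qed
  \<comment> \<open>every row is cancelled by a combination of the chosen rows\<close>
  have "\<exists>m. m \<in> carrier (free_module R W) \<and> row_map R A m = \<ominus>\<^bsub>?F\<^esub> row i" if "i < u" for i
  proof -
    have "row i \<in> K" using rowK that by auto
    then have "\<ominus>\<^bsub>?F\<^esub> row i \<in> d ` carrier (free_rank R w)" unfolding dK by (rule F.submodule_neg[OF K])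
    then obtain x where x: "x \<in> carrier (free_rank R w)" "d x = \<ominus>\<^bsub>?F\<^esub> row i" by auto
    then show ?thesis
      using A\<gamma>[OF x(1)] lm_hom_closed[OF lm_isoD(1)[OF \<gamma>] x(1)] by (intro exI[of _ "\<gamma> x"]) simp
  qed
  then obtain m where m: "\<And>i. i < u \<Longrightarrow> m i \<in> carrier (free_module R W)"
    "\<And>i. i < u \<Longrightarrow> row_map R A (m i) = \<ominus>\<^bsub>?F\<^esub> row i" by metis
  have mU: "m i \<in> carrier ?U" if "i < u" for i by (rule subsetD[OF free_module_mono[OF Wu] m(1)[OF that]])
  have unitU: "free_unit R i \<in> carrier ?U" if "i < u" for i by (rule free_unit_closed) (simp add: that)
  have main: "\<exists>p\<in>lm_iso R ?U ?U. \<forall>i<u.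
        row_map R A (p (free_unit R i)) = \<zero>\<^bsub>?F\<^esub> \<or>
        (\<exists>j<w. row_map R A (p (free_unit R i)) = d (\<psi> (free_unit R j)))"
    if \<psi>: "\<psi> \<in> lm_iso R (free_rank R w) (free_rank R w)" for \<psi>
  proof -
    note \<psi>D = lm_isoD[OF \<psi>]
    let ?\<beta>' = "the_inv_into {..<w} \<beta>"
    have \<beta>'w: "?\<beta>' i < w" if "i \<in> W" for i using \<beta>' that by (auto simp: bij_betw_def)
    have \<beta>'\<beta>: "?\<beta>' (\<beta> j) = j" if "j < w" for j
      by (rule the_inv_into_f_f) (use \<beta> that in \<open>auto simp: bij_betw_def\<close>)
    have unitw: "free_unit R j \<in> carrier (free_rank R w)" if "j < w" for j
      by (rule free_unit_closed) (simp add: that)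
    define n where "n = (\<lambda>i. if i \<in> W then \<gamma> (\<psi> (free_unit R (?\<beta>' i))) else free_unit R i \<oplus>\<^bsub>?U\<^esub> m i)"
    have nU: "n i \<in> carrier ?U" if "i \<in> {..<u}" for i
    proof (cases "i \<in> W")
      case True
      then show ?thesis
        using lm_hom_closed[OF \<gamma>U lm_hom_closed[OF \<psi>D(1) unitw[OF \<beta>'w[OF True]]]] by (simp add: n_def)
    next
      case False
      then show ?thesis using free_add_closed[OF unitU mU] that by (simp add: n_def)
    qed
    define p where "p = free_lift R ?U {..<u} n"
    have p: "p \<in> lm_hom R ?U ?U" unfolding p_def by (rule U.free_lift_hom[OF nU])
    have pu: "p (free_unit R i) = n i" if "i < u" for i
      unfolding p_def by (rule U.free_lift_unit[OF nU]) (simp_all add: that)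
    have p\<gamma>: "p (\<gamma> x) = \<gamma> (\<psi> x)" if "x \<in> carrier (free_rank R w)" for x
    proof -
      have "(p \<circ> \<gamma>) x = (\<gamma> \<circ> \<psi>) x"
      proof (rule free_hom_eqI[OF left_module_free lm_hom_comp[OF \<gamma>U p] lm_hom_comp[OF \<psi>D(1) \<gamma>U] _ that])
        fix j assume "j \<in> {..<w}"
        then have j: "j < w" by simp
        then have "\<beta> j \<in> W" using \<beta> by (auto simp: bij_betw_def)
        then show "(p \<circ> \<gamma>) (free_unit R j) = (\<gamma> \<circ> \<psi>) (free_unit R j)"
          using pu[of "\<beta> j"] Wu j by (auto simp: \<gamma>u n_def \<beta>'\<beta>)
      qed
      then show ?thesis by simp
    qed
    have imp: "submodule (p ` carrier ?U) R ?U"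
      by (rule submodule_image[OF left_module_free left_module_free p U.submodule_carrier])
    have WP: "x \<in> p ` carrier ?U" if "x \<in> carrier (free_module R W)" for x
    proof -
      have "x \<in> \<gamma> ` carrier (free_rank R w)" using that unfolding lm_isoD(3)[OF \<gamma>] .
      then obtain y where y: "y \<in> carrier (free_rank R w)" "x = \<gamma> y" by auto
      have "y \<in> \<psi> ` carrier (free_rank R w)" using y(1) unfolding \<psi>D(3) .
      then obtain z where z: "z \<in> carrier (free_rank R w)" "y = \<psi> z" by auto
      have "p (\<gamma> z) \<in> p ` carrier ?U" by (rule imageI[OF lm_hom_closed[OF \<gamma>U z(1)]])
      then show ?thesis unfolding p\<gamma>[OF z(1)] y(2) z(2) .
    qed
    have "free_unit R i \<in> p ` carrier ?U" if i: "i < u" for i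
    proof (cases "i \<in> W")
      case True
      then show ?thesis by (intro WP free_unit_closed)
    next
      case False
      have "n i \<in> p ` carrier ?U" unfolding pu[OF i, symmetric] by (rule imageI[OF unitU[OF i]])
      moreover have "\<ominus>\<^bsub>?U\<^esub> m i \<in> p ` carrier ?U" by (rule U.submodule_neg[OF imp WP[OF m(1)[OF i]]])
      ultimately have "n i \<oplus>\<^bsub>?U\<^esub> \<ominus>\<^bsub>?U\<^esub> m i \<in> p ` carrier ?U" using imp unfolding U.submodule_iff by blast
      moreover have "n i \<oplus>\<^bsub>?U\<^esub> \<ominus>\<^bsub>?U\<^esub> m i = free_unit R i"
        using False unitU[OF i] mU[OF i] by (simp add: n_def U.M.a_assoc U.M.r_neg)
      ultimately show ?thesis by simp
    qed
    then have "free_unit R ` {..<u} \<subseteq> p ` carrier ?U" by auto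
    then have "carrier ?U \<subseteq> p ` carrier ?U" by (rule U.generatesD[OF free_generated_by_units imp])
    then have "p ` carrier ?U = carrier ?U" using lm_hom_closed[OF p] by auto
    then have piso: "p \<in> lm_iso R ?U ?U" by (rule surjective_endomorphism_iso[OF noeth p])
    have "row_map R A (p (free_unit R i)) = \<zero>\<^bsub>?F\<^esub> \<or>
        (\<exists>j<w. row_map R A (p (free_unit R i)) = d (\<psi> (free_unit R j)))" if i: "i < u" for i
    proof (cases "i \<in> W")
      case True
      have "row_map R A (p (free_unit R i)) = d (\<psi> (free_unit R (?\<beta>' i)))"
        using A\<gamma>[OF lm_hom_closed[OF \<psi>D(1) unitw[OF \<beta>'w[OF True]]]] True by (simp add: pu[OF i] n_def)
      then show ?thesis using \<beta>'w[OF True] by auto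
    next
      case False
      have "row_map R A (p (free_unit R i)) = row i \<oplus>\<^bsub>?F\<^esub> \<ominus>\<^bsub>?F\<^esub> row i"
        using lm_hom_add[OF hA unitU[OF i] mU[OF i]] False by (simp add: pu[OF i] n_def m(2)[OF i] row_def)
      also have "\<dots> = \<zero>\<^bsub>?F\<^esub>" using rowK KF i by (intro F.M.r_neg) auto
      finally show ?thesis ..
    qed
    then show ?thesis using piso by auto
  qed
  show ?thesis
  proof (rule that)
    show "d \<in> lm_hom R (free_rank R w) ?F" by (rule dF)
    show "d ` carrier (free_rank R w) = row_map R A ` carrier ?U" using dK unfolding K_def .
    show "minimal_on_basis R w (?F\<lparr>carrier := row_map R A ` carrier ?U\<rparr>) d"
      using dm(3) unfolding K_def .
  qed (rule ballI, rule main)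
qed

text \<open>A presentation adapted to the decomposition has monochrome relations, hence a matrix in block
  form. Comparing it with the given presentation yields the row and column operations: \<open>\<phi>\<close> changes
  the generators, and \<open>\<psi>\<close> enters the row reduction.\<close>

lemma decomposition_imp_blocks:
  assumes noeth: "left_noetherian R" and uniq: "unique_minimal_resolutions R"
    and M: "left_module R M" and fg: "finitely_generated R M"
    and eps: "eps \<in> lm_hom R (free_rank R v) M" "eps ` carrier (free_rank R v) = carrier M"
      "minimal_on_basis R v M eps"
    and A: "A \<in> matrices R u v" "row_map R A ` carrier (free_rank R u) = a_kernel (free_rank R v) M eps"
      "inj_on (\<lambda>i. row_map R A (free_unit R i)) {..<u}"
    and D: "direct_decomposition R M t N" and nz: "\<And>k. k < t \<Longrightarrow> N k \<noteq> {\<zero>\<^bsub>M\<^esub>}"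
  shows "\<exists>A'. mat_equivalent R u v A A' \<and> has_blocks R A' t"
proof -
  interpret M: left_module R M by fact
  \<comment> \<open>a second minimal presentation, with homogeneous generators and monochrome relations\<close>
  obtain T where T: "finite T" "minimal_basis R M T" "\<forall>x\<in>T. \<exists>k<t. x \<in> N k"
    by (rule M.homogeneous_minimal_basis[OF fg D])
  obtain b where b: "bij_betw b {..<card T} T"
    using ex_bij_betw_nat_finite[OF T(1)] by (auto simp: atLeast0LessThan)
  define n where "n = card T"
  define eps' where "eps' = free_lift R M {..<n} b"
  note eps' = M.minimal_on_basis_free_lift[OF T(2) b, folded n_def, folded eps'_def]
  have bT: "b j \<in> T" if "j < n" for j using b that by (auto simp: bij_betw_def n_def)
  have TM: "T \<subseteq> carrier M" using T(2) by (simp add: minimal_basis_def generates_def)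
  have eu: "eps' (free_unit R j) = b j" if "j < n" for j
    unfolding eps'_def by (rule M.free_lift_unit) (use bT TM that in auto)
  have "\<forall>j\<in>{..<n}. \<exists>k. k < t \<and> b j \<in> N k" using bspec[OF T(3) bT] by auto
  then obtain c where c: "\<And>j. j < n \<Longrightarrow> c j < t" "\<And>j. j < n \<Longrightarrow> b j \<in> N (c j)" by (metis lessThan_iff)
  have c': "\<And>j. j \<in> {..<n} \<Longrightarrow> c j < t" "\<And>j. j \<in> {..<n} \<Longrightarrow> eps' (free_unit R j) \<in> N (c j)"
    using c eu by simp_all
  let ?K' = "a_kernel (free_rank R n) M eps'"
  note K' = submodule_kernel[OF left_module_free M eps'(1)]
  have closed: "colour_part R {..<n} c k x \<in> ?K'" if "k < t" "x \<in> ?K'" for k x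
    by (rule decomposition_coloured_kernel[OF M eps'(1) D c' that])
  obtain T' where T': "finite T'" "minimal_basis R ((free_rank R n)\<lparr>carrier := ?K'\<rparr>) T'"
    "\<forall>s\<in>T'. \<forall>i j. s i \<noteq> \<zero> \<longrightarrow> s j \<noteq> \<zero> \<longrightarrow> c i = c j"
    by (rule monochrome_minimal_basis[OF noeth K' c(1) closed])
  obtain b' where b': "bij_betw b' {..<card T'} T'"
    using ex_bij_betw_nat_finite[OF T'(1)] by (auto simp: atLeast0LessThan)
  interpret F': left_module R "free_rank R n" by (rule left_module_free)
  interpret K': left_module R "(free_rank R n)\<lparr>carrier := ?K'\<rparr>" by (rule F'.left_module_submodule[OF K'])
  define w' where "w' = card T'"
  define d' where "d' = free_lift R ((free_rank R n)\<lparr>carrier := ?K'\<rparr>) {..<w'} b'"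
  note dm' = K'.minimal_on_basis_free_lift[OF T'(2) b', folded w'_def, folded d'_def]
  have K'F: "?K' \<subseteq> carrier (free_rank R n)" by (auto simp: a_kernel_def')
  have d': "d' \<in> lm_hom R (free_rank R w') (free_rank R n)" by (rule lm_hom_codomain_restrict[OF dm'(1) K'F])
  have dK': "d' ` carrier (free_rank R w') = ?K'" using dm'(2) by simp
  have T'K: "T' \<subseteq> ?K'" using T'(2) by (simp add: minimal_basis_def generates_def)
  have b'T: "b' j \<in> T'" if "j < w'" for j using b' that by (auto simp: bij_betw_def w'_def)
  have du': "d' (free_unit R j) = b' j" if "j < w'" for j
    unfolding d'_def by (rule K'.free_lift_unit) (use b'T T'K that in auto)
  \<comment> \<open>comparison with the given presentation\<close>
  obtain w d where d: "d \<in> lm_hom R (free_rank R w) (free_rank R v)"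
    "d ` carrier (free_rank R w) = a_kernel (free_rank R v) M eps"
    "minimal_on_basis R w ((free_rank R v)\<lparr>carrier := a_kernel (free_rank R v) M eps\<rparr>) d"
    and red: "\<forall>\<psi>\<in>lm_iso R (free_rank R w) (free_rank R w).
      \<exists>p\<in>lm_iso R (free_rank R u) (free_rank R u). \<forall>i<u.
        row_map R A (p (free_unit R i)) = \<zero>\<^bsub>free_rank R v\<^esub> \<or>
        (\<exists>j<w. row_map R A (p (free_unit R i)) = d (\<psi> (free_unit R j)))"
    by (rule row_reduction_to_minimal[OF noeth A(1,3), unfolded A(2)])
  obtain \<phi> \<psi> where nv: "n = v" "w' = w" and \<phi>: "\<phi> \<in> lm_iso R (free_rank R v) (free_rank R v)"
    and \<psi>: "\<psi> \<in> lm_iso R (free_rank R w) (free_rank R w)"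
    and comm: "\<And>x. x \<in> carrier (free_rank R w) \<Longrightarrow> \<phi> (d x) = d' (\<psi> x)"
    using minimal_presentations_isomorphic[OF noeth uniq M eps d eps' d' dK' dm'(3)] by auto
  let ?\<psi>' = "the_inv_into (carrier (free_rank R w)) \<psi>"
  note \<psi>' = lm_iso_inv[OF left_module_free \<psi>]
  obtain p where p: "p \<in> lm_iso R (free_rank R u) (free_rank R u)"
    and pA: "\<And>i. i < u \<Longrightarrow> row_map R A (p (free_unit R i)) = \<zero>\<^bsub>free_rank R v\<^esub> \<or>
        (\<exists>j<w. row_map R A (p (free_unit R i)) = d (?\<psi>' (free_unit R j)))"
    using bspec[OF red \<psi>'] by auto
  have \<phi>d: "\<phi> (d (?\<psi>' (free_unit R j))) = b' j" if j: "j < w" for j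
  proof -
    have e: "free_unit R j \<in> carrier (free_rank R w)" by (rule free_unit_closed) (simp add: j)
    have "\<psi> (?\<psi>' (free_unit R j)) = free_unit R j"
      by (rule f_the_inv_into_f[OF lm_isoD(2)[OF \<psi>]]) (simp add: lm_isoD(3)[OF \<psi>] e)
    then show ?thesis
      using comm[OF lm_hom_closed[OF lm_isoD(1)[OF \<psi>'] e]] du'[of j] j nv by simp
  qed
  define f where "f = \<phi> \<circ> row_map R A \<circ> p"
  have f: "f \<in> lm_hom R (free_rank R u) (free_rank R v)"
    unfolding f_def comp_assoc
    by (intro lm_hom_comp[OF lm_hom_comp[OF lm_isoD(1)[OF p] row_map_hom[OF A(1)]] lm_isoD(1)[OF \<phi>]])
  define A' where "A' = hom_mat R u v f"
  have A'm: "A' \<in> matrices R u v" unfolding A'_def by (rule hom_mat_matrices[OF f])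
  have entry: "A' $$ (i, j) = f (free_unit R i) j" if "i < u" "j < v" for i j
    using that by (simp add: A'_def hom_mat_def)
  have mono: "c j = c j'"
    if i: "i < u" and j: "j < v" "j' < v" "A' $$ (i, j) \<noteq> \<zero>" "A' $$ (i, j') \<noteq> \<zero>" for i j j'
  proof -
    have nz: "f (free_unit R i) j \<noteq> \<zero>" "f (free_unit R i) j' \<noteq> \<zero>"
      using j entry[OF i] by simp_all
    have "row_map R A (p (free_unit R i)) \<noteq> \<zero>\<^bsub>free_rank R v\<^esub>"
    proof
      assume "row_map R A (p (free_unit R i)) = \<zero>\<^bsub>free_rank R v\<^esub>"
      then have "f (free_unit R i) = \<zero>\<^bsub>free_rank R v\<^esub>"
        using lm_hom_zero[OF left_module_free left_module_free lm_isoD(1)[OF \<phi>]] by (simp add: f_def)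
      then show False using nz(1) by (simp add: free_module_simps(2))
    qed
    then obtain l where l: "l < w" "row_map R A (p (free_unit R i)) = d (?\<psi>' (free_unit R l))"
      using pA[OF i] by auto
    then have "f (free_unit R i) = b' l" using \<phi>d[OF l(1)] by (simp add: f_def)
    then have "b' l j \<noteq> \<zero>" "b' l j' \<noteq> \<zero>" using nz by simp_all
    moreover have "b' l \<in> T'" using b'T l(1) nv by simp
    ultimately show ?thesis using T'(3) by blast
  qed
  have "\<exists>j<v. c j = k" if "k < t" for k
    using decomposition_all_colours_occur[OF M eps'(1,2) D c' that nz[OF that]] nv by auto
  from colouring_has_blocks[OF matricesD(1)[OF A'm] matricesD(2)[OF A'm] this mono]
  have "has_blocks R A' t" by simp
  moreover have "mat_equivalent R u v A A'"
  proof (rule mat_equivalent_if_row_maps[OF A(1) A'm p \<phi>])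
    fix i assume "i < u"
    then have "free_unit R i \<in> carrier (free_rank R u)" by (intro free_unit_closed) simp
    then show "row_map R A' (free_unit R i) = \<phi> (row_map R A (p (free_unit R i)))"
      using row_map_hom_mat[OF f] by (simp add: A'_def f_def)
  qed
  ultimately show ?thesis by auto
qed

end

section \<open>The relationship matrix\<close>

text \<open>With the generators numbered by \<open>g\<close>, the rows of the relationship matrix are the given
  relations read as vectors in \<open>R\<^sup>v\<close>, without repetitions because \<open>r\<close> enumerates \<open>S\<close>. So the matrix
  presents the module.\<close>

lemma relationship_matrix_presents:
  fixes R :: "('a, 'x) ring_scheme" and M :: "('a, 'b, 'y) module_scheme"
  assumes M: "left_module R M" and G: "generates R M G" and S: "relationship_set R M G S"
    and g: "bij_betw g {..<v} G" and r: "bij_betw r {..<u} S"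
  defines "A \<equiv> relationship_matrix u v g r"
  shows "A \<in> matrices R u v"
    and "row_map R A ` carrier (free_rank R u) = a_kernel (free_rank R v) M (free_lift R M {..<v} g)"
    and "inj_on (\<lambda>i. row_map R A (free_unit R i)) {..<u}"
proof -
  interpret M: left_module R M by fact
  let ?F = "free_module R G" and ?E = "free_rank R v" and ?K = "relationship_submodule R M G"
  let ?h = "reindex R {..<v} g" and ?eps = "free_lift R M {..<v} g" and ?lift = "free_lift R M G (\<lambda>x. x)"
  note lift = M.generators_lift[OF G]
  interpret F: left_module R ?F by (rule M.R.left_module_free)
  interpret E: left_module R ?E by (rule M.R.left_module_free)
  have K: "submodule ?K R ?F"
    unfolding relationship_submodule_kernel
    by (rule submodule_kernel[OF M.R.left_module_free M lift(1)])
  have KF: "?K \<subseteq> carrier ?F" using K by (simp add: F.submodule_iff)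
  have hullS: "(\<lambda>H. submodule H R ?F) hull S = ?K" and SK: "S \<subseteq> ?K"
    using S unfolding relationship_set_def F.generates_submodule_iff[OF K] by auto
  have rS: "r i \<in> S" if "i < u" for i using r that by (auto simp: bij_betw_def)
  have rF: "r i \<in> carrier ?F" if "i < u" for i using rS[OF that] SK KF by blast
  have entries: "r i x \<in> carrier R" if "i < u" for i x by (rule M.R.free_carrier_closed[OF rF[OF that]])
  show A: "A \<in> matrices R u v"
    using entries by (simp add: A_def relationship_matrix_def matrices_def)
  have row: "row_map R A (free_unit R i) = ?h (r i)" if "i < u" for i
    unfolding M.R.row_map_unit[OF A that] using that
    by (simp add: A_def relationship_matrix_def reindex_def fun_eq_iff)
  note h = M.R.reindex_iso[OF g]
  note hD = lm_isoD[OF h]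
  have gM: "g j \<in> carrier M" if "j \<in> {..<v}" for j
    using g G that by (auto simp: bij_betw_def generates_def)
  have eps: "?eps \<in> lm_hom R ?E M" by (rule M.free_lift_hom[OF gM])
  have comm: "?eps (?h y) = ?lift y" if y: "y \<in> carrier ?F" for y
  proof -
    have "(?eps \<circ> ?h) y = ?lift y"
    proof (rule M.R.free_hom_eqI[OF M lm_hom_comp[OF hD(1) eps] lift(1) _ y])
      fix x assume "x \<in> G"
      then obtain j where j: "j \<in> {..<v}" "x = g j" using g by (auto simp: bij_betw_def)
      have "(?eps \<circ> ?h) (free_unit R x) = g j"
        using M.R.reindex_unit[OF g j(1)] M.free_lift_unit[OF gM j(1)] by (simp add: j(2))
      then show "(?eps \<circ> ?h) (free_unit R x) = ?lift (free_unit R x)"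
        using lift(3)[OF \<open>x \<in> G\<close>] j(2) by simp
    qed
    then show ?thesis by simp
  qed
  have hK: "?h ` ?K = a_kernel ?E M ?eps"
  proof
    show "?h ` ?K \<subseteq> a_kernel ?E M ?eps"
      unfolding relationship_submodule_kernel
      using comm lm_hom_closed[OF hD(1)] by (auto simp: a_kernel_def')
    show "a_kernel ?E M ?eps \<subseteq> ?h ` ?K"
    proof
      fix x assume x: "x \<in> a_kernel ?E M ?eps"
      then have "x \<in> ?h ` carrier ?F" unfolding hD(3) by (simp add: a_kernel_def')
      then obtain y where y: "y \<in> carrier ?F" "x = ?h y" by auto
      then have "y \<in> ?K"
        using x comm[OF y(1)] by (simp add: relationship_submodule_kernel a_kernel_def')
      then show "x \<in> ?h ` ?K" using y(2) by simp
    qed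
  qed
  have rows: "(\<lambda>i. row_map R A (free_unit R i)) ` {..<u} = ?h ` S"
  proof -
    have "(\<lambda>i. row_map R A (free_unit R i)) ` {..<u} = ?h ` (r ` {..<u})"
      unfolding image_image by (rule image_cong[OF refl]) (simp add: row)
    then show ?thesis using r by (simp add: bij_betw_def)
  qed
  have SF: "S \<subseteq> carrier ?F" using SK KF by blast
  show "row_map R A ` carrier (free_rank R u) = a_kernel ?E M ?eps"
    unfolding M.R.row_map_image[OF A] rows hK[symmetric] hullS[symmetric]
    by (rule hull_image[OF M.R.left_module_free M.R.left_module_free hD(1) SF, symmetric])
  have "inj_on (?h \<circ> r) {..<u}"
    using r by (intro comp_inj_on inj_on_subset[OF hD(2)]) (auto simp: bij_betw_def intro: subsetD[OF SF])
  then show "inj_on (\<lambda>i. row_map R A (free_unit R i)) {..<u}"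
    using row by (auto simp: inj_on_def)
qed

theorem theorem2p2:
  fixes R :: "('a, 'x) ring_scheme" and M :: "('a, 'b, 'y) module_scheme"
    and G :: "'b set" and S :: "('b \<Rightarrow> 'a) set"
    and u v :: nat and g :: "nat \<Rightarrow> 'b" and r :: "nat \<Rightarrow> 'b \<Rightarrow> 'a"
  assumes "left_noetherian R"
    and "unique_minimal_resolutions R"
    and "left_module R M"
    and "finitely_generated R M"
    and "minimal_basis R M G"
    and "relationship_set R M G S"
    and "bij_betw g {..<v} G"
    and "bij_betw r {..<u} S"
  shows "decomposition_number R M =
    enat (Max {block_number R A | A. mat_equivalent R u v A (relationship_matrix u v g r)})"
proof -
  note noeth = assms(1) and uniq = assms(2) and M = assms(3) and fg = assms(4)
  interpret M: left_module R M by fact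
  have genG: "generates R M G" using assms(5) by (simp add: minimal_basis_def)
  let ?eps = "free_lift R M {..<v} g"
  define A0 where "A0 = relationship_matrix u v g r"
  note eps = M.minimal_on_basis_free_lift[OF assms(5,7)]
  note A0 = relationship_matrix_presents[OF M genG assms(6-8), folded A0_def]
  let ?B = "{block_number R A | A. mat_equivalent R u v A A0}"
  define n where "n = Max ?B"
  have block_le: "t \<le> v" if "mat_equivalent R u v A A0" "has_blocks R A t" for A t
    using has_blocks_le[OF that(2)] that(1) matricesD(2)[of A R u v] by (simp add: mat_equivalent_def)
  have "?B \<subseteq> {..v}" using block_le block_number_attained by auto
  then have fin: "finite ?B" by (rule finite_subset) simp
  have ne: "?B \<noteq> {}" using M.R.mat_equivalent_refl[OF A0(1)] by auto
  have "n \<in> ?B" unfolding n_def by (rule Max_in[OF fin ne])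
  then obtain A where A: "mat_equivalent R u v A A0" "n = block_number R A" by auto
  have le: "t \<le> n" if B: "mat_equivalent R u v A' A0" "has_blocks R A' t" for A' t
  proof -
    have "t \<le> block_number R A'" by (rule has_blocks_le_block_number[OF B(2)])
    also have "\<dots> \<le> n" unfolding n_def by (rule Max_ge[OF fin]) (use B(1) in auto)
    finally show ?thesis .
  qed
  have max: "t \<le> n" if D: "direct_decomposition R M t L" "\<And>k. k < t \<Longrightarrow> L k \<noteq> {\<zero>\<^bsub>M\<^esub>}" for t L
  proof -
    obtain A' where "mat_equivalent R u v A0 A'" "has_blocks R A' t"
      using M.R.decomposition_imp_blocks[OF noeth uniq M fg eps A0 D] by auto
    then show ?thesis using le M.R.mat_equivalent_sym by blast
  qed
  have "\<exists>N. direct_decomposition R M n N \<and> (\<forall>k<n. N k \<noteq> {\<zero>\<^bsub>M\<^esub>})"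
  proof (cases "n = 0")
    case True
    \<comment> \<open>a single block containing all columns exists unless there are no generators\<close>
    have "v = 0"
    proof (rule ccontr)
      assume "v \<noteq> 0"
      then have "has_blocks R A0 1"
        by (intro colouring_has_blocks[OF matricesD(1)[OF A0(1)] matricesD(2)[OF A0(1)], where c = "\<lambda>_. 0"])
          auto
      then have "1 \<le> n" by (rule le[OF M.R.mat_equivalent_refl[OF A0(1)]])
      then show False using True by simp
    qed
    then have "G = {}" using assms(7) by (simp add: bij_betw_def)
    then have "{\<zero>\<^bsub>M\<^esub>} = carrier M" using genG M.submodule_zero by (simp add: M.generates_iff)
    then have "carrier M = {\<zero>\<^bsub>M\<^esub>}" by (rule sym)
    then have "direct_decomposition R M 0 (\<lambda>_. {})"
      by (intro M.direct_decompositionI) auto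
    then show ?thesis using True by auto
  next
    case False
    then have "0 < n" by simp
    have "has_blocks R A n" unfolding A(2) by (rule block_number_attained)
    from M.R.blocks_imp_decomposition[OF noeth uniq M eps A0(1,2) M.R.mat_equivalent_sym[OF A(1)] this \<open>0 < n\<close>]
    show ?thesis by metis
  qed
  then obtain N where "direct_decomposition R M n N" "\<And>k. k < n \<Longrightarrow> N k \<noteq> {\<zero>\<^bsub>M\<^esub>}" by auto
  from M.decomposition_number_eqI[OF this max]
  show ?thesis unfolding n_def A0_def .
qed

end
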